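(* Let $U_0\in\mathcal{M}^N_{\geqslant}$, and define $$c_e=2\Big(\frac{\sqrt2E(U_0)}{\lambda_1}+c_\Omega^2\sqrt{E(U_0)\lambda_{\max}(\langle U_0,U_0\rangle)}\Big)\sqrt{NE(U_0)\lambda_{\max}(\langle U_0,U_0\rangle)}+\frac12.$$ Let $\{U_n\}$ be generated by the two-stage scheme with time steps satisfying, for all $n$, $$\tau_n<\min\Big(\frac{\lambda_1}{2c_e\lambda_{\max}(\langle U_0,U_0\rangle)},\ \frac{\lambda_1}{2\sqrt{2E(U_0)\lambda_{\max}(\langle U_0,U_0\rangle)}}\Big).$$ Then for all $n\geqslant0$, $$E(U_n)-E(U_{n+1})\geqslant\Big(\frac{\lambda_1}{2\lambda_{\max}(\langle U_0,U_0\rangle)}-c_e\tau_n\Big)\tau_n\|\mathcal{A}_{U_n}U_n\|_a^2.$$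
   Context: $\Omega\subset\mathbb{R}^d$ is a bounded domain, and $(\cdot,\cdot)$, $\|\cdot\|$ denote the $L^2(\Omega)$ inner product and norm. $\mathcal{V}:\Omega\to\mathbb{R}$ is a potential such that $a(u,v)=\int_\Omega(\nabla u\cdot\nabla v+\mathcal{V}uv)\,dx$ on $H_0^1(\Omega)$ is symmetric, bounded and coercive, with $c_1\|\nabla u\|^2\leqslant a(u,u)\leqslant c_2\|\nabla u\|^2$. $\|u\|_a=\sqrt{a(u,u)}$, and $c_\Omega>0$ is a constant with $\|u\|\leqslant c_\Omega\|u\|_a$ for all $u\in H_0^1(\Omega)$. $\lambda_1$ is the smallest eigenvalue of $a(u,v)=\lambda(u,v)$ for all $v$. $\mathcal{G}=(-\Delta+\mathcal{V})^{-1}$: $\mathcal{G}f\in H_0^1(\Omega)$ is the unique element with $a(\mathcal{G}f,v)=(f,v)$ for all $v\in H_0^1(\Omega)$. For $N$-tuples: - $\mathcal{G}U=(\mathcal{G}u_1,\dots,\mathcal{G}u_N)$; - $UA$ has $j$-th entry $\sum_iu_iA_{ij}$; - $\langle U,V\rangle=((u_i,v_j))_{i,j}$ and $\langle U,V\rangle_a=(a(u_i,v_j))_{i,j}$; - $\|U\|_a^2=\operatorname{tr}\langle U,U\rangle_a$. $E(U)=\frac12\|U\|_a^2$. $\lambda_{\max}$ denotes the largest eigenvalue. The quasi-Stiefel set is $\mathcal{M}^N_{\geqslant}=\{U:\langle U,U\rangle-I_N\text{ positive semidefinite}\}$. Define $\mathcal{A}_UV=\mathcal{G}U\langle U,V\rangle-U\langle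 U,\mathcal{G}V\rangle$. The two-stage scheme: given $U_n$ and $\tau_n>0$, $\hat U_{n+1}$ solves $$\hat U_{n+1}=U_n+\tau_n\mathcal{A}_{U_n}\Big(\tfrac{\hat U_{n+1}+U_n}{2}\Big),$$ and $$U_{n+1}=\hat U_{n+1}-\tau_n\mathcal{G}\hat U_{n+1}\big(\langle\hat U_{n+1},\hat U_{n+1}\rangle-I_N\big).$$ *)

theory Defs
  imports "HOL-Analysis.Analysis"
begin

text \<open>Abstract rendering of the setting. The type 'v plays the role of L2(Omega)
 (inner product and norm of real_inner), the set H plays the role of H_0^1(Omega),
 a is the bilinear form, G the solution operator. N-tuples are functions 'n => 'v
 with a finite index type 'n, so N = CARD('n). Gram matrices are real^'n^'n.\<close>

definition gram :: "('n::finite \<Rightarrow> 'v::real_inner) \<Rightarrow> ('n \<Rightarrow> 'v) \<Rightarrow> real^'n^'n" where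
  "gram U V = (\<chi> i j. inner (U i) (V j))"

definition gram_a :: "('v \<Rightarrow> 'v \<Rightarrow> real) \<Rightarrow> ('n::finite \<Rightarrow> 'v) \<Rightarrow> ('n \<Rightarrow> 'v) \<Rightarrow> real^'n^'n" where
  "gram_a a U V = (\<chi> i j. a (U i) (V j))"

definition tmul :: "('n::finite \<Rightarrow> 'v::real_vector) \<Rightarrow> real^'n^'n \<Rightarrow> ('n \<Rightarrow> 'v)" where
  "tmul U A = (\<lambda>j. \<Sum>i\<in>UNIV. (A $ i $ j) *\<^sub>R U i)"

definition tG :: "('v \<Rightarrow> 'v) \<Rightarrow> ('n \<Rightarrow> 'v) \<Rightarrow> ('n \<Rightarrow> 'v)" where
  "tG G U = (\<lambda>i. G (U i))"

definition mtrace :: "real^'n^'n \<Rightarrow> real" where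
  "mtrace M = (\<Sum>i\<in>UNIV. M $ i $ i)"

definition tnorm_a :: "('v \<Rightarrow> 'v \<Rightarrow> real) \<Rightarrow> ('n::finite \<Rightarrow> 'v) \<Rightarrow> real" where
  "tnorm_a a U = sqrt (mtrace (gram_a a U U))"

definition energy :: "('v \<Rightarrow> 'v \<Rightarrow> real) \<Rightarrow> ('n::finite \<Rightarrow> 'v) \<Rightarrow> real" where
  "energy a U = (1/2) * (tnorm_a a U)^2"

definition A_op :: "('v::real_inner \<Rightarrow> 'v) \<Rightarrow> ('n::finite \<Rightarrow> 'v) \<Rightarrow> ('n \<Rightarrow> 'v) \<Rightarrow> ('n \<Rightarrow> 'v)" where
  "A_op G U V = (\<lambda>j. tmul (tG G U) (gram U V) j - tmul U (gram U (tG G V)) j)"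

definition lambda_max :: "real^'n^'n \<Rightarrow> real" where
  "lambda_max M = Max {l. \<exists>x::real^'n. x \<noteq> 0 \<and> M *v x = l *\<^sub>R x}"

definition psd :: "real^'n^'n \<Rightarrow> bool" where
  "psd M \<longleftrightarrow> (\<forall>x::real^'n. 0 \<le> x \<bullet> (M *v x))"

definition quasi_stiefel :: "('n::finite \<Rightarrow> 'v::real_inner) \<Rightarrow> bool" where
  "quasi_stiefel U \<longleftrightarrow> psd (gram U U - mat 1)"

definition standing ::
  "'v::real_inner set \<Rightarrow> ('v \<Rightarrow> 'v \<Rightarrow> real) \<Rightarrow> ('v \<Rightarrow> 'v) \<Rightarrow> real \<Rightarrow> real \<Rightarrow> bool" where
  "standing H a G c\<Omega> lam1 \<longleftrightarrow>
     subspace H \<and>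
     (\<forall>u\<in>H. \<forall>v\<in>H. a u v = a v u) \<and>
     (\<forall>u\<in>H. \<forall>v\<in>H. \<forall>w\<in>H. \<forall>c. a (u + v) w = a u w + a v w \<and> a (c *\<^sub>R u) w = c * a u w) \<and>
     (\<forall>u\<in>H. 0 \<le> a u u) \<and>
     c\<Omega> > 0 \<and> (\<forall>u\<in>H. norm u \<le> c\<Omega> * sqrt (a u u)) \<and>
     \<comment> \<open>lambda1 is the smallest eigenvalue of a(u,v) = lambda (u,v)\<close>
     (\<exists>u\<in>H. u \<noteq> 0 \<and> (\<forall>v\<in>H. a u v = lam1 * inner u v)) \<and>
     (\<forall>\<mu>. \<forall>u\<in>H. u \<noteq> 0 \<and> (\<forall>v\<in>H. a u v = \<mu> * inner u v) \<longrightarrow> lam1 \<le> \<mu>) \<and>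
     \<comment> \<open>Rayleigh bound, true for the smallest eigenvalue in the concrete setting\<close>
     (\<forall>u\<in>H. lam1 * inner u u \<le> a u u) \<and>
     \<comment> \<open>G = (-Delta + V)^{-1}\<close>
     (\<forall>f. G f \<in> H \<and> (\<forall>v\<in>H. a (G f) v = inner f v))"

end

theory Submission
  imports Defs
begin

text \<open>
  After rescaling \<open>G\<close> and \<open>a\<close> one may assume lambda1 = 1. Write S for the Gram matrix of U, D = S - I for its defect,
  d = lambda_max(S0) - 1, and K, M for the Gram matrices of (Uh, G Uh) and (G Uh, G Uh). The first stage leaves S unchanged
  and the second turns D into D - x (K D + D K) + x^2 D M D. This can destroy D >= 0. It does preserve the bounds
  -eps <= D <= d and, for N >= 2, the inequality
  d <phi, D phi> - |D phi|^2 + d c |(G - mu) U phi|^2 >= 0 for all vectors phi and 0 <= mu <= 1, where c = 2 / (5 sqrt N):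
  with psi = phi - x K phi it is carried from psi to phi, up to errors of order x^2 that are controlled by the time step
  restriction.

  For the energy, let T be the \<open>a\<close>-Gram matrix of U and K0 = <U, G U>. The first stage dissipates x (tr(K0 T) - tr S^2) up to
  second order in x. This is half the squared Hilbert-Schmidt norm of an \<open>a\<close>-skew operator and dominates
  |A_U U|_a^2 / (2 lambda_max), with a quantified slack. The second stage gains x (tr D + tr D^2) up to second order.
  Summing the inequality above over an orthonormal eigenbasis of K0, with mu the respective eigenvalue, bounds tr D from below
  by what the slack and tr D^2 absorb.
\<close>

section \<open>Symmetric operators on Euclidean spaces\<close>

text \<open>The obstacle is \<open>K D + D K\<close>: unless K and D commute, it can push D below
  zero at second order in x. For fixed \<mu> put h = (G - \<mu>) U \<phi>. The errors of one step
  are bounded by products of two quantities linear in b |G^(1/2) h| and |D \<phi>|, where b^2 bounds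
  T. The step also has two first-order gains of just this kind: compared with their values at
  \<psi>, |h|^2 gains about 2 x |G^(1/2) h|^2 and |D \<phi>|^2 loses about 2 x (D \<phi>, K D
  \<phi>). The time step makes x b^2 l^2 sqrt N, with l = d + 1, small enough for the gains to win,
  so that a quadratic form in two variables remains to be checked. All \<mu> are carried along
  because \<mu> stays fixed during the propagation, while in the end each eigenvector of K0 needs
  its own eigenvalue. There (G - \<mu>) U \<phi> equals (A_U U) \<phi> up to G U D \<phi>, so a
  negative trace of D costs no more than the dissipation leaves over. The sqrt N in c belongs to a
  threshold for lambda_max(S): up to sqrt N, c lambda_max(S) is at most 2/5; beyond it tr D^2 alone
  outweighs the loss.\<close>

definition orthonormal :: "'a::real_inner set \<Rightarrow> bool" where
  "orthonormal B \<longleftrightarrow> finite B \<and> pairwise orthogonal B \<and> (\<forall>b\<in>B. norm b = 1)"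

lemma orthonormal_expand:
  fixes B :: "'a::real_inner set"
  assumes "orthonormal B" "v \<in> span B"
  shows "(\<Sum>b\<in>B. (v \<bullet> b) *\<^sub>R b) = v"
  using assms by (intro orthonormal_basis_expand) (auto simp: orthonormal_def)

text \<open>Basis independence of the trace. The bilinear form makes it apply alike to traces of
  products and to sums of \<open>a\<close>-norms. Expanding each \<open>b\<close> in
  \<open>C\<close> and then each \<open>c\<close> in \<open>B\<close> uses the same
  coefficients.\<close>

lemma orthonormal_sum_bilinear:
  fixes B C :: "'a::real_inner set" and \<beta> :: "'a \<Rightarrow> 'a \<Rightarrow> real"
  assumes B: "orthonormal B" "span B = UNIV" and C: "orthonormal C" "span C = UNIV"
    and lin: "\<And>v. linear (\<beta> v)" "\<And>v. linear (\<lambda>w. \<beta> w v)"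
  shows "(\<Sum>b\<in>B. \<beta> b b) = (\<Sum>c\<in>C. \<beta> c c)"
proof -
  have l: "\<beta> v (\<Sum>i\<in>I. f i *\<^sub>R g i) = (\<Sum>i\<in>I. f i * \<beta> v (g i))"
    "\<beta> (\<Sum>i\<in>I. f i *\<^sub>R g i) v = (\<Sum>i\<in>I. f i * \<beta> (g i) v)" for v I f and g :: "'a \<Rightarrow> 'a"
    using linear_sum[OF lin(1)[of v], of "\<lambda>i. f i *\<^sub>R g i" I] linear_sum[OF lin(2)[of v], of "\<lambda>i. f i *\<^sub>R g i" I]
    by (simp_all add: linear_scale[OF lin(1)] linear_scale[OF lin(2)])
  have "(\<Sum>b\<in>B. \<beta> b b) = (\<Sum>b\<in>B. \<beta> b (\<Sum>c\<in>C. (b \<bullet> c) *\<^sub>R c))"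
    using orthonormal_expand[OF C(1)] C(2) by simp
  also have "\<dots> = (\<Sum>b\<in>B. \<Sum>c\<in>C. (b \<bullet> c) * \<beta> b c)" by (simp add: l)
  also have "\<dots> = (\<Sum>c\<in>C. \<Sum>b\<in>B. (c \<bullet> b) * \<beta> b c)"
    by (subst sum.swap) (simp add: inner_commute)
  also have "\<dots> = (\<Sum>c\<in>C. \<beta> (\<Sum>b\<in>B. (c \<bullet> b) *\<^sub>R b) c)" by (simp add: l)
  also have "\<dots> = (\<Sum>c\<in>C. \<beta> c c)" using orthonormal_expand[OF B(1)] B(2) by simp
  finally show ?thesis .
qed

lemma orthonormal_Basis: "orthonormal (Basis :: 'a::euclidean_space set)" "span (Basis :: 'a set) = UNIV"
  by (auto simp: orthonormal_def pairwise_def orthogonal_def inner_Basis)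

lemma orthonormal_parseval:
  assumes B: "orthonormal B" "span B = UNIV"
  shows "(v \<bullet> w) = (\<Sum>b\<in>B. (v \<bullet> b) * (b \<bullet> w))"
proof -
  have "v \<bullet> w = (\<Sum>b\<in>B. (v \<bullet> b) *\<^sub>R b) \<bullet> w" using orthonormal_expand[OF B(1)] B(2) by simp
  also have "\<dots> = (\<Sum>b\<in>B. (v \<bullet> b) * (b \<bullet> w))" by (simp add: inner_sum_left)
  finally show ?thesis .
qed

text \<open>A maximiser \<open>e\<close> of the quadratic form on the unit sphere is an eigenvector:
  perturbing it along the residual \<open>g = f e - lam e\<close> gains 2 t |g|^2 at first order,
  which maximality forbids. The version on an invariant subspace is the one the induction below
  needs.\<close>

lemma quadratic_max_eigenvector:
  fixes f :: "'a::euclidean_space \<Rightarrow> 'a"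
  assumes lin: "linear f" and sym: "\<And>v w. f v \<bullet> w = v \<bullet> f w"
    and V: "subspace V" "\<And>v. v \<in> V \<Longrightarrow> f v \<in> V" and v0: "v0 \<in> V" "v0 \<noteq> 0"
  obtains e lam where "e \<in> V" "norm e = 1" "f e = lam *\<^sub>R e" "\<And>v. v \<in> V \<Longrightarrow> v \<bullet> f v \<le> lam * (v \<bullet> v)"
proof -
  let ?S = "V \<inter> sphere 0 1"
  have "compact ?S" using closed_subspace[OF V(1)] by (simp add: closed_Int_compact)
  moreover have "(1 / norm v0) *\<^sub>R v0 \<in> ?S" using v0 V(1) by (simp add: subspace_scale)
  then have "?S \<noteq> {}" by blast
  moreover have "continuous_on ?S (\<lambda>v. v \<bullet> f v)"
    using lin by (intro continuous_intros linear_continuous_on_compose[OF continuous_on_id]) 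
  ultimately obtain e where e: "e \<in> ?S" and mx: "\<And>v. v \<in> ?S \<Longrightarrow> v \<bullet> f v \<le> e \<bullet> f e"
    using continuous_attains_sup by metis
  define lam where "lam = e \<bullet> f e"
  have ne: "norm e = 1" "e \<in> V" using e by auto
  have le: "v \<bullet> f v \<le> lam * (v \<bullet> v)" if "v \<in> V" for v
  proof (cases "v = 0")
    case True then show ?thesis by (simp add: linear_0[OF lin])
  next
    case False
    have "(1 / norm v) *\<^sub>R v \<in> ?S" using that False V(1) by (simp add: subspace_scale)
    from mx[OF this] have "(1 / norm v)\<^sup>2 * (v \<bullet> f v) \<le> lam"
      by (simp add: linear_scale[OF lin] lam_def power2_eq_square)
    then have "(norm v)\<^sup>2 * ((1 / norm v)\<^sup>2 * (v \<bullet> f v)) \<le> (norm v)\<^sup>2 * lam" by (intro mult_left_mono) auto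
    then show ?thesis using False by (simp add: power_divide power2_norm_eq_inner mult.commute)
  qed
  define g where "g = f e - lam *\<^sub>R e"
  have gV: "g \<in> V" using ne V by (simp add: g_def subspace_diff subspace_scale)
  have eg: "e \<bullet> g = 0" using ne by (simp add: g_def lam_def inner_diff_right norm_eq_1)
  have fe: "f e = lam *\<^sub>R e + g" by (simp add: g_def)
  have key: "2 * t * (g \<bullet> g) \<le> t\<^sup>2 * (lam * (g \<bullet> g) - g \<bullet> f g)" for t
  proof -
    have "(e + t *\<^sub>R g) \<bullet> f (e + t *\<^sub>R g) \<le> lam * ((e + t *\<^sub>R g) \<bullet> (e + t *\<^sub>R g))"
      using ne gV V(1) by (intro le) (simp add: subspace_add subspace_scale)
    moreover have "e \<bullet> f g = g \<bullet> g"
      using eg by (simp add: sym[symmetric] fe inner_add_left)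
    moreover have "g \<bullet> f e = g \<bullet> g" using eg by (simp add: fe inner_add_right inner_commute)
    moreover have "e \<bullet> f e = lam" "e \<bullet> e = 1" using ne by (simp_all add: lam_def norm_eq_1)
    ultimately show ?thesis using eg
      by (simp add: linear_add[OF lin] linear_scale[OF lin] inner_add_left inner_add_right inner_commute[of g e]
          power2_eq_square algebra_simps)
  qed
  have "g \<bullet> g = 0"
  proof (rule ccontr)
    assume "g \<bullet> g \<noteq> 0"
    then have gp: "0 < g \<bullet> g" by simp
    define M where "M = lam * (g \<bullet> g) - g \<bullet> f g"
    have M0: "0 \<le> M" using le[OF gV] by (simp add: M_def)
    \<comment> \<open>Small enough for the quadratic loss \<open>t * M\<close> to stay below
      \<open>g \<bullet> g\<close>; the summand 1 covers \<open>M = 0\<close>.\<close>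
    define t where "t = (g \<bullet> g) / (M + 1)"
    have t0: "0 < t" using gp M0 by (simp add: t_def)
    have "2 * t * (g \<bullet> g) \<le> t * (t * M)" using key[of t] by (simp add: M_def power2_eq_square mult.assoc)
    then have "2 * (g \<bullet> g) \<le> t * M" using t0 by (simp add: mult.assoc mult.left_commute)
    also have "\<dots> \<le> t * (M + 1)" using t0 by simp
    also have "\<dots> = g \<bullet> g" using M0 by (simp add: t_def)
    finally show False using gp by simp
  qed
  then have "f e = lam *\<^sub>R e" using fe by simp
  with that[OF ne(2,1) _ le] show thesis by blast
qed

text \<open>Deflation: by symmetry of \<open>f\<close> the orthogonal complement of an eigenvector
  is again invariant, and its dimension is one less.\<close>

lemma spectral_subspace:
  fixes f :: "'a::euclidean_space \<Rightarrow> 'a"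
  assumes lin: "linear f" and sym: "\<And>v w. f v \<bullet> w = v \<bullet> f w"
  shows "subspace V \<Longrightarrow> (\<And>v. v \<in> V \<Longrightarrow> f v \<in> V) \<Longrightarrow>
    \<exists>B k. orthonormal B \<and> B \<subseteq> V \<and> V \<subseteq> span B \<and> (\<forall>b\<in>B. f b = k b *\<^sub>R b)"
proof (induction "dim V" arbitrary: V rule: less_induct)
  case less
  show ?case
  proof (cases "\<exists>v0\<in>V. v0 \<noteq> 0")
    case False
    then have "V \<subseteq> span {}" by auto
    then show ?thesis by (intro exI[of _ "{}"]) (auto simp: orthonormal_def)
  next
    case True
    then obtain e lam where e: "e \<in> V" "norm e = 1" "f e = lam *\<^sub>R e"
      using quadratic_max_eigenvector[OF lin sym less.prems] by metis
    let ?W = "{v \<in> V. \<forall>w \<in> span {e}. orthogonal w v}"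
    have W: "?W = {v \<in> V. e \<bullet> v = 0}"
      by (auto simp: span_singleton orthogonal_def)
    have sW: "subspace ?W" unfolding W using less.prems(1)
      by (auto simp: subspace_def inner_add_right)
    have fW: "f v \<in> ?W" if "v \<in> ?W" for v
      using that less.prems(2) unfolding W by (auto simp: sym[symmetric] e(3))
    have "dim ?W + dim (span {e}) = dim V"
      using e less.prems(1) by (intro dim_subspace_orthogonal_to_vectors) (auto simp: span_minimal)
    moreover have "dim (span {e}) = 1" using e by (auto simp: dim_singleton)
    ultimately have "dim ?W < dim V" by linarith
    from less.hyps[OF this sW fW] obtain B k where B: "orthonormal B" "B \<subseteq> ?W" "?W \<subseteq> span B" "\<forall>b\<in>B. f b = k b *\<^sub>R b"
      by blast
    have eB: "e \<notin> B" using B(2) e(2) unfolding W by auto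
    have "orthonormal (insert e B)" using B(1,2) e(2) unfolding W
      by (auto simp: orthonormal_def pairwise_insert orthogonal_def inner_commute)
    moreover have "insert e B \<subseteq> V" using B(2) e by auto
    moreover have "V \<subseteq> span (insert e B)"
    proof
      fix v assume v: "v \<in> V"
      have "v - (e \<bullet> v) *\<^sub>R e \<in> ?W" unfolding W using v e less.prems(1)
        by (auto simp: subspace_diff subspace_scale inner_diff_right norm_eq_1)
      then have "v - (e \<bullet> v) *\<^sub>R e \<in> span B" using B(3) by blast
      then show "v \<in> span (insert e B)" unfolding span_insert by blast
    qed
    moreover have "\<forall>b\<in>insert e B. f b = (k(e := lam)) b *\<^sub>R b" using B(4) e(3) eB by auto
    ultimately show ?thesis by blast
  qed
qed

theorem spectral_theorem:
  fixes f :: "'a::euclidean_space \<Rightarrow> 'a"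
  assumes "linear f" "\<And>v w. f v \<bullet> w = v \<bullet> f w"
  obtains B k where "orthonormal B" "span B = UNIV" "\<And>b. b \<in> B \<Longrightarrow> f b = k b *\<^sub>R b"
  using spectral_subspace[OF assms, of UNIV] by auto

text \<open>The largest of nonnegative eigenvalues is at most their sum. This turns bounds on
  energies, which are traces, into operator bounds.\<close>

lemma psd_le_trace:
  fixes f :: "'a::euclidean_space \<Rightarrow> 'a"
  assumes lin: "linear f" and sym: "\<And>v w. f v \<bullet> w = v \<bullet> f w" and pos: "\<And>v. 0 \<le> v \<bullet> f v"
  shows "v \<bullet> f v \<le> (\<Sum>b\<in>Basis. b \<bullet> f b) * (v \<bullet> v)"
proof -
  obtain B k where B: "orthonormal B" "span B = UNIV" "\<And>b. b \<in> B \<Longrightarrow> f b = k b *\<^sub>R b"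
    using spectral_theorem[OF lin sym] by metis
  have bb: "b \<bullet> b = 1" if "b \<in> B" for b using that B(1) by (simp add: orthonormal_def norm_eq_1)
  have k0: "0 \<le> k b" if "b \<in> B" for b using pos[of b] B(3)[OF that] bb[OF that] by simp
  have tr: "(\<Sum>b\<in>Basis. b \<bullet> f b) = (\<Sum>b\<in>B. k b)"
  proof -
    have "(\<Sum>b\<in>Basis. b \<bullet> f b) = (\<Sum>b\<in>B. b \<bullet> f b)"
      by (rule orthonormal_sum_bilinear[OF orthonormal_Basis B(1,2)])
        (auto intro!: linearI simp: inner_add_left inner_add_right linear_add[OF lin] linear_scale[OF lin])
    also have "\<dots> = (\<Sum>b\<in>B. k b)" using B(3) bb by (intro sum.cong) auto
    finally show ?thesis .
  qed
  have "v \<bullet> f v = (\<Sum>b\<in>B. (v \<bullet> b) * (b \<bullet> f v))" by (rule orthonormal_parseval[OF B(1,2)])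
  also have "\<dots> = (\<Sum>b\<in>B. k b * (v \<bullet> b)\<^sup>2)"
    using B(3) by (intro sum.cong) (auto simp: sym[symmetric] power2_eq_square inner_commute[of v])
  also have "\<dots> \<le> (\<Sum>b\<in>B. k b * (v \<bullet> v))"
  proof (intro sum_mono mult_left_mono)
    fix b assume b: "b \<in> B"
    have "(v \<bullet> b)\<^sup>2 \<le> (v \<bullet> v) * (b \<bullet> b)" by (rule Cauchy_Schwarz_ineq)
    then show "(v \<bullet> b)\<^sup>2 \<le> v \<bullet> v" using bb[OF b] by simp
  qed (rule k0)
  also have "\<dots> = (\<Sum>b\<in>Basis. b \<bullet> f b) * (v \<bullet> v)" by (simp add: tr sum_distrib_right)
  finally show ?thesis .
qed

text \<open>Polarisation with \<open>w\<close> parallel to \<open>f v\<close> and scaled to the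
  length of \<open>v\<close>: then 4 (w, f v) is a difference of two values of the quadratic form,
  and the parallelogram law gives the bound in any inner product space.\<close>

lemma sym_norm_le:
  fixes f :: "'a::real_inner \<Rightarrow> 'a"
  assumes lin: "linear f" and sym: "\<And>v w. f v \<bullet> w = v \<bullet> f w"
    and up: "\<And>v. v \<bullet> f v \<le> d * (v \<bullet> v)" and lo: "\<And>v. - d * (v \<bullet> v) \<le> v \<bullet> f v"
  shows "norm (f v) \<le> d * norm v"
proof (cases "f v = 0 \<or> v = 0")
  case True
  show ?thesis
  proof (cases "v = 0")
    case False
    then have "0 < v \<bullet> v" by simp
    moreover have "0 \<le> d * (v \<bullet> v)" using up[of v] lo[of v] by linarith
    ultimately have "0 \<le> d" by (metis zero_le_mult_iff linorder_not_less)
    then show ?thesis using True False by simp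
  qed (simp add: linear_0[OF lin])
next
  case False
  define s where "s = norm v / norm (f v)"
  define w where "w = s *\<^sub>R f v"
  have nw: "w \<bullet> w = v \<bullet> v" using False
    by (simp add: w_def s_def power2_norm_eq_inner[symmetric] power2_eq_square)
  have "4 * (w \<bullet> f v) = (w + v) \<bullet> f (w + v) - (w - v) \<bullet> f (w - v)"
  proof -
    have "v \<bullet> f w = w \<bullet> f v" by (metis sym inner_commute)
    then show ?thesis
      by (simp add: linear_add[OF lin] linear_diff[OF lin] inner_add_left inner_add_right inner_diff_left inner_diff_right)
  qed
  also have "\<dots> \<le> d * ((w + v) \<bullet> (w + v)) + d * ((w - v) \<bullet> (w - v))"
    using up[of "w + v"] lo[of "w - v"] by simp
  also have "\<dots> = 4 * (d * (v \<bullet> v))"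
    using nw by (simp add: inner_add_left inner_add_right inner_diff_left inner_diff_right algebra_simps)
  finally have "w \<bullet> f v \<le> d * (v \<bullet> v)" by simp
  moreover have "w \<bullet> f v = norm v * norm (f v)" using False
    by (simp add: w_def s_def power2_norm_eq_inner[symmetric] power2_eq_square)
  ultimately have "norm v * norm (f v) \<le> norm v * (d * norm v)"
    by (simp add: power2_norm_eq_inner[symmetric] power2_eq_square algebra_simps)
  then show ?thesis using False by simp
qed

section \<open>The scalar inequality behind the propagation\<close>

text \<open>Resolves the implicit inequality for \<open>ww\<close>: since x l^2 is at most \<pi>, it
  yields \<open>l * ww \<le> q * (\<beta> + n)\<close> with \<open>q\<close> about \<pi> / (1 -
  \<pi>/2), and the remaining quantities follow by substitution. The parameters \<open>vb\<close>,
  \<open>vn\<close>, \<open>al1\<close>, \<open>al2\<close>, \<open>eb\<close>, \<open>en\<close>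
  are free upper bounds, so that round decimals can be inserted later.\<close>

lemma slop_bounds:
  fixes l d x \<beta> n ww ww' \<rho>n R0 e1 \<pi> q vb vn al1 al2 eb en :: real
  assumes l: "1 \<le> l" "d = l - 1" and x: "0 < x" "x * l\<^sup>2 \<le> \<pi>"
    and nn: "0 \<le> \<beta>" "0 \<le> n" "0 \<le> ww" "0 \<le> ww'"
    and ww: "ww \<le> x * l * (\<beta> + n + (1/2) * ww)"
    and ww': "ww' \<le> (1/2) * ww + x * ((1/2) * (1 + l) * \<beta> + (1/2) * l * n + (1/4) * l * ww)"
    and \<rho>: "\<rho>n \<le> n + \<beta> + ww + x * l * (\<beta> + ww')"
    and R: "R0 \<le> x * (d * \<beta> + l * n + (1/2) * l * ww)"
    and e: "e1 \<le> l * n + (1/2) * l * ww + (1/2) * (x * l) * l * \<beta> + l * ww'"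
    and cs: "\<pi> \<le> q * (1 - \<pi> / 2)" "\<pi> < 1" "0 \<le> q" "(1/2) * q + \<pi> + (1/4) * \<pi> * q \<le> vb"
      "(1/2) * q + (1/2) * \<pi> + (1/4) * \<pi> * q \<le> vn" "q + \<pi> * (1 + vb) \<le> al1" "q + \<pi> * vn \<le> al2"
      "(1/2) * q + (1/2) * \<pi> + vb \<le> eb" "(1/2) * q + vn \<le> en"
  shows "l * \<rho>n \<le> (l + al1) * \<beta> + (l + al2) * n"
    and "R0 \<le> x * ((d + q / 2) * \<beta> + (l + q / 2) * n)"
    and "e1 \<le> eb * \<beta> + (l + en) * n"
proof -
  have \<pi>0: "0 \<le> \<pi>" using x by (smt (verit) mult_nonneg_nonneg zero_le_power2)
  have p: "0 \<le> x * l" "x * l * l \<le> \<pi>" using x l by (simp_all add: power2_eq_square mult.assoc)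
  have p1: "x * l \<le> \<pi>" using p l mult_left_mono[of 1 l "x * l"] by simp
  have "l * ww \<le> (x * l * l) * (\<beta> + n + (1/2) * ww)"
    using mult_left_mono[OF ww, of l] l by (simp add: algebra_simps)
  also have "\<dots> \<le> \<pi> * (\<beta> + n + (1/2) * ww)" using p nn by (intro mult_right_mono) auto
  also have "\<dots> \<le> \<pi> * (\<beta> + n) + \<pi> / 2 * (l * ww)"
    using mult_right_mono[of 1 l ww] l nn \<pi>0 by (simp add: algebra_simps mult_left_mono)
  finally have "(1 - \<pi> / 2) * (l * ww) \<le> \<pi> * (\<beta> + n)" by (simp add: algebra_simps)
  also have "\<dots> \<le> (q * (1 - \<pi> / 2)) * (\<beta> + n)" using cs nn by (intro mult_right_mono) auto
  finally have "(1 - \<pi> / 2) * (l * ww) \<le> (1 - \<pi> / 2) * (q * (\<beta> + n))" by (simp add: algebra_simps add_divide_distrib)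
  then have lw: "l * ww \<le> q * (\<beta> + n)" using cs by (simp add: mult_le_cancel_left)
  have w1: "ww \<le> q * (\<beta> + n)" using lw mult_right_mono[of 1 l ww] l nn by linarith
  have "l * ww' \<le> (1/2) * (l * ww) + (x * l) * ((1/2) * (1 + l) * \<beta> + (1/2) * l * n + (1/4) * l * ww)"
    using mult_left_mono[OF ww', of l] l by (simp add: algebra_simps)
  also have "\<dots> \<le> (1/2) * (l * ww) + ((x * l * l) * \<beta> + (1/2) * (x * l * l) * n + (1/4) * (x * l * l) * ww)"
  proof -
    have "(x * l) * ((1/2) * (1 + l) * \<beta>) \<le> (x * l) * (l * \<beta>)"
      using p l nn by (intro mult_left_mono mult_right_mono) auto
    then show ?thesis by (simp add: algebra_simps)
  qed
  also have "\<dots> \<le> (1/2) * (q * (\<beta> + n)) + (\<pi> * \<beta> + (1/2) * \<pi> * n + (1/4) * \<pi> * (q * (\<beta> + n)))"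
  proof -
    have "(x * l * l) * \<beta> \<le> \<pi> * \<beta>" "(x * l * l) * n \<le> \<pi> * n" using p nn by (auto intro: mult_right_mono)
    moreover have "(x * l * l) * ww \<le> \<pi> * (q * (\<beta> + n))" using p nn w1 \<pi>0 by (intro mult_mono) auto
    ultimately show ?thesis using lw by linarith
  qed
  also have "\<dots> = ((1/2) * q + \<pi> + (1/4) * \<pi> * q) * \<beta> + ((1/2) * q + (1/2) * \<pi> + (1/4) * \<pi> * q) * n"
    by (simp add: algebra_simps)
  also have "\<dots> \<le> vb * \<beta> + vn * n" using cs nn by (intro add_mono mult_right_mono) auto
  finally have lw': "l * ww' \<le> vb * \<beta> + vn * n" .
  have w1': "ww' \<le> vb * \<beta> + vn * n" using lw' mult_right_mono[of 1 l ww'] l nn by linarith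
  have "l * \<rho>n \<le> l * (n + \<beta>) + l * ww + (x * l * l) * (\<beta> + ww')"
    using mult_left_mono[OF \<rho>, of l] l by (simp add: algebra_simps)
  also have "\<dots> \<le> l * (n + \<beta>) + q * (\<beta> + n) + \<pi> * (\<beta> + (vb * \<beta> + vn * n))"
  proof -
    have "(x * l * l) * (\<beta> + ww') \<le> \<pi> * (\<beta> + (vb * \<beta> + vn * n))" using p nn w1' \<pi>0 by (intro mult_mono) auto
    then show ?thesis using lw by linarith
  qed
  also have "\<dots> = (l + (q + \<pi> * (1 + vb))) * \<beta> + (l + (q + \<pi> * vn)) * n" by (simp add: algebra_simps)
  also have "\<dots> \<le> (l + al1) * \<beta> + (l + al2) * n" using cs nn by (intro add_mono mult_right_mono) auto
  finally show "l * \<rho>n \<le> (l + al1) * \<beta> + (l + al2) * n" .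
  have "R0 \<le> x * (d * \<beta> + l * n + (1/2) * (q * (\<beta> + n)))"
  proof -
    have "d * \<beta> + l * n + (1/2) * l * ww \<le> d * \<beta> + l * n + (1/2) * (q * (\<beta> + n))" using lw by linarith
    from order_trans[OF R mult_left_mono[OF this]] x show ?thesis by simp
  qed
  then show "R0 \<le> x * ((d + q / 2) * \<beta> + (l + q / 2) * n)" by (simp add: algebra_simps)
  have "e1 \<le> l * n + (1/2) * (l * ww) + (1/2) * (x * l * l) * \<beta> + l * ww'"
    using e by (simp add: algebra_simps)
  also have "\<dots> \<le> l * n + (1/2) * (q * (\<beta> + n)) + (1/2) * \<pi> * \<beta> + (vb * \<beta> + vn * n)"
    using lw lw' p nn by (intro add_mono mult_left_mono mult_right_mono) auto
  also have "\<dots> = ((1/2) * q + (1/2) * \<pi> + vb) * \<beta> + (l + ((1/2) * q + vn)) * n" by (simp add: algebra_simps)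
  also have "\<dots> \<le> eb * \<beta> + (l + en) * n" using cs nn by (intro add_mono mult_right_mono) auto
  finally show "e1 \<le> eb * \<beta> + (l + en) * n" .
qed

text \<open>Weighted arithmetic-geometric mean with weights \<tau> d and T. Unlike a discriminant,
  the two conditions are linear in \<open>a\<close>, \<open>b\<close>, \<open>c\<close>, so they
  stay polynomial inequalities of moderate degree once the coefficients are inserted.\<close>

lemma quad_form_nonneg:
  fixes a b c d \<beta> \<nu> \<tau> T :: real
  assumes "0 \<le> d" "0 < \<tau>" "0 < T" "0 \<le> \<beta>" "0 \<le> \<nu>" "0 \<le> b"
    and "\<tau> * b * d / 2 \<le> a * T" "b * T / 2 \<le> c * \<tau>"
  shows "0 \<le> d * a * \<beta>\<^sup>2 - d * b * (\<beta> * \<nu>) + c * \<nu>\<^sup>2"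
proof -
  have "0 \<le> b / 2 * (\<tau> * d * \<beta> - T * \<nu>)\<^sup>2" using assms by simp
  also have "\<dots> = (\<tau> * d * \<beta>\<^sup>2) * (\<tau> * b * d / 2) - \<tau> * T * (d * b * (\<beta> * \<nu>)) + (T * \<nu>\<^sup>2) * (b * T / 2)"
    by (simp add: power2_eq_square algebra_simps)
  also have "\<dots> \<le> (\<tau> * d * \<beta>\<^sup>2) * (a * T) - \<tau> * T * (d * b * (\<beta> * \<nu>)) + (T * \<nu>\<^sup>2) * (c * \<tau>)"
    using assms by (intro add_mono diff_mono mult_left_mono) auto
  also have "\<dots> = (\<tau> * T) * (d * a * \<beta>\<^sup>2 - d * b * (\<beta> * \<nu>) + c * \<nu>\<^sup>2)"
    by (simp add: algebra_simps)
  finally have "0 \<le> (\<tau> * T) * (d * a * \<beta>\<^sup>2 - d * b * (\<beta> * \<nu>) + c * \<nu>\<^sup>2)" .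
  moreover have "0 < \<tau> * T" using assms by simp
  ultimately show ?thesis by (simp only: zero_le_mult_iff) linarith
qed

text \<open>After normalisation, the change of the invariant over one step is bounded below by x^2 times \<open>excess\<close>.\<close>

definition "excess (x::real) \<mu> l d c L n \<beta> \<gamma> \<kappa> \<rho>n chn R0 e1 =
      2 / x * (1 - x * \<mu>) * \<kappa>\<^sup>2 - 2 * L * d * \<kappa> * (\<rho>n + chn) - l * (1 + x * d)\<^sup>2 * \<kappa>\<^sup>2
      - (chn / (1 - x * \<mu>))\<^sup>2 - d * (2 / (1 - x * \<mu>) * n * \<rho>n + d * \<rho>n\<^sup>2)
      + 2 * d * c * ((1 - x * \<mu>) / x * (\<gamma>\<^sup>2 - (1/2) * L * \<gamma> * R0 - x * l * L * \<gamma> * n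
        - x * ((3/8) * l\<^sup>2 * \<beta>\<^sup>2 + \<beta> * (2 * d * \<beta> + e1)))
     - \<rho>n * (L * \<gamma> + (1/2) * l * R0 + x * l\<^sup>2 * n
        + x * l * ((3/2) * (1 + l) * \<beta> + 2 * d * \<beta> + e1)))"

text \<open>Coefficients of a quadratic form in \<open>\<beta>\<close> and \<open>\<nu>\<close> (an upper bound of \<open>n\<close>) lying below \<open>l^2\<close> times \<open>excess\<close>.\<close>

definition "coeffA (l::real) d r s \<pi> k q2 al1 eb j1 W u = l\<^sup>2 * (8/5 * (l\<^sup>2 - \<pi> + 19/20 * r * (l - \<pi>)) - k * (s / 2 * (d + q2) + 3/8 * l\<^sup>2 + 2 * d + eb))
       - k * l * (l + al1) * (s + j1) - d * (l + al1)\<^sup>2 - \<pi> * (u - 1) * W\<^sup>2 * (l + al1)\<^sup>2"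

definition "coeffB (l::real) d s \<pi> k q2 al1 al2 en j1 j2 W u = l\<^sup>2 * k * (s / 2 * (l + q2) + l * s + l + en) + k * l * ((l + al1) * j2 + (l + al2) * (s + j1))
       + 2 * W * l * (l + al1) + 2 * d * (l + al1) * (l + al2) + 2 * u * s * l * (l + al1)
       + 2 * \<pi> * W\<^sup>2 * (l * (l + al1) + (u - 1) * (l + al1) * (l + al2))"

definition "coeffC (l::real) d r s \<pi> k al2 j2 W u = l\<^sup>2 * (21/4 * (l\<^sup>2 - \<pi> + 19/20 * r * (l - \<pi>)) - u\<^sup>2 * r) - W\<^sup>2 * (l + (u - 1) * (l + al2))\<^sup>2
       - d * l * (k * (l + al2) * j2 + 2 * W * (l + al2) + 2 * s * (u * (l + al2) + l)) - d\<^sup>2 * (l + al2)\<^sup>2"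

text \<open>Term-by-term estimate of \<open>excess\<close>. Here \<open>s\<close> bounds L / b and
  \<open>r\<close> stands for l / b^2; the hypotheses with 21/8 and 4/5 are what the time step gives
  for the two gains \<kappa>^2 / x and c \<gamma>^2 / x. The factor l^2 appears because \<rho> is
  controlled only through \<open>l * \<rho>n\<close>.\<close>

lemma form_bound:
  fixes l d x r s \<beta> \<nu> n \<rho>n R0 e1 chn \<kappa> \<gamma> L c \<mu> \<pi> q2 al1 al2 eb en j1 j2 W u k :: real
  assumes l: "1 \<le> l" "d = l - 1" and x: "0 < x" "x * l\<^sup>2 \<le> \<pi>" and \<pi>: "\<pi> < 1" and \<mu>: "0 \<le> \<mu>" "\<mu> \<le> 1"
    and nn: "0 \<le> \<beta>" "0 \<le> n" "n \<le> \<nu>" "0 \<le> \<rho>n" "0 \<le> R0" "0 \<le> e1" "0 \<le> chn" "0 \<le> \<kappa>" "0 \<le> \<gamma>" "0 \<le> L"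
      "0 \<le> r" "0 \<le> s" "0 \<le> c" "0 \<le> al1" "0 \<le> al2"
    and \<rho>: "l * \<rho>n \<le> (l + al1) * \<beta> + (l + al2) * \<nu>"
    and R: "R0 \<le> x * ((d + q2) * \<beta> + (l + q2) * \<nu>)"
    and e: "e1 \<le> eb * \<beta> + (l + en) * \<nu>"
    and ch: "chn \<le> n + x * d * \<rho>n"
    and Lg: "L * \<gamma> \<le> s * \<beta>" and Lk: "L * \<kappa> \<le> s * \<nu>" and lk: "l * \<kappa>\<^sup>2 \<le> r * \<nu>\<^sup>2"
    and gk: "21/8 * (l\<^sup>2 + 19/20 * r * l) * \<nu>\<^sup>2 \<le> \<kappa>\<^sup>2 / x"
    and gg: "4/5 * (l\<^sup>2 + 19/20 * r * l) * \<beta>\<^sup>2 \<le> c * \<gamma>\<^sup>2 / x"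
    and cs: "2 * c \<le> k" "1 / (1 - \<pi>) \<le> W" "1 + \<pi> / 4 \<le> u" "4 * \<pi> + \<pi> * eb \<le> j1"
      "\<pi> / 2 * (1 + q2) + \<pi> + \<pi> * (1 + en) \<le> j2" "0 \<le> q2" "q2 \<le> 1" "0 \<le> eb" "0 \<le> en"
  shows "d * coeffA l d r s \<pi> k q2 al1 eb j1 W u * \<beta>\<^sup>2
      - d * coeffB l d s \<pi> k q2 al1 al2 en j1 j2 W u * (\<beta> * \<nu>)
      + coeffC l d r s \<pi> k al2 j2 W u * \<nu>\<^sup>2
   \<le> l\<^sup>2 * excess x \<mu> l d c L n \<beta> \<gamma> \<kappa> \<rho>n chn R0 e1"
proof -
  define G where "G = l\<^sup>2 - \<pi> + 19/20 * r * (l - \<pi>)"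
  define A1 where "A1 = l + al1"
  define A2 where "A2 = l + al2"
  define a where "a = A1 * \<beta> + A2 * \<nu>"
  have d0: "0 \<le> d" and l0: "0 < l" using l by auto
  have \<nu>0: "0 \<le> \<nu>" using nn by linarith
  have \<pi>0: "0 \<le> \<pi>" using x by (smt (verit) mult_nonneg_nonneg zero_le_power2)
  have p: "0 \<le> x * l" "x * l * l \<le> \<pi>" using x l by (simp_all add: power2_eq_square mult.assoc)
  have p1: "x * l \<le> \<pi>" using p l mult_left_mono[of 1 l "x * l"] by simp
  have "x * 1 \<le> x * l" using x l by (intro mult_left_mono) auto
  then have x1: "x \<le> \<pi>" using p1 by linarith
  have xm: "0 \<le> x * \<mu>" "x * \<mu> \<le> x" using x \<mu> mult_left_mono[of \<mu> 1 x] by auto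
  have om: "0 < 1 - x * \<mu>" "1 - x \<le> 1 - x * \<mu>" "1 - x * \<mu> \<le> 1" "0 \<le> 1 - x" using xm x1 \<pi> by linarith+
  have A0: "0 \<le> A1" "0 \<le> A2" using l nn by (simp_all add: A1_def A2_def)
  have a0: "0 \<le> a" using A0 nn \<nu>0 by (simp add: a_def)
  have la: "l * \<rho>n \<le> a" using \<rho> by (simp add: a_def A1_def A2_def)
  have W0: "0 < W" "1 / (1 - x * \<mu>) \<le> W"
  proof -
    have "1 / (1 - x * \<mu>) \<le> 1 / (1 - \<pi>)" using om x1 \<pi> by (intro divide_left_mono) auto
    then show w: "1 / (1 - x * \<mu>) \<le> W" using cs by linarith
    have "0 < 1 / (1 - x * \<mu>)" using om by simp
    with w show "0 < W" by linarith
  qed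
  have u0: "0 \<le> u - 1" "0 \<le> u" using cs \<pi>0 by linarith+
  have xd: "0 \<le> x * d" "x * d \<le> u - 1" "x * d \<le> d * \<pi>"
  proof -
    show "0 \<le> x * d" using x d0 by simp
    \<comment> \<open>With l = 1 + d this is (l - 2)^2 \<ge> 0; it replaces x d by at most \<pi> /
      4, whence the bound on \<open>u\<close>.\<close>
    have "4 * d \<le> l\<^sup>2" using zero_le_power2[of "l - 2"] l by (simp add: power2_eq_square algebra_simps)
    then have "4 * (x * d) \<le> x * l\<^sup>2" using mult_left_mono[of "4 * d" "l\<^sup>2" x] x by simp
    then show "x * d \<le> u - 1" using x cs by linarith
    show "x * d \<le> d * \<pi>" using mult_left_mono[OF x1 d0] by (simp add: mult.commute)
  qed
  have k0: "0 \<le> k" using cs nn by linarith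
  have G1: "G \<le> (1 - x) * (l\<^sup>2 + 19/20 * r * l)"
  proof -
    have "x * l * r \<le> \<pi> * r" using p1 nn by (intro mult_right_mono) auto
    moreover have "(1 - x) * (l\<^sup>2 + 19/20 * r * l) = l\<^sup>2 - x * l\<^sup>2 + 19/20 * (r * l) - 19/20 * (x * l * r)"
      by (simp add: algebra_simps add_divide_distrib diff_divide_distrib)
    moreover have "G = l\<^sup>2 - \<pi> + 19/20 * (r * l) - 19/20 * (\<pi> * r)" by (simp add: G_def algebra_simps add_divide_distrib diff_divide_distrib)
    ultimately show ?thesis using x by linarith
  qed
  have X1: "21/4 * G * \<nu>\<^sup>2 \<le> 2 / x * (1 - x * \<mu>) * \<kappa>\<^sup>2"
  proof -
    have "21/4 * G * \<nu>\<^sup>2 \<le> 21/4 * ((1 - x) * (l\<^sup>2 + 19/20 * r * l)) * \<nu>\<^sup>2"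
      using G1 by (intro mult_right_mono mult_left_mono) auto
    also have "\<dots> = 2 * ((1 - x) * (21/8 * (l\<^sup>2 + 19/20 * r * l) * \<nu>\<^sup>2))" by simp
    also have "\<dots> \<le> 2 * ((1 - x * \<mu>) * (\<kappa>\<^sup>2 / x))"
      using gk om l0 nn by (intro mult_left_mono mult_mono) auto
    finally show ?thesis by (simp add: algebra_simps)
  qed
  have X2: "l\<^sup>2 * (2 * L * d * \<kappa> * (\<rho>n + chn)) \<le> 2 * d * s * \<nu> * (l * a * u + l\<^sup>2 * \<nu>)"
  proof -
    have "\<rho>n + chn \<le> u * \<rho>n + \<nu>"
      using ch nn mult_right_mono[OF xd(2), of \<rho>n] by (simp add: algebra_simps)
    then have "l\<^sup>2 * (\<rho>n + chn) \<le> l\<^sup>2 * (u * \<rho>n + \<nu>)" by (intro mult_left_mono) auto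
    also have "\<dots> = (l * u) * (l * \<rho>n) + l\<^sup>2 * \<nu>" by (simp add: power2_eq_square algebra_simps)
    also have "\<dots> \<le> (l * u) * a + l\<^sup>2 * \<nu>" using la u0 l0 by (intro add_right_mono mult_left_mono) auto
    finally have 1: "l\<^sup>2 * (\<rho>n + chn) \<le> l * a * u + l\<^sup>2 * \<nu>" by (simp add: algebra_simps)
    have "(2 * d * (L * \<kappa>)) * (l\<^sup>2 * (\<rho>n + chn)) \<le> (2 * d * (s * \<nu>)) * (l * a * u + l\<^sup>2 * \<nu>)"
    proof (rule mult_mono[OF mult_left_mono[OF Lk] 1])
      show "0 \<le> 2 * d * (s * \<nu>)" using d0 nn \<nu>0 by simp
      show "0 \<le> l\<^sup>2 * (\<rho>n + chn)" using nn by simp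
    qed (use d0 in simp)
    then show ?thesis by (simp add: algebra_simps)
  qed
  have X3: "l * (1 + x * d)\<^sup>2 * \<kappa>\<^sup>2 \<le> u\<^sup>2 * r * \<nu>\<^sup>2"
  proof -
    have "(1 + x * d)\<^sup>2 \<le> u\<^sup>2" using xd by (intro power_mono) auto
    then have "(1 + x * d)\<^sup>2 * (l * \<kappa>\<^sup>2) \<le> u\<^sup>2 * (r * \<nu>\<^sup>2)"
      using lk l0 by (rule_tac mult_mono) auto
    then show ?thesis by (simp add: algebra_simps)
  qed
  have X4: "l\<^sup>2 * (chn / (1 - x * \<mu>))\<^sup>2 \<le> W\<^sup>2 * (d * (\<pi> * (u - 1) * A1\<^sup>2) * \<beta>\<^sup>2
      + d * (2 * \<pi> * (l * A1 + (u - 1) * A1 * A2)) * (\<beta> * \<nu>) + (l + (u - 1) * A2)\<^sup>2 * \<nu>\<^sup>2)"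
  proof -
    have "l * chn \<le> l * \<nu> + x * d * (l * \<rho>n)"
    proof -
      have "l * chn \<le> l * (\<nu> + x * d * \<rho>n)" using ch nn l0 by (intro mult_left_mono) auto
      then show ?thesis by (simp add: algebra_simps)
    qed
    also have "\<dots> \<le> l * \<nu> + x * d * a" using la xd by (intro add_left_mono mult_left_mono) auto
    finally have lc: "l * chn \<le> (x * d) * A1 * \<beta> + (l + (x * d) * A2) * \<nu>" by (simp add: a_def algebra_simps)
    have "(l * chn)\<^sup>2 \<le> ((x * d) * A1 * \<beta> + (l + (x * d) * A2) * \<nu>)\<^sup>2"
      using lc l0 nn by (intro power_mono) auto
    also have "\<dots> = ((x * d) * (x * d)) * (A1\<^sup>2 * \<beta>\<^sup>2) + 2 * (x * d) * (A1 * (l + (x * d) * A2) * (\<beta> * \<nu>))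
        + (l + (x * d) * A2)\<^sup>2 * \<nu>\<^sup>2" by (simp add: power2_eq_square algebra_simps)
    also have "\<dots> \<le> ((d * \<pi>) * (u - 1)) * (A1\<^sup>2 * \<beta>\<^sup>2) + 2 * (d * \<pi>) * (A1 * (l + (u - 1) * A2) * (\<beta> * \<nu>))
        + (l + (u - 1) * A2)\<^sup>2 * \<nu>\<^sup>2"
    proof -
      have "((x * d) * (x * d)) * (A1\<^sup>2 * \<beta>\<^sup>2) \<le> ((d * \<pi>) * (u - 1)) * (A1\<^sup>2 * \<beta>\<^sup>2)"
        using mult_mono[OF xd(3,2)] xd d0 \<pi>0 by (intro mult_right_mono) auto
      moreover have xA: "(x * d) * A2 \<le> (u - 1) * A2" using xd A0 by (intro mult_right_mono) auto
      then have "A1 * (l + (x * d) * A2) * (\<beta> * \<nu>) \<le> A1 * (l + (u - 1) * A2) * (\<beta> * \<nu>)"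
        using A0 nn \<nu>0 by (intro mult_right_mono mult_left_mono) auto
      then have "(2 * (x * d)) * (A1 * (l + (x * d) * A2) * (\<beta> * \<nu>)) \<le> (2 * (d * \<pi>)) * (A1 * (l + (u - 1) * A2) * (\<beta> * \<nu>))"
        using xd A0 l0 nn \<nu>0 d0 \<pi>0 by (rule_tac mult_mono) auto
      moreover have "(l + (x * d) * A2)\<^sup>2 * \<nu>\<^sup>2 \<le> (l + (u - 1) * A2)\<^sup>2 * \<nu>\<^sup>2"
        using xA xd A0 l0 by (intro mult_right_mono power_mono) auto
      ultimately show ?thesis by linarith
    qed
    finally have 1: "(l * chn)\<^sup>2 \<le> d * (\<pi> * (u - 1) * A1\<^sup>2) * \<beta>\<^sup>2
      + d * (2 * \<pi> * (l * A1 + (u - 1) * A1 * A2)) * (\<beta> * \<nu>) + (l + (u - 1) * A2)\<^sup>2 * \<nu>\<^sup>2"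
      by (simp add: algebra_simps)
    have "l\<^sup>2 * (chn / (1 - x * \<mu>))\<^sup>2 = (1 / (1 - x * \<mu>))\<^sup>2 * (l * chn)\<^sup>2" by (simp add: power_mult_distrib power_divide)
    also have "\<dots> \<le> W\<^sup>2 * (l * chn)\<^sup>2" using W0 om by (intro mult_right_mono power_mono) auto
    also have "\<dots> \<le> W\<^sup>2 * (d * (\<pi> * (u - 1) * A1\<^sup>2) * \<beta>\<^sup>2
      + d * (2 * \<pi> * (l * A1 + (u - 1) * A1 * A2)) * (\<beta> * \<nu>) + (l + (u - 1) * A2)\<^sup>2 * \<nu>\<^sup>2)"
      using 1 by (intro mult_left_mono) auto
    finally show ?thesis .
  qed
  have X5: "l\<^sup>2 * (2 / (1 - x * \<mu>) * n * \<rho>n + d * \<rho>n\<^sup>2) \<le> 2 * W * l * \<nu> * a + d * a\<^sup>2"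
  proof -
    have "(2 / (1 - x * \<mu>)) * n \<le> (2 * W) * \<nu>"
      using W0 nn om by (intro mult_mono) auto
    then have "((2 / (1 - x * \<mu>)) * n) * (l * (l * \<rho>n)) \<le> ((2 * W) * \<nu>) * (l * a)"
      using la l0 nn W0 \<nu>0 by (rule_tac mult_mono) (auto intro: mult_left_mono)
    moreover have "d * (l * \<rho>n)\<^sup>2 \<le> d * a\<^sup>2" using la l0 nn d0 by (intro mult_left_mono power_mono) auto
    ultimately show ?thesis by (simp add: power2_eq_square algebra_simps)
  qed
  define N1 where "N1 = (s / 2 * (d + q2) + 3/8 * l\<^sup>2 + 2 * d + eb) * \<beta>\<^sup>2 + (s / 2 * (l + q2) + l * s + l + en) * (\<beta> * \<nu>)"
  define J where "J = (s + j1) * \<beta> + j2 * \<nu>"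
  have B1: "(1/2) * L * \<gamma> * R0 + x * l * L * \<gamma> * n + x * ((3/8) * l\<^sup>2 * \<beta>\<^sup>2 + \<beta> * (2 * d * \<beta> + e1)) \<le> x * N1"
  proof -
    have "(1/2) * ((L * \<gamma>) * R0) \<le> (1/2) * ((s * \<beta>) * (x * ((d + q2) * \<beta> + (l + q2) * \<nu>)))"
    proof -
      have "(L * \<gamma>) * R0 \<le> (s * \<beta>) * (x * ((d + q2) * \<beta> + (l + q2) * \<nu>))"
        using Lg R nn by (rule_tac mult_mono) auto
      then show ?thesis by linarith
    qed
    moreover have "(x * l) * ((L * \<gamma>) * n) \<le> (x * l) * ((s * \<beta>) * \<nu>)"
    proof -
      have "(L * \<gamma>) * n \<le> (s * \<beta>) * \<nu>" using Lg nn by (rule_tac mult_mono) auto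
      then show ?thesis using p by (rule_tac mult_left_mono) auto
    qed
    moreover have "x * (\<beta> * e1) \<le> x * (\<beta> * (eb * \<beta> + (l + en) * \<nu>))"
      using e x nn by (intro mult_left_mono) auto
    ultimately show ?thesis by (simp add: N1_def power2_eq_square algebra_simps add_divide_distrib)
  qed
  have B2: "L * \<gamma> + (1/2) * l * R0 + x * l\<^sup>2 * n + x * l * ((3/2) * (1 + l) * \<beta> + 2 * d * \<beta> + e1) \<le> J"
  proof -
    have b1: "(1/2) * (l * R0) \<le> (1/2) * (\<pi> * \<beta> + (\<pi> + \<pi> * q2) * \<nu>)"
    proof -
      have "l * R0 \<le> (x * l) * (d + q2) * \<beta> + (x * l) * (l + q2) * \<nu>"
        using mult_left_mono[OF R, of l] l0 by (simp add: algebra_simps)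
      also have "\<dots> \<le> \<pi> * \<beta> + (\<pi> + \<pi> * q2) * \<nu>"
      proof (intro add_mono mult_right_mono)
        have "(x * l) * (d + q2) \<le> (x * l) * l" using p l cs by (intro mult_left_mono) auto
        then show "(x * l) * (d + q2) \<le> \<pi>" using p by linarith
        show "(x * l) * (l + q2) \<le> \<pi> + \<pi> * q2" using p p1 cs mult_right_mono[OF p1, of q2] by (simp add: distrib_left)
      qed (use nn \<nu>0 in auto)
      finally show ?thesis by simp
    qed
    have b2: "x * l\<^sup>2 * n \<le> \<pi> * \<nu>" using x nn \<pi>0 by (intro mult_mono) auto
    have b3: "x * l * ((3/2) * (1 + l) * \<beta> + 2 * d * \<beta>) \<le> 7/2 * \<pi> * \<beta>"
    proof -
      have "x * l * ((3/2) * (1 + l) + 2 * d) \<le> x * l * (7/2 * l)"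
      proof (rule mult_left_mono)
        show "(3/2) * (1 + l) + 2 * d \<le> 7/2 * l" using l by (simp add: field_simps)
      qed (rule p)
      also have "\<dots> \<le> 7/2 * \<pi>" using p by linarith
      finally have "x * l * ((3/2) * (1 + l) + 2 * d) * \<beta> \<le> 7/2 * \<pi> * \<beta>" using nn by (intro mult_right_mono) auto
      then show ?thesis by (simp add: algebra_simps)
    qed
    have b4: "x * l * e1 \<le> \<pi> * eb * \<beta> + \<pi> * (1 + en) * \<nu>"
    proof -
      have "x * l * e1 \<le> x * l * (eb * \<beta> + (l + en) * \<nu>)" using e p by (intro mult_left_mono) auto
      also have "\<dots> = (x * l) * (eb * \<beta>) + ((x * l * l) + (x * l) * en) * \<nu>" by (simp add: algebra_simps)
      also have "\<dots> \<le> \<pi> * (eb * \<beta>) + (\<pi> + \<pi> * en) * \<nu>"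
        using p p1 cs nn \<nu>0 by (intro add_mono mult_right_mono) auto
      finally show ?thesis by (simp add: algebra_simps)
    qed
    have "(4 * \<pi> + \<pi> * eb) * \<beta> \<le> j1 * \<beta>" "(\<pi> / 2 * (1 + q2) + \<pi> + \<pi> * (1 + en)) * \<nu> \<le> j2 * \<nu>"
      using cs nn \<nu>0 by (auto intro: mult_right_mono)
    then show ?thesis using b1 b2 b3 b4 Lg by (simp add: J_def algebra_simps add_divide_distrib)
  qed
  have N10: "0 \<le> N1" using nn \<nu>0 cs d0 l0 by (simp add: N1_def)
  have J0: "0 \<le> J"
  proof -
    have "0 \<le> j1" "0 \<le> j2" using cs \<pi>0 by (smt (verit) mult_nonneg_nonneg divide_nonneg_nonneg)+
    then show ?thesis using nn \<nu>0 by (simp add: J_def)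
  qed
  have X6: "8/5 * G * l\<^sup>2 * \<beta>\<^sup>2 - k * (l\<^sup>2 * N1 + l * a * J)
     \<le> l\<^sup>2 * (2 * c * ((1 - x * \<mu>) / x * (\<gamma>\<^sup>2 - (1/2) * L * \<gamma> * R0 - x * l * L * \<gamma> * n
        - x * ((3/8) * l\<^sup>2 * \<beta>\<^sup>2 + \<beta> * (2 * d * \<beta> + e1)))
     - \<rho>n * (L * \<gamma> + (1/2) * l * R0 + x * l\<^sup>2 * n
        + x * l * ((3/2) * (1 + l) * \<beta> + 2 * d * \<beta> + e1))))"
  proof -
    have g: "8/5 * G * \<beta>\<^sup>2 \<le> 2 * (1 - x * \<mu>) * (c * \<gamma>\<^sup>2 / x)"
    proof -
      have "8/5 * G * \<beta>\<^sup>2 \<le> 8/5 * ((1 - x) * (l\<^sup>2 + 19/20 * r * l)) * \<beta>\<^sup>2"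
        using G1 by (intro mult_right_mono mult_left_mono) auto
      also have "\<dots> = 2 * ((1 - x) * (4/5 * (l\<^sup>2 + 19/20 * r * l) * \<beta>\<^sup>2))" by simp
      also have "\<dots> \<le> 2 * ((1 - x * \<mu>) * (c * \<gamma>\<^sup>2 / x))"
        using gg om l0 nn by (intro mult_left_mono mult_mono) auto
      finally show ?thesis by (simp only: mult.assoc)
    qed
    have t1: "(1 - x * \<mu>) / x * (\<gamma>\<^sup>2 - (1/2) * L * \<gamma> * R0 - x * l * L * \<gamma> * n
        - x * ((3/8) * l\<^sup>2 * \<beta>\<^sup>2 + \<beta> * (2 * d * \<beta> + e1))) \<ge> (1 - x * \<mu>) * \<gamma>\<^sup>2 / x - N1"
    proof -
      have "(1 - x * \<mu>) / x * (\<gamma>\<^sup>2 - (1/2) * L * \<gamma> * R0 - x * l * L * \<gamma> * n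
        - x * ((3/8) * l\<^sup>2 * \<beta>\<^sup>2 + \<beta> * (2 * d * \<beta> + e1))) \<ge> (1 - x * \<mu>) / x * (\<gamma>\<^sup>2 - x * N1)"
        using B1 om x by (intro mult_left_mono) auto
      moreover have "(1 - x * \<mu>) / x * (\<gamma>\<^sup>2 - x * N1) = (1 - x * \<mu>) * \<gamma>\<^sup>2 / x - (1 - x * \<mu>) * N1"
        using x by (simp add: field_simps)
      moreover have "(1 - x * \<mu>) * N1 \<le> 1 * N1" using om N10 by (intro mult_right_mono) auto
      ultimately show ?thesis by linarith
    qed
    have t2: "\<rho>n * (L * \<gamma> + (1/2) * l * R0 + x * l\<^sup>2 * n
        + x * l * ((3/2) * (1 + l) * \<beta> + 2 * d * \<beta> + e1)) \<le> \<rho>n * J"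
      using B2 nn by (intro mult_left_mono) auto
    have t3: "l\<^sup>2 * (\<rho>n * J) \<le> l * a * J"
    proof -
      have "l * (l * \<rho>n) * J \<le> l * a * J" using la l0 J0 by (intro mult_right_mono mult_left_mono) auto
      then show ?thesis by (simp add: power2_eq_square mult.assoc)
    qed
    let ?E = "(1 - x * \<mu>) / x * (\<gamma>\<^sup>2 - (1/2) * L * \<gamma> * R0 - x * l * L * \<gamma> * n
        - x * ((3/8) * l\<^sup>2 * \<beta>\<^sup>2 + \<beta> * (2 * d * \<beta> + e1)))
     - \<rho>n * (L * \<gamma> + (1/2) * l * R0 + x * l\<^sup>2 * n
        + x * l * ((3/2) * (1 + l) * \<beta> + 2 * d * \<beta> + e1))"
    have "(1 - x * \<mu>) * \<gamma>\<^sup>2 / x - N1 - \<rho>n * J \<le> ?E" using t1 t2 by linarith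
    then have "l\<^sup>2 * (2 * c * ((1 - x * \<mu>) * \<gamma>\<^sup>2 / x - N1 - \<rho>n * J)) \<le> l\<^sup>2 * (2 * c * ?E)"
      using nn by (intro mult_left_mono) auto
    moreover have "l\<^sup>2 * (2 * c * ((1 - x * \<mu>) * \<gamma>\<^sup>2 / x - N1 - \<rho>n * J))
        = l\<^sup>2 * (2 * (1 - x * \<mu>) * (c * \<gamma>\<^sup>2 / x)) - 2 * c * (l\<^sup>2 * N1 + l\<^sup>2 * (\<rho>n * J))"
    proof -
      have "A * (2 * c * (m * g - N1 - j)) = A * (2 * m * (c * g)) - 2 * c * (A * N1 + A * j)" for A m g j :: real
        by algebra
      from this[of "l\<^sup>2" "1 - x * \<mu>" "\<gamma>\<^sup>2 / x" "\<rho>n * J"] show ?thesis by (simp only: times_divide_eq_right)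
    qed
    moreover have "l\<^sup>2 * (8/5 * G * \<beta>\<^sup>2) \<le> l\<^sup>2 * (2 * (1 - x * \<mu>) * (c * \<gamma>\<^sup>2 / x))"
      using g by (intro mult_left_mono) auto
    moreover have "2 * c * (l\<^sup>2 * N1 + l\<^sup>2 * (\<rho>n * J)) \<le> k * (l\<^sup>2 * N1 + l * a * J)"
    proof (rule mult_mono)
      show "0 \<le> l\<^sup>2 * N1 + l\<^sup>2 * (\<rho>n * J)" using N10 J0 nn by simp
    qed (use cs t3 k0 in auto)
    ultimately show ?thesis by (simp add: algebra_simps)
  qed
  let ?H = "(1 - x * \<mu>) / x * (\<gamma>\<^sup>2 - (1/2) * L * \<gamma> * R0 - x * l * L * \<gamma> * n
        - x * ((3/8) * l\<^sup>2 * \<beta>\<^sup>2 + \<beta> * (2 * d * \<beta> + e1)))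
     - \<rho>n * (L * \<gamma> + (1/2) * l * R0 + x * l\<^sup>2 * n
        + x * l * ((3/2) * (1 + l) * \<beta> + 2 * d * \<beta> + e1))"
  have Y1: "l\<^sup>2 * (21/4 * G * \<nu>\<^sup>2) \<le> l\<^sup>2 * (2 / x * (1 - x * \<mu>) * \<kappa>\<^sup>2)" using X1 by (intro mult_left_mono) auto
  have Y3: "l\<^sup>2 * (l * (1 + x * d)\<^sup>2 * \<kappa>\<^sup>2) \<le> l\<^sup>2 * (u\<^sup>2 * r * \<nu>\<^sup>2)" using X3 by (intro mult_left_mono) auto
  have Y5: "d * (l\<^sup>2 * (2 / (1 - x * \<mu>) * n * \<rho>n + d * \<rho>n\<^sup>2)) \<le> d * (2 * W * l * \<nu> * a + d * a\<^sup>2)"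
    using X5 d0 by (intro mult_left_mono) auto
  have Y6: "d * (8/5 * G * l\<^sup>2 * \<beta>\<^sup>2 - k * (l\<^sup>2 * N1 + l * a * J)) \<le> d * (l\<^sup>2 * (2 * c * ?H))"
    using X6 d0 by (intro mult_left_mono) auto
  have fin: "l\<^sup>2 * (21/4 * G * \<nu>\<^sup>2) - 2 * d * s * \<nu> * (l * a * u + l\<^sup>2 * \<nu>) - l\<^sup>2 * (u\<^sup>2 * r * \<nu>\<^sup>2)
      - W\<^sup>2 * (d * (\<pi> * (u - 1) * A1\<^sup>2) * \<beta>\<^sup>2 + d * (2 * \<pi> * (l * A1 + (u - 1) * A1 * A2)) * (\<beta> * \<nu>) + (l + (u - 1) * A2)\<^sup>2 * \<nu>\<^sup>2)
      - d * (2 * W * l * \<nu> * a + d * a\<^sup>2) + d * (8/5 * G * l\<^sup>2 * \<beta>\<^sup>2 - k * (l\<^sup>2 * N1 + l * a * J))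
    \<le> l\<^sup>2 * (2 / x * (1 - x * \<mu>) * \<kappa>\<^sup>2) - l\<^sup>2 * (2 * L * d * \<kappa> * (\<rho>n + chn)) - l\<^sup>2 * (l * (1 + x * d)\<^sup>2 * \<kappa>\<^sup>2)
      - l\<^sup>2 * (chn / (1 - x * \<mu>))\<^sup>2 - d * (l\<^sup>2 * (2 / (1 - x * \<mu>) * n * \<rho>n + d * \<rho>n\<^sup>2)) + d * (l\<^sup>2 * (2 * c * ?H))"
    using Y1 X2 Y3 X4 Y5 Y6 by linarith
  have rhs: "l\<^sup>2 * (2 / x * (1 - x * \<mu>) * \<kappa>\<^sup>2) - l\<^sup>2 * (2 * L * d * \<kappa> * (\<rho>n + chn)) - l\<^sup>2 * (l * (1 + x * d)\<^sup>2 * \<kappa>\<^sup>2)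
      - l\<^sup>2 * (chn / (1 - x * \<mu>))\<^sup>2 - d * (l\<^sup>2 * (2 / (1 - x * \<mu>) * n * \<rho>n + d * \<rho>n\<^sup>2)) + d * (l\<^sup>2 * (2 * c * ?H))
     = l\<^sup>2 * (2 / x * (1 - x * \<mu>) * \<kappa>\<^sup>2 - 2 * L * d * \<kappa> * (\<rho>n + chn) - l * (1 + x * d)\<^sup>2 * \<kappa>\<^sup>2
      - (chn / (1 - x * \<mu>))\<^sup>2 - d * (2 / (1 - x * \<mu>) * n * \<rho>n + d * \<rho>n\<^sup>2) + 2 * d * c * ?H)"
    by (simp only: right_diff_distrib distrib_left) (simp only: mult_ac)
  have lhs: "l\<^sup>2 * (21/4 * G * \<nu>\<^sup>2) - 2 * d * s * \<nu> * (l * a * u + l\<^sup>2 * \<nu>) - l\<^sup>2 * (u\<^sup>2 * r * \<nu>\<^sup>2)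
      - W\<^sup>2 * (d * (\<pi> * (u - 1) * A1\<^sup>2) * \<beta>\<^sup>2 + d * (2 * \<pi> * (l * A1 + (u - 1) * A1 * A2)) * (\<beta> * \<nu>) + (l + (u - 1) * A2)\<^sup>2 * \<nu>\<^sup>2)
      - d * (2 * W * l * \<nu> * a + d * a\<^sup>2) + d * (8/5 * G * l\<^sup>2 * \<beta>\<^sup>2 - k * (l\<^sup>2 * N1 + l * a * J))
    = d * (l\<^sup>2 * (8/5 * G - k * (s / 2 * (d + q2) + 3/8 * l\<^sup>2 + 2 * d + eb))
       - k * l * A1 * (s + j1) - d * A1\<^sup>2 - \<pi> * (u - 1) * W\<^sup>2 * A1\<^sup>2) * \<beta>\<^sup>2
    - d * (l\<^sup>2 * k * (s / 2 * (l + q2) + l * s + l + en) + k * l * (A1 * j2 + A2 * (s + j1))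
       + 2 * W * l * A1 + 2 * d * A1 * A2 + 2 * u * s * l * A1
       + 2 * \<pi> * W\<^sup>2 * (l * A1 + (u - 1) * A1 * A2)) * (\<beta> * \<nu>)
    + (l\<^sup>2 * (21/4 * G - u\<^sup>2 * r) - W\<^sup>2 * (l + (u - 1) * A2)\<^sup>2
       - d * l * (k * A2 * j2 + 2 * W * A2 + 2 * s * (u * A2 + l)) - d\<^sup>2 * A2\<^sup>2) * \<nu>\<^sup>2"
    unfolding a_def N1_def J_def by algebra
  show ?thesis unfolding excess_def coeffA_def coeffB_def coeffC_def G_def[symmetric] A1_def[symmetric] A2_def[symmetric]
    using fin unfolding rhs lhs .
qed

text \<open>Interface between analysis and numerics: besides the analytic estimates, a range of
  \<open>r\<close> only has to supply rational constants that satisfy \<open>cs1\<close>,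
  \<open>cs2\<close> and the two polynomial inequalities \<open>c1\<close>,
  \<open>c2\<close>.\<close>

lemma total_nonneg_aux:
  fixes l d x r s \<beta> \<nu> n \<rho>n R0 e1 chn \<kappa> \<gamma> L c \<mu> \<pi> q q2 vb vn al1 al2 eb en j1 j2 W u k ww ww' :: real
  assumes l: "1 \<le> l" "d = l - 1" and x: "0 < x" "x * l\<^sup>2 \<le> \<pi>" and \<mu>: "0 \<le> \<mu>" "\<mu> \<le> 1"
    and nn: "0 \<le> \<beta>" "0 \<le> n" "n \<le> \<nu>" "0 \<le> \<rho>n" "0 \<le> R0" "0 \<le> e1" "0 \<le> chn" "0 \<le> \<kappa>" "0 \<le> \<gamma>" "0 \<le> L"
      "0 \<le> r" "0 \<le> s" "0 \<le> c" "0 \<le> ww" "0 \<le> ww'"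
    and ww: "ww \<le> x * l * (\<beta> + n + (1/2) * ww)"
    and ww': "ww' \<le> (1/2) * ww + x * ((1/2) * (1 + l) * \<beta> + (1/2) * l * n + (1/4) * l * ww)"
    and \<rho>: "\<rho>n \<le> n + \<beta> + ww + x * l * (\<beta> + ww')"
    and R: "R0 \<le> x * (d * \<beta> + l * n + (1/2) * l * ww)"
    and e: "e1 \<le> l * n + (1/2) * l * ww + (1/2) * (x * l) * l * \<beta> + l * ww'"
    and ch: "chn \<le> n + x * d * \<rho>n"
    and Lg: "L * \<gamma> \<le> s * \<beta>" and Lk: "L * \<kappa> \<le> s * \<nu>" and lk: "l * \<kappa>\<^sup>2 \<le> r * \<nu>\<^sup>2"
    and gk: "21/8 * (l\<^sup>2 + 19/20 * r * l) * \<nu>\<^sup>2 \<le> \<kappa>\<^sup>2 / x"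
    and gg: "4/5 * (l\<^sup>2 + 19/20 * r * l) * \<beta>\<^sup>2 \<le> c * \<gamma>\<^sup>2 / x"
    and cs1: "\<pi> \<le> q * (1 - \<pi> / 2)" "\<pi> < 1" "0 \<le> q" "(1/2) * q + \<pi> + (1/4) * \<pi> * q \<le> vb"
      "(1/2) * q + (1/2) * \<pi> + (1/4) * \<pi> * q \<le> vn" "q + \<pi> * (1 + vb) \<le> al1" "q + \<pi> * vn \<le> al2"
      "(1/2) * q + (1/2) * \<pi> + vb \<le> eb" "(1/2) * q + vn \<le> en"
    and cs2: "2 * c \<le> k" "1 / (1 - \<pi>) \<le> W" "1 + \<pi> / 4 \<le> u" "4 * \<pi> + \<pi> * eb \<le> j1"
      "\<pi> / 2 * (1 + q2) + \<pi> + \<pi> * (1 + en) \<le> j2" "q \<le> 2" "0 \<le> eb" "0 \<le> en" "0 \<le> al1" "0 \<le> al2"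
      "0 \<le> j1" "0 \<le> j2" and qq: "q = 2 * q2"
    and c1: "11/10 * coeffB l d s \<pi> k q2 al1 al2 en j1 j2 W u * d / 2
        \<le> coeffA l d r s \<pi> k q2 al1 eb j1 W u * (1 + 2 * d)"
    and c2: "coeffB l d s \<pi> k q2 al1 al2 en j1 j2 W u * (1 + 2 * d) / 2
        \<le> coeffC l d r s \<pi> k al2 j2 W u * (11/10)"
  shows "0 \<le> excess x \<mu> l d c L n \<beta> \<gamma> \<kappa> \<rho>n chn R0 e1" (is "0 \<le> ?T")
proof -
  note S = slop_bounds[OF l x nn(1,2,14,15) ww ww' \<rho> R e cs1]
  have \<nu>0: "0 \<le> \<nu>" using nn by linarith
  have \<pi>0: "0 \<le> \<pi>" using x by (smt (verit) mult_nonneg_nonneg zero_le_power2)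
  have d0: "0 \<le> d" using l by simp
  have \<rho>': "l * \<rho>n \<le> (l + al1) * \<beta> + (l + al2) * \<nu>"
    by (rule order_trans[OF S(1) add_left_mono[OF mult_left_mono[OF nn(3)]]]) (use l cs2 in simp)
  have R': "R0 \<le> x * ((d + q2) * \<beta> + (l + q2) * \<nu>)"
  proof -
    have "R0 \<le> x * ((d + q2) * \<beta> + (l + q2) * n)" using S(2) qq by simp
    moreover have "x * ((d + q2) * \<beta> + (l + q2) * n) \<le> x * ((d + q2) * \<beta> + (l + q2) * \<nu>)"
      using l x cs1 qq nn by (intro mult_left_mono add_left_mono) auto
    ultimately show ?thesis by linarith
  qed
  have e': "e1 \<le> eb * \<beta> + (l + en) * \<nu>"
    by (rule order_trans[OF S(3) add_left_mono[OF mult_left_mono[OF nn(3)]]]) (use l cs2 in simp)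
  have q2: "0 \<le> q2" "q2 \<le> 1" using cs1 cs2 qq by auto
  have WU: "0 \<le> W" "0 \<le> u - 1" "0 \<le> u" "0 \<le> k"
  proof -
    have "0 \<le> 1 / (1 - \<pi>)" using cs1 by simp
    then show "0 \<le> W" using cs2 by linarith
  qed (use cs2 \<pi>0 nn in linarith)+
  have B0: "0 \<le> coeffB l d s \<pi> k q2 al1 al2 en j1 j2 W u"
  proof -
    have "0 \<le> l" "0 \<le> s / 2" using l nn by simp_all
    note pos = this d0 nn(12) WU q2(1) cs2(7-12) \<pi>0
    show ?thesis
      unfolding coeffB_def by (intro add_nonneg_nonneg mult_nonneg_nonneg pos zero_le_power2) simp_all
  qed
  have "0 \<le> d * coeffA l d r s \<pi> k q2 al1 eb j1 W u * \<beta>\<^sup>2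
      - d * coeffB l d s \<pi> k q2 al1 al2 en j1 j2 W u * (\<beta> * \<nu>)
      + coeffC l d r s \<pi> k al2 j2 W u * \<nu>\<^sup>2"
    \<comment> \<open>For fixed \<open>r\<close> and \<open>s\<close>, \<open>coeffB\<close> has
      degree 3 in d and \<open>coeffC\<close> degree 4, so a weight \<open>T\<close> linear in d is
      the fastest growth that the second condition tolerates. The numbers 11/10 and 2 are numerical
      choices.\<close>
    by (rule quad_form_nonneg[where \<tau> = "11/10" and T = "1 + 2 * d"]) (use d0 nn(1) \<nu>0 B0 c1 c2 in auto)
  also have "\<dots> \<le> l\<^sup>2 * ?T"
    by (rule form_bound[OF l x cs1(2) \<mu> nn(1-13) cs2(9,10) \<rho>' R' e' ch Lg Lk lk gk gg cs2(1-5) q2 cs2(7,8)])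
  finally have "0 \<le> l\<^sup>2 * ?T" .
  moreover have "0 < l\<^sup>2" using l by simp
  ultimately show ?thesis by (simp only: zero_le_mult_iff) linarith
qed

text \<open>With \<open>s\<close> linear in \<open>r\<close>, the differences to be checked are
  linear in \<open>r\<close>. Taking each product \<open>d^i * r\<close> as an atom, confined by the
  endpoints of the range of \<open>r\<close>, makes them problems of linear arithmetic.\<close>

lemma monomial_bounds:
  fixes d r a b :: real
  assumes "0 \<le> d" "a \<le> r" "r \<le> b"
  shows "a * d^i \<le> d^i * r" "d^i * r \<le> b * d^i" "0 \<le> d^i"
  using assms by (simp_all add: mult.commute[of "d^i"] mult_right_mono)

text \<open>Multipliers for the linear arithmetic below: these multiples of (d - 1/3)^2 and (d^2 -
  3/4)^2 are there to absorb negative coefficients of the polynomials in \<open>d\<close>.\<close>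

lemma square_bounds:
  fixes d :: real
  assumes "0 \<le> d"
  shows "0 \<le> d^2 - 2/3 * d + 1/9" "0 \<le> d^3 - 2/3 * d^2 + 1/9 * d" "0 \<le> d^4 - 2/3 * d^3 + 1/9 * d^2"
    "0 \<le> d^5 - 2/3 * d^4 + 1/9 * d^3" "0 \<le> d^4 - 3/2 * d^2 + 9/16"
proof -
  have "0 \<le> d^i * (d - 1/3)^2" for i using assms by simp
  from this[of 0] this[of 1] this[of 2] this[of 3] show "0 \<le> d^2 - 2/3 * d + 1/9"
    "0 \<le> d^3 - 2/3 * d^2 + 1/9 * d" "0 \<le> d^4 - 2/3 * d^3 + 1/9 * d^2" "0 \<le> d^5 - 2/3 * d^4 + 1/9 * d^3"
    by (simp_all add: power2_eq_square algebra_simps eval_nat_numeral)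
  have "0 \<le> (d^2 - 3/4)^2" by simp
  then show "0 \<le> d^4 - 3/2 * d^2 + 9/16" by (simp add: power2_eq_square algebra_simps eval_nat_numeral)
qed

text \<open>Here \<open>r\<close> is \<open>l / b^2\<close>, the linear function of \<open>r\<close> dominates \<open>sqrt r\<close>, and the numbers are rounded solutions of
  the constraints in \<open>total_nonneg_aux\<close>; no single choice works for all \<open>r\<close>, whence three ranges.\<close>

lemma coeff_case1:
  fixes d r :: real
  assumes d: "0 \<le> d" and r: "0 \<le> r" "r \<le> 1/2"
  shows "11/10 * coeffB (1 + d) d (63/50 * r + 21/100) (11/100) (57/100) (3/50) (1/4) (7/50) (9/50) (12/25) (3/10) (113/100) (103/100) * d / 2
      \<le> coeffA (1 + d) d r (63/50 * r + 21/100) (11/100) (57/100) (3/50) (1/4) (29/100) (12/25) (113/100) (103/100) * (1 + 2 * d)" (is "11/10 * ?B * d / 2 \<le> ?A * (1 + 2 * d)")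
    and "coeffB (1 + d) d (63/50 * r + 21/100) (11/100) (57/100) (3/50) (1/4) (7/50) (9/50) (12/25) (3/10) (113/100) (103/100) * (1 + 2 * d) / 2
      \<le> coeffC (1 + d) d r (63/50 * r + 21/100) (11/100) (57/100) (7/50) (3/10) (113/100) (103/100) * (11/10)" (is "_ \<le> ?C * (11/10)")
proof -
  note m = monomial_bounds[OF d r]
  note ms = m[of 0, simplified] m[of 1, simplified] m[of 2] m[of 3] m[of 4] m[of 5] square_bounds[OF d]
  have "?A * (1 + 2 * d) - 11/10 * ?B * d / 2
    = 34761599/64000000 - 24080372629/40000000000 * d - 221618834633/100000000000 * d^2 + 2821342863/1000000000 * d^3 + 2625719/400000 * d^4 + 1109/400 * d^5 + 13547/31250 * r + 2353143/10000000 * d * r + 372787/250000 * d^2 * r + 34186227/10000000 * d^3 * r + 345857/200000 * d^4 * r"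
    unfolding coeffA_def coeffB_def by algebra
  moreover have "0 \<le> \<dots>" using ms by linarith
  ultimately show "11/10 * ?B * d / 2 \<le> ?A * (1 + 2 * d)" by linarith
  have "?C * (11/10) - ?B * (1 + 2 * d) / 2
    = 633789566939/625000000000 + 72834340513/25000000000 * d + 756500231/156250000 * d^2 + 246208923/50000000 * d^3 + 38509/20000 * d^4 + 2269451/2000000 * r - 17986007/5000000 * d * r - 109014329/10000000 * d^2 * r - 3623403/500000 * d^3 * r - 10773/10000 * d^4 * r"
    unfolding coeffC_def coeffB_def by algebra
  moreover have "0 \<le> \<dots>" using ms by linarith
  ultimately show "?B * (1 + 2 * d) / 2 \<le> ?C * (11/10)" by linarith
qed

lemma coeff_case2:
  fixes d r :: real
  assumes d: "0 \<le> d" and r: "1/2 \<le> r" "r \<le> 7/10"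
  shows "11/10 * coeffB (1 + d) d (18/25 * r + 7/20) (13/100) (57/100) (7/100) (3/10) (4/25) (21/100) (57/100) (9/25) (23/20) (26/25) * d / 2
      \<le> coeffA (1 + d) d r (18/25 * r + 7/20) (13/100) (57/100) (7/100) (3/10) (17/50) (57/100) (23/20) (26/25) * (1 + 2 * d)" (is "11/10 * ?B * d / 2 \<le> ?A * (1 + 2 * d)")
    and "coeffB (1 + d) d (18/25 * r + 7/20) (13/100) (57/100) (7/100) (3/10) (4/25) (21/100) (57/100) (9/25) (23/20) (26/25) * (1 + 2 * d) / 2
      \<le> coeffC (1 + d) d r (18/25 * r + 7/20) (13/100) (57/100) (4/25) (9/25) (23/20) (26/25) * (11/10)" (is "_ \<le> ?C * (11/10)")
proof -
  note m = monomial_bounds[OF d r]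
  note ms = m[of 0, simplified] m[of 1, simplified] m[of 2] m[of 3] m[of 4] m[of 5] square_bounds[OF d]
  have "?A * (1 + 2 * d) - 11/10 * ?B * d / 2
    = 28412537/100000000 - 11546964263/5000000000 * d - 2476833881/500000000 * d^2 + 57113237/40000000 * d^3 + 513493/80000 * d^4 + 1109/400 * d^5 + 193629/250000 * r + 14284423/5000000 * d * r + 15218951/2500000 * d^2 * r + 31481159/5000000 * d^3 * r + 114551/50000 * d^4 * r"
    unfolding coeffA_def coeffB_def by algebra
  moreover have "0 \<le> \<dots>" using ms by linarith
  ultimately show "11/10 * ?B * d / 2 \<le> ?A * (1 + 2 * d)" by linarith
  have "?C * (11/10) - ?B * (1 + 2 * d) / 2
    = 3672448943/12500000000 - 46740123/125000000 * d + 46786211/100000000 * d^2 + 6034437/2000000 * d^3 + 7223/4000 * d^4 + 4113647/2000000 * r + 15008617/5000000 * d * r - 2615741/10000000 * d^2 * r - 911037/500000 * d^3 * r - 1539/2500 * d^4 * r"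
    unfolding coeffC_def coeffB_def by algebra
  moreover have "0 \<le> \<dots>" using ms by linarith
  ultimately show "?B * (1 + 2 * d) / 2 \<le> ?C * (11/10)" by linarith
qed

lemma coeff_case3:
  fixes d r :: real
  assumes d: "0 \<le> d" and r: "7/10 \<le> r" "r \<le> 1"
  shows "11/10 * coeffB (1 + d) d (63/100 * r + 2/5) (151/1000) (57/100) (41/500) (44/125) (189/1000) (123/500) (83/125) (421/1000) (589/500) (519/500) * d / 2
      \<le> coeffA (1 + d) d r (63/100 * r + 2/5) (151/1000) (57/100) (41/500) (44/125) (397/1000) (83/125) (589/500) (519/500) * (1 + 2 * d)" (is "11/10 * ?B * d / 2 \<le> ?A * (1 + 2 * d)")
    and "coeffB (1 + d) d (63/100 * r + 2/5) (151/1000) (57/100) (41/500) (44/125) (189/1000) (123/500) (83/125) (421/1000) (589/500) (519/500) * (1 + 2 * d) / 2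
      \<le> coeffC (1 + d) d r (63/100 * r + 2/5) (151/1000) (57/100) (189/1000) (421/1000) (589/500) (519/500) * (11/10)" (is "_ \<le> ?C * (11/10)")
proof -
  note m = monomial_bounds[OF d r]
  note ms = m[of 0, simplified] m[of 1, simplified] m[of 2] m[of 3] m[of 4] m[of 5] square_bounds[OF d]
  have "?A * (1 + 2 * d) - 11/10 * ?B * d / 2
    = 145500582256211/1953125000000000 - 569435324330454739/156250000000000000 * d - 8786739922370819/1250000000000000 * d^2 + 598944927681/1250000000000 * d^3 + 127333/20000 * d^4 + 1109/400 * d^5 + 7902537/10000000 * r + 1558069891/500000000 * d * r + 6663098177/1000000000 * d^2 * r + 1344370919/200000000 * d^3 * r + 953857/400000 * d^4 * r"
    unfolding coeffA_def coeffB_def by algebra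
  moreover have "0 \<le> \<dots>" using ms by linarith
  ultimately show "11/10 * ?B * d / 2 \<le> ?A * (1 + 2 * d)" by linarith
  have "?C * (11/10) - ?B * (1 + 2 * d) / 2
    = - 167619249876952171/625000000000000000 - 41502895628369893/15625000000000000 * d - 144537203429909/62500000000000 * d^2 + 121485585651/62500000000 * d^3 + 1763/1000 * d^4 + 209833947/100000000 * r + 1916276379/500000000 * d * r + 341866797/250000000 * d^2 * r - 9053961/10000000 * d^3 * r - 10773/20000 * d^4 * r"
    unfolding coeffC_def coeffB_def by algebra
  moreover have "0 \<le> \<dots>" using ms by linarith
  ultimately show "?B * (1 + 2 * d) / 2 \<le> ?C * (11/10)" by linarith
qed

section \<open>Positive contractions\<close>

text \<open>Models lambda1 times the solution operator: the last axiom says G^2 \<le> G, so the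
  spectrum lies in [0,1]. It comes from the Rayleigh bound applied to G v.\<close>

locale contraction_op =
  fixes G :: "'v::real_inner \<Rightarrow> 'v"
  assumes G_linear: "linear G"
    and G_sym: "G v \<bullet> w = v \<bullet> G w"
    and G_contr: "G v \<bullet> G v \<le> v \<bullet> G v"
begin

definition sh :: "real \<Rightarrow> 'v \<Rightarrow> 'v" where
  "sh t v = G v - t *\<^sub>R v"

text \<open>This is |G^(1/2) v|, written without an operator square root; it is also the energy norm
  of G v.\<close>

definition gam :: "'v \<Rightarrow> real" where
  "gam v = sqrt (v \<bullet> G v)"

lemmas G_simps = linear_add[OF G_linear] linear_diff[OF G_linear] linear_scale[OF G_linear]
  linear_neg[OF G_linear] linear_0[OF G_linear]

lemma sh_linear: "linear (sh t)"
  by (rule linearI) (simp_all add: sh_def G_simps algebra_simps)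

lemma sh_G: "sh t (G v) = G (sh t v)"
  by (simp add: sh_def G_simps)

lemma sh_sym: "sh t v \<bullet> w = v \<bullet> sh t w"
  by (simp add: sh_def inner_diff_left inner_diff_right G_sym)

lemma G_comm: "v \<bullet> G w = w \<bullet> G v"
  by (metis G_sym inner_commute)

lemma G_pos: "0 \<le> v \<bullet> G v"
  using G_contr[of v] inner_ge_zero[of "G v"] by linarith

lemma norm_G_le: "norm (G v) \<le> norm v"
proof -
  have "(norm (G v))\<^sup>2 \<le> v \<bullet> G v"
    using G_contr[of v] by (simp add: power2_norm_eq_inner)
  also have "\<dots> \<le> norm v * norm (G v)"
    by (rule norm_cauchy_schwarz)
  finally have "norm (G v) * norm (G v) \<le> norm v * norm (G v)"
    by (simp add: power2_eq_square)
  then show ?thesis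
    by (cases "norm (G v) = 0") (auto simp: mult_le_cancel_right)
qed

lemma G_le: "v \<bullet> G v \<le> v \<bullet> v"
proof -
  have "v \<bullet> G v \<le> norm v * norm (G v)" by (rule norm_cauchy_schwarz)
  also have "\<dots> \<le> norm v * norm v" using norm_G_le[of v] by (simp add: mult_left_mono)
  finally show ?thesis by (simp add: power2_norm_eq_inner flip: power2_eq_square)
qed

lemma gam_nonneg: "0 \<le> gam v"
  by (simp add: gam_def G_pos)

lemma gam_sq: "(gam v)\<^sup>2 = v \<bullet> G v"
  by (simp add: gam_def G_pos)

lemma gam_le_norm: "gam v \<le> norm v"
  unfolding gam_def norm_eq_sqrt_inner using G_le by (rule real_sqrt_le_mono)

lemma norm_G_le_gam: "norm (G v) \<le> gam v"
  unfolding gam_def norm_eq_sqrt_inner using G_contr by (rule real_sqrt_le_mono)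

text \<open>Replaces spectral calculus: \<open>a\<close>, \<open>b\<close>, \<open>c\<close> play
  the second, first and zeroth moment of G on a vector, and on [0,1] the function |g - t| is at most
  max(t, 1 - t). It serves both for the plain norm and for \<open>gam\<close>, where the moments
  move up by one.\<close>

lemma shift_bound_aux:
  fixes a b c t m :: real
  assumes "a \<le> b" "b \<le> c" "0 \<le> b" "t \<le> m" "1 - t \<le> m" "0 \<le> t"
  shows "a - 2 * t * b + t\<^sup>2 * c \<le> m\<^sup>2 * c"
proof (cases "1/2 \<le> t")
  case True
  have "a - 2 * t * b + t\<^sup>2 * c \<le> t\<^sup>2 * c"
    using assms True mult_mono[of 1 "2*t" b b] by auto
  also have "\<dots> \<le> m\<^sup>2 * c"
    using assms by (intro mult_right_mono power_mono) auto
  finally show ?thesis .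
next
  case False
  have "a - 2 * t * b + t\<^sup>2 * c \<le> (1 - 2*t) * c + t\<^sup>2 * c"
    using assms False mult_left_mono[of b c "1 - 2*t"] by (auto simp: algebra_simps)
  also have "\<dots> = (1 - t)\<^sup>2 * c" by (simp add: power2_eq_square algebra_simps)
  also have "\<dots> \<le> m\<^sup>2 * c"
    using assms False by (intro mult_right_mono power_mono) auto
  finally show ?thesis .
qed

lemma norm_sh_le:
  assumes "0 \<le> t" "t \<le> m" "1 - t \<le> m"
  shows "norm (sh t v) \<le> m * norm v"
proof -
  have "(norm (sh t v))\<^sup>2 = G v \<bullet> G v - 2 * t * (v \<bullet> G v) + t\<^sup>2 * (v \<bullet> v)"
    unfolding power2_norm_eq_inner
    by (simp add: sh_def algebra_simps power2_eq_square inner_commute[of "G v" v])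
  also have "\<dots> \<le> m\<^sup>2 * (v \<bullet> v)"
    using assms G_contr G_le G_pos by (intro shift_bound_aux) auto
  also have "\<dots> = (m * norm v)\<^sup>2" by (simp add: power2_norm_eq_inner power_mult_distrib)
  finally have sq: "(norm (sh t v))\<^sup>2 \<le> (m * norm v)\<^sup>2" .
  have "0 \<le> m" using assms by linarith
  then show ?thesis by (intro power2_le_imp_le[OF sq]) simp
qed

lemma gam_sh_le:
  assumes "0 \<le> t" "t \<le> m" "1 - t \<le> m"
  shows "gam (sh t v) \<le> m * gam v"
proof -
  have "(gam (sh t v))\<^sup>2 = G v \<bullet> G (G v) - 2 * t * (G v \<bullet> G v) + t\<^sup>2 * (v \<bullet> G v)"
    unfolding gam_sq
    by (simp add: sh_def G_simps algebra_simps power2_eq_square G_sym inner_commute[of "G v" v])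
  also have "\<dots> \<le> m\<^sup>2 * (v \<bullet> G v)"
    using assms G_contr[of v] G_le[of "G v"] G_pos by (intro shift_bound_aux) auto
  also have "\<dots> = (m * gam v)\<^sup>2" by (simp add: gam_sq power_mult_distrib)
  finally have sq: "(gam (sh t v))\<^sup>2 \<le> (m * gam v)\<^sup>2" .
  have "0 \<le> m" using assms by linarith
  then show ?thesis by (intro power2_le_imp_le[OF sq]) (simp add: gam_nonneg)
qed

end

section \<open>The midpoint stage\<close>

text \<open>A tuple is encoded by its synthesis operator \<open>u\<close> from coefficient vectors
  to functions, with adjoint \<open>us\<close>, so that the Gram matrix is \<open>us\<close> after
  \<open>u\<close>. The hatted tuple is only required to satisfy the implicit equation.\<close>

locale midpoint_stage = contraction_op G
  for G :: "'v::real_inner \<Rightarrow> 'v" +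
  fixes u uh :: "'e::real_inner \<Rightarrow> 'v" and us uhs :: "'v \<Rightarrow> 'e"
    and x l :: real
  assumes u_linear: "linear u" and uh_linear: "linear uh"
    and us_linear: "linear us" and uhs_linear: "linear uhs"
    and u_adj: "u \<xi> \<bullet> v = \<xi> \<bullet> us v" and uh_adj: "uh \<xi> \<bullet> v = \<xi> \<bullet> uhs v"
    and x_pos: "0 < x"
    and midpoint: "uh \<xi> = u \<xi> + x *\<^sub>R
      (G (u (us ((1/2) *\<^sub>R (uh \<xi> + u \<xi>)))) - u (us (G ((1/2) *\<^sub>R (uh \<xi> + u \<xi>)))))"
    and l_ge: "1 \<le> l"
    and u_le: "u \<xi> \<bullet> u \<xi> \<le> l * (\<xi> \<bullet> \<xi>)"
begin

definition A :: "'v \<Rightarrow> 'v" where "A v = G (u (us v)) - u (us (G v))"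
definition w :: "'e \<Rightarrow> 'v" where "w \<xi> = (1/2) *\<^sub>R (uh \<xi> + u \<xi>)"
definition ws :: "'v \<Rightarrow> 'e" where "ws v = (1/2) *\<^sub>R (uhs v + us v)"
definition Y :: "'e \<Rightarrow> 'v" where "Y \<xi> = uh \<xi> - u \<xi>"
definition Ys :: "'v \<Rightarrow> 'e" where "Ys v = uhs v - us v"
definition D :: "'e \<Rightarrow> 'e" where "D \<xi> = us (u \<xi>) - \<xi>"
definition K :: "'e \<Rightarrow> 'e" where "K \<xi> = uhs (G (uh \<xi>))"
definition Ko :: "'e \<Rightarrow> 'e" where "Ko \<xi> = us (G (u \<xi>))"
definition L :: real where "L = sqrt l"

lemma linears: "linear A" "linear w" "linear ws" "linear Y" "linear Ys" "linear D" "linear K" "linear Ko"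
  by (rule linearI; simp add: A_def w_def ws_def Y_def Ys_def D_def K_def Ko_def G_simps algebra_simps
      linear_add[OF u_linear] linear_scale[OF u_linear] linear_add[OF uh_linear] linear_scale[OF uh_linear]
      linear_add[OF us_linear] linear_scale[OF us_linear] linear_add[OF uhs_linear] linear_scale[OF uhs_linear])+

lemmas all_linear = u_linear uh_linear us_linear uhs_linear linears G_linear sh_linear
lemmas lin = all_linear[THEN linear_add] all_linear[THEN linear_diff] all_linear[THEN linear_scale]
  all_linear[THEN linear_neg] all_linear[THEN linear_0]

lemma A_antisym: "A v \<bullet> z = - (v \<bullet> A z)"
  by (simp add: A_def inner_diff_left inner_diff_right u_adj G_sym inner_commute[of v]
      inner_commute[of "us v"] inner_commute[of "us (G v)"])

lemma w_adj: "w \<xi> \<bullet> v = \<xi> \<bullet> ws v"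
  by (simp add: w_def ws_def inner_add_left inner_add_right u_adj uh_adj)

lemma Y_adj: "Y \<xi> \<bullet> v = \<xi> \<bullet> Ys v"
  by (simp add: Y_def Ys_def inner_diff_left inner_diff_right u_adj uh_adj)

lemma Y_eq: "Y \<xi> = x *\<^sub>R A (w \<xi>)"
  unfolding Y_def A_def w_def by (subst midpoint) simp

lemma uh_eq: "uh \<xi> = u \<xi> + Y \<xi>"
  by (simp add: Y_def)

lemma Ys_eq: "Ys v = - (x *\<^sub>R ws (A v))"
proof -
  have "\<xi> \<bullet> Ys v = \<xi> \<bullet> - (x *\<^sub>R ws (A v))" for \<xi>
    by (simp add: Y_adj[symmetric] Y_eq A_antisym w_adj)
  then show ?thesis by (rule vector_eq_ldot[THEN iffD1, rule_format])
qed

text \<open>The increment is x A applied to the midpoint and A is antisymmetric, so (Y, w) + (w, Y)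
  vanishes; with w the average, this is a discrete product rule for the inner product.\<close>

lemma gram_inner: "uh \<xi> \<bullet> uh \<zeta> = u \<xi> \<bullet> u \<zeta>"
proof -
  have "Y \<xi> \<bullet> w \<zeta> + w \<xi> \<bullet> Y \<zeta> = 0"
    by (simp add: Y_eq A_antisym)
  then have "(uh \<xi> \<bullet> uh \<zeta> - u \<xi> \<bullet> uh \<zeta> + (uh \<xi> \<bullet> u \<zeta> - u \<xi> \<bullet> u \<zeta>)) / 2 +
     ((uh \<xi> \<bullet> uh \<zeta> + u \<xi> \<bullet> uh \<zeta>) / 2 - (uh \<xi> \<bullet> u \<zeta> + u \<xi> \<bullet> u \<zeta>) / 2) = 0"
    by (simp add: Y_def w_def inner_diff_left inner_diff_right inner_add_left inner_add_right)
  then show ?thesis by (simp add: field_simps)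
qed

lemma gram_eq: "uhs (uh \<xi>) = us (u \<xi>)"
proof -
  have "\<zeta> \<bullet> uhs (uh \<xi>) = \<zeta> \<bullet> us (u \<xi>)" for \<zeta>
    by (simp add: u_adj[symmetric] uh_adj[symmetric] gram_inner)
  then show ?thesis by (rule vector_eq_ldot[THEN iffD1, rule_format])
qed

lemma L_nonneg: "0 \<le> L" and L_sq: "L * L = l" and L_ge: "1 \<le> L"
  using l_ge by (auto simp: L_def)

lemma norm_u: "norm (u \<xi>) \<le> L * norm \<xi>"
proof -
  have "(norm (u \<xi>))\<^sup>2 \<le> (L * norm \<xi>)\<^sup>2"
    using u_le[of \<xi>] L_sq by (simp add: power2_norm_eq_inner power_mult_distrib) (simp add: power2_eq_square)
  then show ?thesis by (rule power2_le_imp_le) (simp add: L_nonneg)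
qed

lemma L2: "L * (m * (L * a)) = m * l * a"
  using L_sq by (metis mult.assoc mult.commute)

lemma L3: "L * (L * a) = l * a"
  using L_sq by (metis mult.assoc)

lemma norm_uh: "norm (uh \<xi>) \<le> L * norm \<xi>"
  using norm_u[of \<xi>] gram_inner[of \<xi> \<xi>] by (simp add: norm_eq_sqrt_inner)

lemma adj_norm:
  fixes f :: "'e \<Rightarrow> 'v"
  assumes "\<And>\<xi> v. f \<xi> \<bullet> v = \<xi> \<bullet> fs v" "\<And>\<xi>. norm (f \<xi>) \<le> L * norm \<xi>"
  shows "norm (fs v) \<le> L * norm v"
proof -
  have "norm (fs v) * norm (fs v) = f (fs v) \<bullet> v"
    using assms(1)[of "fs v" v] by (simp add: power2_norm_eq_inner flip: power2_eq_square)
  also have "\<dots> \<le> norm (f (fs v)) * norm v" by (rule norm_cauchy_schwarz)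
  also have "\<dots> \<le> (L * norm (fs v)) * norm v" using assms(2) by (intro mult_right_mono) auto
  finally have "norm (fs v) * norm (fs v) \<le> (L * norm v) * norm (fs v)" by (simp add: algebra_simps)
  then show ?thesis using L_nonneg
    by (cases "norm (fs v) = 0") (auto simp: mult_le_cancel_right)
qed

lemma norm_us: "norm (us v) \<le> L * norm v"
  by (rule adj_norm[OF u_adj norm_u])

lemma norm_uhs: "norm (uhs v) \<le> L * norm v"
  by (rule adj_norm[OF uh_adj norm_uh])

lemma norm_w: "norm (w \<xi>) \<le> L * norm \<xi>"
  unfolding w_def using norm_u[of \<xi>] norm_uh[of \<xi>] norm_triangle_ineq[of "uh \<xi>" "u \<xi>"] by simp

lemma norm_ws: "norm (ws v) \<le> L * norm v"
  by (rule adj_norm[OF w_adj norm_w])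

text \<open>The operator \<open>A\<close> does not change when G is replaced by G - t. The choice t
  = 1/2, where the shifted operator has norm at most 1/2, leads to |A v| \<le> sqrt l times this
  quantity, and so to |A v| \<le> l |v| instead of 2 l |v|.\<close>

definition N2 :: "'v \<Rightarrow> real" where "N2 v = norm (us v) / 2 + norm (us (sh (1/2) v))"

lemma A_shift: "A v = sh t (u (us v)) - u (us (sh t v))"
  by (simp add: A_def sh_def lin)

lemma norm_A: "norm (A v) \<le> L * N2 v"
proof -
  have "norm (A v) \<le> norm (sh (1/2) (u (us v))) + norm (u (us (sh (1/2) v)))"
    unfolding A_shift[of v "1/2"] by (rule norm_triangle_ineq4)
  also have "\<dots> \<le> (1/2) * norm (u (us v)) + norm (u (us (sh (1/2) v)))"
    using norm_sh_le[of "1/2" "1/2" "u (us v)"] by simp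
  also have "\<dots> \<le> (1/2) * (L * norm (us v)) + L * norm (us (sh (1/2) v))"
    using norm_u by (intro add_mono mult_left_mono) auto
  finally show ?thesis by (simp add: N2_def algebra_simps)
qed

lemma N2_nonneg: "0 \<le> N2 v" by (simp add: N2_def)

lemma N2_le: "N2 v \<le> L * norm v"
proof -
  have "norm (us (sh (1/2) v)) \<le> L * ((1/2) * norm v)"
    by (rule order_trans[OF norm_us mult_left_mono[OF norm_sh_le L_nonneg]]) simp_all
  then show ?thesis using norm_us[of v] by (simp add: N2_def)
qed

lemma N2_add: "N2 (a + b) \<le> N2 a + N2 b"
  using norm_triangle_ineq[of "us a" "us b"] norm_triangle_ineq[of "us (sh (1/2) a)" "us (sh (1/2) b)"]
  by (simp add: N2_def lin)

lemma norm_A_le: "norm (A v) \<le> l * norm v"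
proof -
  have "norm (A v) \<le> L * (L * norm v)"
    by (rule order_trans[OF norm_A mult_left_mono[OF N2_le L_nonneg]])
  then show ?thesis by (simp only: L3)
qed

lemma norm_us_A: 
  assumes "norm (P (A v)) \<le> m * norm (A v)" "0 \<le> m"
  shows "norm (us (P (A v))) \<le> m * l * N2 v"
proof -
  have "norm (us (P (A v))) \<le> L * (m * norm (A v))"
    by (rule order_trans[OF norm_us mult_left_mono[OF assms(1) L_nonneg]])
  also have "\<dots> \<le> L * (m * (L * N2 v))"
    using norm_A[of v] assms L_nonneg by (intro mult_left_mono) auto
  finally show ?thesis by (simp only: L2)
qed

lemma norm_ws_A: "norm (ws (A v)) \<le> l * N2 v"
proof -
  have "norm (ws (A v)) \<le> L * (L * N2 v)"
    by (rule order_trans[OF norm_ws mult_left_mono[OF norm_A L_nonneg]])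
  then show ?thesis by (simp only: L3)
qed

lemma norm_us_u:
  assumes "norm (P (u \<xi>)) \<le> m * norm (u \<xi>)" "0 \<le> m"
  shows "norm (us (P (u \<xi>))) \<le> m * l * norm \<xi>"
proof -
  have "norm (us (P (u \<xi>))) \<le> L * (m * norm (u \<xi>))"
    by (rule order_trans[OF norm_us mult_left_mono[OF assms(1) L_nonneg]])
  also have "\<dots> \<le> L * (m * (L * norm \<xi>))"
    using norm_u[of \<xi>] assms L_nonneg by (intro mult_left_mono) auto
  finally show ?thesis by (simp only: L2)
qed

lemma D_sym: "D \<xi> \<bullet> \<zeta> = \<xi> \<bullet> D \<zeta>"
  by (simp add: D_def inner_diff_left inner_diff_right inner_commute[of "us _" \<zeta>] u_adj[symmetric])
     (simp add: u_adj[symmetric] inner_commute)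

lemma Ko_sym: "Ko \<xi> \<bullet> \<zeta> = \<xi> \<bullet> Ko \<zeta>"
  by (simp add: Ko_def inner_commute[of "us _" \<zeta>] u_adj[symmetric]) (rule G_comm)

lemma K_sym: "K \<xi> \<bullet> \<zeta> = \<xi> \<bullet> K \<zeta>"
  by (simp add: K_def inner_commute[of "uhs _" \<zeta>] uh_adj[symmetric]) (rule G_comm)

end

section \<open>Propagation of the defect inequality\<close>

text \<open>One step seen by one vector \<phi> and one shift \<mu>. The constant \<open>b\<close>
  will be the square root of an upper bound for the energy Gram matrix; \<open>us_gam\<close> is the
  dual form of that bound and is stronger than \<open>norm_us\<close> where G is small.\<close>

locale test_vector = midpoint_stage G u uh us uhs x l
  for G :: "'v::real_inner \<Rightarrow> 'v" and u uh :: "'e::real_inner \<Rightarrow> 'v" and us uhs x l +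
  fixes b d \<mu> :: real and \<phi> :: 'e
  assumes d_def: "d = l - 1"
    and D_upper: "\<xi> \<bullet> D \<xi> \<le> d * (\<xi> \<bullet> \<xi>)"
    and norm_D: "norm (D \<xi>) \<le> d * norm \<xi>"
    and us_gam: "norm (us v) \<le> b * gam v"
    and b_nonneg: "0 \<le> b"
    and mu: "0 \<le> \<mu>" "\<mu> \<le> 1"
    and p_le: "x * l \<le> 1"
begin

definition "y0 = u \<phi>"
text \<open>Vanishes exactly when u \<phi> satisfies the eigenvalue equation of G for \<mu>.
  Together with \<eta> it is the small quantity in which all errors are measured.\<close>

definition "h0 = sh \<mu> y0"
definition "r0 = Y \<phi>"
definition "\<eta> = D \<phi>"
definition "hh = sh \<mu> (uh \<phi>)"
definition "\<rho> = K \<phi> - \<mu> *\<^sub>R \<phi>"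
definition "\<beta> = b * gam h0"
definition "\<gamma> = gam h0"
definition "n = norm \<eta>"
definition "ww = N2 r0"
definition "ww' = N2 (sh \<mu> r0)"

lemma d_nonneg: "0 \<le> d" using l_ge d_def by simp

lemma beta_nonneg: "0 \<le> \<beta>" and gamma_nonneg: "0 \<le> \<gamma>" and n_nonneg: "0 \<le> n"
  and ww_nonneg: "0 \<le> ww" and ww'_nonneg: "0 \<le> ww'"
  by (auto simp: \<beta>_def \<gamma>_def n_def ww_def ww'_def b_nonneg gam_nonneg N2_nonneg)

lemma us_P_h0:
  assumes "gam (P h0) \<le> m * gam h0"
  shows "norm (us (P h0)) \<le> m * \<beta>"
proof -
  have "norm (us (P h0)) \<le> b * (m * gam h0)"
    by (rule order_trans[OF us_gam mult_left_mono[OF assms b_nonneg]])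
  then show ?thesis by (simp add: \<beta>_def algebra_simps)
qed

lemma us_h0: "norm (us h0) \<le> \<beta>"
  using us_P_h0[of "\<lambda>v. v" 1] by simp

lemma us_sh_h0: "norm (us (sh (1/2) h0)) \<le> (1/2) * \<beta>"
  by (rule us_P_h0, rule gam_sh_le) simp_all

lemma us_mu_h0: "norm (us (sh \<mu> h0)) \<le> \<beta>"
  using us_P_h0[of "sh \<mu>" 1] gam_sh_le[of \<mu> 1 h0] mu by simp

lemma us_G_h0: "norm (us (G h0)) \<le> \<beta>"
  using us_P_h0[of "sh 0" 1] gam_sh_le[of 0 1 h0] by (simp add: sh_def)

lemma us_sh_mu_h0: "norm (us (sh (1/2) (sh \<mu> h0))) \<le> (1/2) * \<beta>"
proof (rule us_P_h0)
  show "gam (sh (1/2) (sh \<mu> h0)) \<le> (1/2) * gam h0"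
    using gam_sh_le[of "1/2" "1/2" "sh \<mu> h0"] gam_sh_le[of \<mu> 1 h0] mu by simp
qed

lemma N2_h0: "N2 h0 \<le> \<beta>"
  using us_h0 us_sh_h0 by (simp add: N2_def)

lemma SD: "us (u \<xi>) = \<xi> + D \<xi>" by (simp add: D_def)

lemma wphi: "w \<phi> = y0 + (1/2) *\<^sub>R r0"
  by (simp add: w_def y0_def r0_def Y_def algebra_simps flip: scaleR_add_left)

text \<open>Shifting G by \<mu> in \<open>A\<close> removes the part of u \<phi> that is an
  eigenvector; the increment becomes linear in \<open>h0\<close> and \<eta>, up to the implicit term
  in \<open>r0\<close> itself.\<close>

lemma r0_eq: "r0 = x *\<^sub>R (h0 - u (us h0) + sh \<mu> (u \<eta>) + (1/2) *\<^sub>R A r0)"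
proof -
  have "r0 = x *\<^sub>R A (y0 + (1/2) *\<^sub>R r0)"
    using Y_eq[of \<phi>] by (simp only: r0_def[symmetric] wphi)
  also have "A (y0 + (1/2) *\<^sub>R r0) = A y0 + (1/2) *\<^sub>R A r0" by (simp add: lin)
  also have "A y0 = sh \<mu> (u (us y0)) - u (us h0)" by (simp add: A_shift[of _ \<mu>] h0_def)
  also have "sh \<mu> (u (us y0)) = h0 + sh \<mu> (u \<eta>)"
    by (simp add: y0_def SD \<eta>_def h0_def lin)
  finally show ?thesis by (simp add: algebra_simps)
qed

lemma norm_mu: "norm (sh \<mu> v) \<le> norm v" using norm_sh_le[of \<mu> 1 v] mu by simp
lemma norm_half: "norm (sh (1/2) v) \<le> (1/2) * norm v" using norm_sh_le[of "1/2" "1/2" v] by simp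
lemma norm_half_mu: "norm (sh (1/2) (sh \<mu> v)) \<le> (1/2) * norm v"
  using norm_half[of "sh \<mu> v"] norm_mu[of v] by simp

text \<open>The two contributions of \<open>h0\<close> combine to \<open>- D (us h0)\<close>, so
  \<beta> enters with the factor d and not with 1 + l.\<close>

lemma us_r0: "norm (us r0) \<le> x * (d * \<beta> + l * n + (1/2) * l * ww)"
proof -
  have eq: "us r0 = x *\<^sub>R (- D (us h0) + us (sh \<mu> (u \<eta>)) + (1/2) *\<^sub>R us (A r0))"
    using arg_cong[OF r0_eq, of us] by (simp only: lin SD) (simp add: algebra_simps)
  have 1: "norm (D (us h0)) \<le> d * \<beta>"
    by (rule order_trans[OF norm_D mult_left_mono[OF us_h0 d_nonneg]])
  have 2: "norm (us (sh \<mu> (u \<eta>))) \<le> l * n"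
    using norm_us_u[of "sh \<mu>" \<eta> 1] norm_mu by (simp add: n_def)
  have 3: "norm (us (A r0)) \<le> l * ww"
    using norm_us_A[of "\<lambda>v. v" r0 1] by (simp add: ww_def)
  have "norm (- D (us h0) + us (sh \<mu> (u \<eta>)) + (1/2) *\<^sub>R us (A r0))
      \<le> norm (D (us h0)) + norm (us (sh \<mu> (u \<eta>))) + (1/2) * norm (us (A r0))"
    using norm_triangle_ineq[of "- D (us h0) + us (sh \<mu> (u \<eta>))" "(1/2) *\<^sub>R us (A r0)"]
      norm_triangle_ineq[of "- D (us h0)" "us (sh \<mu> (u \<eta>))"] by simp
  also have "\<dots> \<le> d * \<beta> + l * n + (1/2) * l * ww" using 1 2 3 by simp
  finally show ?thesis unfolding eq using x_pos by (simp add: mult_left_mono)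
qed

text \<open>The operator \<open>P\<close> stands for G - 1/2 and for (G - 1/2)(G - \<mu>), both of
  norm at most 1/2; no cancellation as in \<open>us_r0\<close> is available here.\<close>

lemma us_P_r0:
  assumes lP: "linear P" and P: "\<And>v. norm (P v) \<le> (1/2) * norm v" and Ph: "norm (us (P h0)) \<le> (1/2) * \<beta>"
    and Pm: "\<And>v. norm (P (sh \<mu> v)) \<le> (1/2) * norm v"
  shows "norm (us (P r0)) \<le> x * ((1/2) * (1 + l) * \<beta> + (1/2) * l * n + (1/4) * l * ww)"
proof -
  have eq: "us (P r0) = x *\<^sub>R (us (P h0) - us (P (u (us h0))) + us (P (sh \<mu> (u \<eta>))) + (1/2) *\<^sub>R us (P (A r0)))"
    using arg_cong[OF r0_eq, of "\<lambda>v. us (P v)"] by (simp only: lin linear_add[OF lP] linear_diff[OF lP] linear_scale[OF lP])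
  have 1: "norm (us (P (u (us h0)))) \<le> (1/2) * l * \<beta>"
    using norm_us_u[of P "us h0" "1/2", OF P] mult_left_mono[OF us_h0, of "(1/2) * l"] l_ge by linarith
  have 2: "norm (us (P (sh \<mu> (u \<eta>)))) \<le> (1/2) * l * n"
    using norm_us_u[of "\<lambda>v. P (sh \<mu> v)" \<eta> "1/2"] Pm by (simp add: n_def)
  have 3: "norm (us (P (A r0))) \<le> (1/2) * l * ww"
    using norm_us_A[of P r0 "1/2"] P by (simp add: ww_def)
  have "norm (us (P h0) - us (P (u (us h0))) + us (P (sh \<mu> (u \<eta>))) + (1/2) *\<^sub>R us (P (A r0)))
      \<le> norm (us (P h0)) + norm (us (P (u (us h0)))) + norm (us (P (sh \<mu> (u \<eta>)))) + (1/2) * norm (us (P (A r0)))"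
    using norm_triangle_ineq[of "us (P h0) - us (P (u (us h0))) + us (P (sh \<mu> (u \<eta>)))" "(1/2) *\<^sub>R us (P (A r0))"]
      norm_triangle_ineq[of "us (P h0) - us (P (u (us h0)))" "us (P (sh \<mu> (u \<eta>)))"]
      norm_triangle_ineq4[of "us (P h0)" "us (P (u (us h0)))"] by simp
  also have "\<dots> \<le> (1/2) * (1 + l) * \<beta> + (1/2) * l * n + (1/4) * l * ww"
    using 1 2 3 Ph by (simp add: algebra_simps add_divide_distrib)
  finally show ?thesis unfolding eq using x_pos by (simp add: mult_left_mono)
qed

lemma us_half_r0: "norm (us (sh (1/2) r0)) \<le> x * ((1/2) * (1 + l) * \<beta> + (1/2) * l * n + (1/4) * l * ww)"
proof (rule us_P_r0[OF sh_linear norm_half us_sh_h0])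
  show "norm (sh (1/2) (sh \<mu> v)) \<le> (1/2) * norm v" for v by (rule norm_half_mu)
qed

text \<open>Sum of half the first bound and the second; the coefficients of \<beta> add up to d/2 +
  (1 + l)/2 = l. The estimate stays implicit in \<open>ww\<close> until a bound on x l^2 is at
  hand.\<close>

lemma ww_le: "ww \<le> x * l * (\<beta> + n + (1/2) * ww)"
proof -
  have "ww \<le> (x * (d * \<beta> + l * n + (1/2) * l * ww)) / 2
      + x * ((1/2) * (1 + l) * \<beta> + (1/2) * l * n + (1/4) * l * ww)"
    using us_r0 us_half_r0 N2_def[of r0] unfolding ww_def[symmetric] by linarith
  also have "\<dots> = x * l * (\<beta> + n + (1/2) * ww)"
    by (simp add: d_def algebra_simps add_divide_distrib diff_divide_distrib)
  finally show ?thesis .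
qed

lemma us_mu_r0: "norm (us (sh \<mu> r0)) \<le> ww"
proof -
  have "us (sh \<mu> r0) = us (sh (1/2) r0) + (1/2 - \<mu>) *\<^sub>R us r0"
    by (simp add: sh_def lin algebra_simps)
  then have "norm (us (sh \<mu> r0)) \<le> norm (us (sh (1/2) r0)) + \<bar>1/2 - \<mu>\<bar> * norm (us r0)"
    using norm_triangle_ineq[of "us (sh (1/2) r0)" "(1/2 - \<mu>) *\<^sub>R us r0"] by simp
  also have "\<dots> \<le> norm (us (sh (1/2) r0)) + (1/2) * norm (us r0)"
    using mu by (intro add_left_mono mult_right_mono) (auto simp: abs_if)
  finally show ?thesis by (simp add: ww_def N2_def)
qed

lemma ww'_le: "ww' \<le> (1/2) * ww + x * ((1/2) * (1 + l) * \<beta> + (1/2) * l * n + (1/4) * l * ww)"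
proof -
  have "norm (us ((\<lambda>v. sh (1/2) (sh \<mu> v)) r0)) \<le> x * ((1/2) * (1 + l) * \<beta> + (1/2) * l * n + (1/4) * l * ww)"
  proof (rule us_P_r0)
    show "linear (\<lambda>v. sh (1/2) (sh \<mu> v))"
      using linear_compose[OF sh_linear sh_linear] by (simp add: o_def)
    show "norm (sh (1/2) (sh \<mu> v)) \<le> (1/2) * norm v" for v by (rule norm_half_mu)
    show "norm (us (sh (1/2) (sh \<mu> h0))) \<le> (1/2) * \<beta>" by (rule us_sh_mu_h0)
    show "norm (sh (1/2) (sh \<mu> (sh \<mu> v))) \<le> (1/2) * norm v" for v
      using norm_half_mu[of "sh \<mu> v"] norm_mu[of v] by simp
  qed
  then show ?thesis using us_mu_r0 by (simp add: ww'_def N2_def)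
qed

lemma hh_eq: "hh = h0 + sh \<mu> r0"
  by (simp add: hh_def uh_eq h0_def y0_def r0_def lin)

lemma N2_hh: "N2 hh \<le> \<beta> + ww'"
  using N2_add[of h0 "sh \<mu> r0"] N2_h0 by (simp add: hh_eq ww'_def)

lemma Ys_hh: "norm (Ys hh) \<le> x * l * (\<beta> + ww')"
proof -
  have "norm (Ys hh) \<le> x * (l * N2 hh)"
    using norm_ws_A[of hh] x_pos by (simp add: Ys_eq mult_left_mono)
  also have "\<dots> \<le> x * (l * (\<beta> + ww'))"
    using N2_hh x_pos l_ge by (intro mult_left_mono) auto
  finally show ?thesis by (simp add: algebra_simps)
qed

lemma rho_eq: "\<rho> = \<mu> *\<^sub>R \<eta> + uhs hh"
proof -
  have "G (uh \<phi>) = \<mu> *\<^sub>R uh \<phi> + hh" by (simp add: hh_def sh_def)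
  then show ?thesis
    by (simp add: \<rho>_def K_def lin gram_eq \<eta>_def D_def algebra_simps)
qed

lemma rho_le: "norm \<rho> \<le> n + \<beta> + ww + x * l * (\<beta> + ww')"
proof -
  have "uhs hh = us h0 + us (sh \<mu> r0) + Ys hh" by (simp add: Ys_def hh_eq lin)
  then have "norm (uhs hh) \<le> norm (us h0) + norm (us (sh \<mu> r0)) + norm (Ys hh)"
    using norm_triangle_ineq[of "us h0 + us (sh \<mu> r0)" "Ys hh"] norm_triangle_ineq[of "us h0" "us (sh \<mu> r0)"] by simp
  also have "\<dots> \<le> \<beta> + ww + x * l * (\<beta> + ww')" using us_h0 us_mu_r0 Ys_hh by simp
  finally have 1: "norm (uhs hh) \<le> \<beta> + ww + x * l * (\<beta> + ww')" .
  have "norm \<rho> \<le> \<mu> * n + norm (uhs hh)"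
    unfolding rho_eq using norm_triangle_ineq[of "\<mu> *\<^sub>R \<eta>" "uhs hh"] mu by (simp add: n_def)
  moreover have "\<mu> * n \<le> n" using mu n_nonneg mult_left_le_one_le by blast
  ultimately show ?thesis using 1 by simp
qed

definition "hG v = (1/2) *\<^sub>R G v - \<mu> *\<^sub>R v"
text \<open>Equals x times K \<phi> - us (G (w \<phi>)): the second stage sees K of the hatted
  tuple, whereas the first stage subtracts the midpoint quantity. The operator G/2 - \<mu> arises
  because the midpoint contains half of the increment.\<close>

definition "ff = x *\<^sub>R (us (hG r0) + Ys hh)"

lemma hG_linear: "linear hG"
  by (rule linearI) (simp_all add: hG_def G_simps algebra_simps)

lemma norm_hG: "norm (hG v) \<le> norm v"
proof -
  have "hG v = (1/2) *\<^sub>R sh (2*\<mu>) v" by (simp add: hG_def sh_def algebra_simps)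
  moreover have "norm (sh (2*\<mu>) v) \<le> 2 * norm v"
    using norm_sh_le[of "2*\<mu>" 2 v] mu by simp
  ultimately show ?thesis by simp
qed

definition "E1 = us (hG (sh \<mu> (u \<eta>))) + (1/2) *\<^sub>R us (hG (A r0)) - (1/2) *\<^sub>R Ys (A h0) - ws (A (sh \<mu> r0))"

text \<open>One further expansion by \<open>r0_eq\<close> shows that \<open>ff\<close> is of order
  x^2. The first term is kept separate because its pairing with us (G - \<mu>) h0 is almost a
  square; \<open>E1\<close> collects contributions without such structure.\<close>

lemma ff_eq: "ff = (x * x) *\<^sub>R ((3/2) *\<^sub>R (us (G h0) - Ko (us h0)) + D (us (G h0) + \<mu> *\<^sub>R us h0) + E1)"
proof -
  have 1: "us (hG r0) = x *\<^sub>R (us (hG (h0 - u (us h0))) + us (hG (sh \<mu> (u \<eta>))) + (1/2) *\<^sub>R us (hG (A r0)))"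
    using arg_cong[OF r0_eq, of "\<lambda>v. us (hG v)"]
    by (simp only: lin linear_add[OF hG_linear] linear_diff[OF hG_linear] linear_scale[OF hG_linear])
  have 2: "us (hG (h0 - u (us h0))) = (1/2) *\<^sub>R (us (G h0) - Ko (us h0)) + \<mu> *\<^sub>R D (us h0)"
    by (simp add: hG_def lin Ko_def D_def algebra_simps)
  have 3: "ws (A h0) = us (A h0) + (1/2) *\<^sub>R Ys (A h0)"
    by (simp add: ws_def Ys_def algebra_simps flip: scaleR_add_left)
  have 4: "us (A h0) = Ko (us h0) - us (G h0) - D (us (G h0))"
    by (simp add: A_def lin Ko_def D_def)
  have "Ys hh = x *\<^sub>R (- ws (A h0) - ws (A (sh \<mu> r0)))"
    by (simp add: Ys_eq hh_eq lin algebra_simps)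
  then have 5: "Ys hh = x *\<^sub>R (us (G h0) + D (us (G h0)) - Ko (us h0) - (1/2) *\<^sub>R Ys (A h0) - ws (A (sh \<mu> r0)))"
    by (simp add: 3 4 algebra_simps)
  have "us (hG r0) + Ys hh = x *\<^sub>R ((1/2) *\<^sub>R (us (G h0) - Ko (us h0)) + \<mu> *\<^sub>R D (us h0)
      + us (hG (sh \<mu> (u \<eta>))) + (1/2) *\<^sub>R us (hG (A r0))
      + (us (G h0) + D (us (G h0)) - Ko (us h0) - (1/2) *\<^sub>R Ys (A h0) - ws (A (sh \<mu> r0))))"
    by (simp only: 1 2 5 scaleR_add_right)
  also have "\<dots> = x *\<^sub>R ((3/2) *\<^sub>R (us (G h0) - Ko (us h0)) + D (us (G h0) + \<mu> *\<^sub>R us h0) + E1)"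
  proof -
    \<comment> \<open>One half stems from \<open>us (hG r0)\<close>, the whole one from
      \<open>Ys hh\<close>.\<close>
    have "(3/2) *\<^sub>R (us (G h0) - Ko (us h0)) = (1/2) *\<^sub>R (us (G h0) - Ko (us h0)) + (us (G h0) - Ko (us h0))"
      using scaleR_add_left[of "1/2" 1 "us (G h0) - Ko (us h0)"] by simp
    then show ?thesis by (simp add: E1_def lin)
  qed
  finally show ?thesis by (simp add: ff_def)
qed

lemma E1_le: "norm E1 \<le> l * n + (1/2) * l * ww + (1/2) * (x * l) * l * \<beta> + l * ww'"
proof -
  have 1: "norm (us (hG (sh \<mu> (u \<eta>)))) \<le> l * n"
    using norm_us_u[of "\<lambda>v. hG (sh \<mu> v)" \<eta> 1] norm_hG[of "sh \<mu> (u \<eta>)"] norm_mu[of "u \<eta>"] by (simp add: n_def)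
  have 2: "norm (us (hG (A r0))) \<le> l * ww"
    using norm_us_A[of hG r0 1] norm_hG by (simp add: ww_def)
  have "norm (ws (A (A h0))) \<le> L * (l * (L * \<beta>))"
  proof -
    have "norm (A h0) \<le> L * \<beta>"
      by (rule order_trans[OF norm_A mult_left_mono[OF N2_h0 L_nonneg]])
    then have "norm (A (A h0)) \<le> l * (L * \<beta>)"
      using norm_A_le[of "A h0"] l_ge by (meson mult_left_mono order_trans zero_le_one)
    then show ?thesis by (rule order_trans[OF norm_ws mult_left_mono[OF _ L_nonneg]])
  qed
  then have 3: "norm (Ys (A h0)) \<le> (x * l) * l * \<beta>"
    using x_pos by (simp add: Ys_eq L2 mult_left_mono mult.assoc)
  have 4: "norm (ws (A (sh \<mu> r0))) \<le> l * ww'"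
    using norm_ws_A[of "sh \<mu> r0"] by (simp add: ww'_def)
  have "norm E1 \<le> norm (us (hG (sh \<mu> (u \<eta>)))) + (1/2) * norm (us (hG (A r0))) + (1/2) * norm (Ys (A h0)) + norm (ws (A (sh \<mu> r0)))"
    unfolding E1_def
    using norm_triangle_ineq4[of "us (hG (sh \<mu> (u \<eta>))) + (1/2) *\<^sub>R us (hG (A r0)) - (1/2) *\<^sub>R Ys (A h0)" "ws (A (sh \<mu> r0))"]
      norm_triangle_ineq4[of "us (hG (sh \<mu> (u \<eta>))) + (1/2) *\<^sub>R us (hG (A r0))" "(1/2) *\<^sub>R Ys (A h0)"]
      norm_triangle_ineq[of "us (hG (sh \<mu> (u \<eta>)))" "(1/2) *\<^sub>R us (hG (A r0))"] by simp
  then show ?thesis using 1 2 3 4 by simp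
qed

end

section \<open>The second stage and the growth of the shifted image of the test vector\<close>

context test_vector
begin

definition "up \<xi> = uh \<xi> - x *\<^sub>R G (uh (D \<xi>))"
definition "ups v = uhs v - x *\<^sub>R D (uhs (G v))"
definition "Dp \<xi> = ups (up \<xi>) - \<xi>"
definition "\<psi> = \<phi> - x *\<^sub>R K \<phi>"
definition "h1 = sh \<mu> (u \<psi>)"
definition "hp = sh \<mu> (up \<phi>)"
definition "qq = (1/2) *\<^sub>R u (us r0) - Y \<eta>"
definition "R0 = norm (us r0)"
definition "e1 = norm E1"
definition "\<rho>n = norm \<rho>"

lemma ff_alt: "ff = x *\<^sub>R (K \<phi> - us (G (w \<phi>)))"
proof -
  have wr: "w \<phi> = uh \<phi> - (1/2) *\<^sub>R r0"
    by (simp add: w_def r0_def Y_def algebra_simps flip: scaleR_add_left)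
  have 1: "Ys (uh \<phi>) = - us r0" by (simp add: Ys_def gram_eq r0_def Y_def lin)
  have 2: "G (uh \<phi>) = \<mu> *\<^sub>R uh \<phi> + hh" by (simp add: hh_def sh_def)
  have "K \<phi> = us (G (uh \<phi>)) + Ys (G (uh \<phi>))" by (simp add: K_def Ys_def)
  also have "Ys (G (uh \<phi>)) = - (\<mu> *\<^sub>R us r0) + Ys hh" by (subst 2) (simp add: lin 1)
  finally have "K \<phi> - us (G (w \<phi>)) = us (hG r0) + Ys hh"
    by (simp add: wr lin hG_def)
  then show ?thesis by (simp add: ff_def)
qed

text \<open>The new tuple at \<phi> is the old tuple at \<psi>, plus x G y0, the source of the gain,
  plus small terms: the first-stage term x G u \<eta> cancels against the second stage except for
  the increment of \<eta> inside \<open>qq\<close>, and subtracting K \<phi> on the coefficient side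
  leaves \<open>ff\<close>.\<close>

lemma up_eq: "up \<phi> = u \<psi> + x *\<^sub>R G (y0 + qq) + u ff"
proof -
  have 1: "us (w \<phi>) = \<phi> + \<eta> + (1/2) *\<^sub>R us r0"
    by (simp add: wphi lin y0_def SD \<eta>_def)
  have "uh \<phi> = y0 + x *\<^sub>R A (w \<phi>)" using uh_eq[of \<phi>] Y_eq[of \<phi>] by (simp add: y0_def)
  also have "A (w \<phi>) = G (u (\<phi> + \<eta> + (1/2) *\<^sub>R us r0)) - u (us (G (w \<phi>)))"
    by (simp add: A_def 1)
  finally have 2: "uh \<phi> = y0 + x *\<^sub>R (G (u (\<phi> + \<eta> + (1/2) *\<^sub>R us r0)) - u (us (G (w \<phi>))))" .
  have "up \<phi> = uh \<phi> - x *\<^sub>R G (u \<eta> + Y \<eta>)" by (simp add: up_def \<eta>_def uh_eq[of "D \<phi>"])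
  then show ?thesis
    by (simp add: 2 \<psi>_def ff_alt qq_def y0_def lin algebra_simps)
qed

lemma psi_eq: "\<psi> = (1 - x * \<mu>) *\<^sub>R \<phi> - x *\<^sub>R \<rho>"
  by (simp add: \<psi>_def \<rho>_def algebra_simps)

lemma h1_eq: "h1 = (1 - x * \<mu>) *\<^sub>R h0 - x *\<^sub>R sh \<mu> (u \<rho>)"
  by (simp add: h1_def psi_eq lin h0_def y0_def)

lemma hp_eq: "hp = h1 + (x *\<^sub>R G (h0 + sh \<mu> qq) + sh \<mu> (u ff))"
  by (simp add: hp_def up_eq h1_def lin sh_G h0_def)

text \<open>From |p + q|^2 \<ge> 0. Where p and q are nearly equal it beats Cauchy-Schwarz.\<close>

lemma half_prod: "- (norm (p - q))\<^sup>2 / 4 \<le> p \<bullet> q" for p q :: "'a::real_inner"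
proof -
  have "0 \<le> (norm (p + q))\<^sup>2" by simp
  then show ?thesis by (simp add: power2_norm_eq_inner algebra_simps inner_commute[of q p])
qed

lemma Ko_pos: "\<xi> \<bullet> Ko \<xi> = u \<xi> \<bullet> G (u \<xi>)" by (simp add: Ko_def u_adj)

text \<open>Both \<mu> and the spectrum of \<open>Ko\<close> lie in [0, l]. The spectral information
  is used only through \<open>kk\<close>, that is Ko^2 \<le> l Ko, and the range of (\<xi>, Ko
  \<xi>).\<close>

lemma Ko_shift: "norm (\<mu> *\<^sub>R \<xi> - Ko \<xi>) \<le> l * norm \<xi>"
proof -
  define k where "k = \<xi> \<bullet> Ko \<xi>"
  have k0: "0 \<le> k" unfolding k_def Ko_pos by (rule G_pos)
  have k1: "k \<le> l * (\<xi> \<bullet> \<xi>)" unfolding k_def Ko_pos using G_le[of "u \<xi>"] u_le[of \<xi>] by linarith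
  have "norm (Ko \<xi>) \<le> L * gam (u \<xi>)"
    unfolding Ko_def by (rule order_trans[OF norm_us mult_left_mono[OF norm_G_le_gam L_nonneg]])
  then have "(norm (Ko \<xi>))\<^sup>2 \<le> (L * gam (u \<xi>))\<^sup>2" by (rule power_mono) simp
  also have "\<dots> = (L * L) * (gam (u \<xi>))\<^sup>2" by (simp add: power2_eq_square algebra_simps)
  also have "\<dots> = l * k" by (simp only: L_sq gam_sq k_def Ko_pos)
  finally have kk: "Ko \<xi> \<bullet> Ko \<xi> \<le> l * k" by (simp add: power2_norm_eq_inner)
  have "(norm (\<mu> *\<^sub>R \<xi> - Ko \<xi>))\<^sup>2 = Ko \<xi> \<bullet> Ko \<xi> - 2 * \<mu> * k + \<mu>\<^sup>2 * (\<xi> \<bullet> \<xi>)"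
    unfolding power2_norm_eq_inner k_def
    by (simp add: algebra_simps power2_eq_square inner_commute[of "Ko \<xi>" \<xi>])
  also have "\<dots> \<le> l\<^sup>2 * (\<xi> \<bullet> \<xi>)"
  proof (cases "l \<le> 2 * \<mu>")
    case True
    have "Ko \<xi> \<bullet> Ko \<xi> - 2 * \<mu> * k + \<mu>\<^sup>2 * (\<xi> \<bullet> \<xi>) \<le> \<mu>\<^sup>2 * (\<xi> \<bullet> \<xi>)"
      using kk mult_right_mono[OF True k0] by simp
    also have "\<dots> \<le> l\<^sup>2 * (\<xi> \<bullet> \<xi>)"
      using mu l_ge by (intro mult_right_mono power_mono) auto
    finally show ?thesis .
  next
    case False
    have "Ko \<xi> \<bullet> Ko \<xi> - 2 * \<mu> * k + \<mu>\<^sup>2 * (\<xi> \<bullet> \<xi>) \<le> (l - 2 * \<mu>) * k + \<mu>\<^sup>2 * (\<xi> \<bullet> \<xi>)"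
      using kk by (simp add: algebra_simps)
    also have "\<dots> \<le> (l - 2 * \<mu>) * (l * (\<xi> \<bullet> \<xi>)) + \<mu>\<^sup>2 * (\<xi> \<bullet> \<xi>)"
      using mult_left_mono[OF k1, of "l - 2 * \<mu>"] False by simp
    also have "\<dots> = (l - \<mu>)\<^sup>2 * (\<xi> \<bullet> \<xi>)" by (simp add: power2_eq_square algebra_simps)
    also have "\<dots> \<le> l\<^sup>2 * (\<xi> \<bullet> \<xi>)"
      using mu l_ge by (intro mult_right_mono power_mono) auto
    finally show ?thesis .
  qed
  also have "\<dots> = (l * norm \<xi>)\<^sup>2" by (simp add: power_mult_distrib power2_norm_eq_inner)
  finally show ?thesis by (rule power2_le_imp_le) (use l_ge in simp)
qed

lemma us_G_mu: "norm (us (G (sh \<mu> h0))) \<le> L * \<gamma>"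
proof -
  have "norm (G (sh \<mu> h0)) \<le> \<gamma>"
    using norm_G_le_gam[of "sh \<mu> h0"] gam_sh_le[of \<mu> 1 h0] mu by (simp add: \<gamma>_def)
  then show ?thesis by (rule order_trans[OF norm_us mult_left_mono[OF _ L_nonneg]])
qed

lemma Ys_G_mu: "norm (Ys (G (sh \<mu> h0))) \<le> x * l * L * \<gamma>"
proof -
  have "norm (G (sh \<mu> h0)) \<le> \<gamma>"
    using norm_G_le_gam[of "sh \<mu> h0"] gam_sh_le[of \<mu> 1 h0] mu by (simp add: \<gamma>_def)
  then have "N2 (G (sh \<mu> h0)) \<le> L * \<gamma>" by (rule order_trans[OF N2_le mult_left_mono[OF _ L_nonneg]])
  then have "norm (ws (A (G (sh \<mu> h0)))) \<le> l * (L * \<gamma>)"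
    using l_ge by (intro order_trans[OF norm_ws_A mult_left_mono]) auto
  then show ?thesis using x_pos by (simp add: Ys_eq mult_left_mono mult.assoc)
qed

lemma norm_Y: "norm (Y \<xi>) \<le> x * l * L * norm \<xi>"
proof -
  have "norm (A (w \<xi>)) \<le> l * (L * norm \<xi>)"
    using l_ge by (intro order_trans[OF norm_A_le mult_left_mono[OF norm_w]]) auto
  then show ?thesis using x_pos by (simp add: Y_eq mult_left_mono mult.assoc)
qed

text \<open>In the leading term the two factors differ only by (\<mu> - Ko) us h0, of norm at most l
  \<beta>. So \<open>half_prod\<close> loses l^2 \<beta>^2 / 4, and the prefactor 3/2 makes this
  3/8.\<close>

lemma ff_main: "- ((x * x) * ((3/8) * l\<^sup>2 * \<beta>\<^sup>2 + \<beta> * (2 * d * \<beta> + e1))) \<le> us (sh \<mu> h0) \<bullet> ff"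
proof -
  let ?g = "us (G h0)" and ?u = "us h0"
  have a: "us (sh \<mu> h0) = ?g - \<mu> *\<^sub>R ?u" by (simp add: sh_def lin)
  have "norm (?g - \<mu> *\<^sub>R ?u - (?g - Ko ?u)) = norm (\<mu> *\<^sub>R ?u - Ko ?u)"
    by (simp add: norm_minus_commute)
  also have "\<dots> \<le> l * \<beta>"
    using Ko_shift[of ?u] mult_left_mono[OF us_h0, of l] l_ge by linarith
  finally have "(norm (?g - \<mu> *\<^sub>R ?u - (?g - Ko ?u)))\<^sup>2 \<le> (l * \<beta>)\<^sup>2" by (rule power_mono) simp
  then have 1: "- (l * \<beta>)\<^sup>2 / 4 \<le> (?g - \<mu> *\<^sub>R ?u) \<bullet> (?g - Ko ?u)"
    using half_prod[of "?g - \<mu> *\<^sub>R ?u" "?g - Ko ?u"] by linarith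
  have "norm (?g + \<mu> *\<^sub>R ?u) \<le> \<beta> + \<mu> * \<beta>"
    using norm_triangle_ineq[of ?g "\<mu> *\<^sub>R ?u"] us_G_h0 mult_left_mono[OF us_h0 mu(1)] mu by simp
  also have "\<dots> \<le> 2 * \<beta>" using mu beta_nonneg mult_right_mono[of \<mu> 1 \<beta>] by simp
  finally have "norm (D (?g + \<mu> *\<^sub>R ?u)) \<le> d * (2 * \<beta>)"
    by (rule order_trans[OF norm_D mult_left_mono[OF _ d_nonneg]])
  then have 2: "norm (D (?g + \<mu> *\<^sub>R ?u) + E1) \<le> 2 * d * \<beta> + e1"
    using norm_triangle_ineq[of "D (?g + \<mu> *\<^sub>R ?u)" E1] by (simp add: e1_def)
  have "\<bar>us (sh \<mu> h0) \<bullet> (D (?g + \<mu> *\<^sub>R ?u) + E1)\<bar> \<le> \<beta> * (2 * d * \<beta> + e1)"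
    by (rule order_trans[OF Cauchy_Schwarz_ineq2 mult_mono[OF us_mu_h0 2]]) (simp_all add: beta_nonneg)
  then have 3: "- (\<beta> * (2 * d * \<beta> + e1)) \<le> us (sh \<mu> h0) \<bullet> (D (?g + \<mu> *\<^sub>R ?u) + E1)" by linarith
  have "- ((3/8) * l\<^sup>2 * \<beta>\<^sup>2 + \<beta> * (2 * d * \<beta> + e1))
      \<le> (3/2) * ((?g - \<mu> *\<^sub>R ?u) \<bullet> (?g - Ko ?u)) + us (sh \<mu> h0) \<bullet> (D (?g + \<mu> *\<^sub>R ?u) + E1)"
    using 1 3 by (simp add: power_mult_distrib)
  also have "\<dots> = us (sh \<mu> h0) \<bullet> ((3/2) *\<^sub>R (?g - Ko ?u) + D (?g + \<mu> *\<^sub>R ?u) + E1)"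
    by (simp add: a[symmetric] inner_add_right)
  finally have "(x * x) * - ((3/8) * l\<^sup>2 * \<beta>\<^sup>2 + \<beta> * (2 * d * \<beta> + e1))
      \<le> (x * x) * (us (sh \<mu> h0) \<bullet> ((3/2) *\<^sub>R (?g - Ko ?u) + D (?g + \<mu> *\<^sub>R ?u) + E1))"
    by (rule mult_left_mono) simp
  then show ?thesis by (subst ff_eq) (simp only: inner_scaleR_right mult_minus_right)
qed

lemma ff_norm: "norm ff \<le> (x * x) * ((3/2) * (1 + l) * \<beta> + 2 * d * \<beta> + e1)"
proof -
  let ?g = "us (G h0)" and ?u = "us h0"
  have "norm (Ko ?u) \<le> l * \<beta>"
    using norm_us_u[of G ?u 1] norm_G_le[of "u ?u"] mult_left_mono[OF us_h0, of l] l_ge unfolding Ko_def by linarith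
  then have "norm (?g - Ko ?u) \<le> (1 + l) * \<beta>"
    using norm_triangle_ineq4[of ?g "Ko ?u"] us_G_h0 by (simp add: algebra_simps)
  from mult_left_mono[OF this, of "3/2"]
  have 1: "norm ((3/2) *\<^sub>R (?g - Ko ?u)) \<le> (3/2) * (1 + l) * \<beta>"
    unfolding norm_scaleR by (simp only: mult.assoc) simp
  have "norm (?g + \<mu> *\<^sub>R ?u) \<le> \<beta> + \<mu> * \<beta>"
    using norm_triangle_ineq[of ?g "\<mu> *\<^sub>R ?u"] us_G_h0 mult_left_mono[OF us_h0 mu(1)] mu by simp
  also have "\<dots> \<le> 2 * \<beta>" using mu beta_nonneg mult_right_mono[of \<mu> 1 \<beta>] by simp
  finally have "norm (D (?g + \<mu> *\<^sub>R ?u)) \<le> d * (2 * \<beta>)"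
    by (rule order_trans[OF norm_D mult_left_mono[OF _ d_nonneg]])
  then have "norm ((3/2) *\<^sub>R (?g - Ko ?u) + D (?g + \<mu> *\<^sub>R ?u) + E1) \<le> (3/2) * (1 + l) * \<beta> + 2 * d * \<beta> + e1"
    using norm_triangle_ineq[of "(3/2) *\<^sub>R (?g - Ko ?u) + D (?g + \<mu> *\<^sub>R ?u)" E1]
      norm_triangle_ineq[of "(3/2) *\<^sub>R (?g - Ko ?u)" "D (?g + \<mu> *\<^sub>R ?u)"] 1 by (simp add: e1_def)
  from mult_left_mono[OF this, of "x * x"] show ?thesis by (subst ff_eq) simp
qed

lemma xmu: "0 \<le> x * \<mu>" "x * \<mu> \<le> x" "x * \<mu> \<le> 1" "x \<le> x * l"
proof -
  show a: "0 \<le> x * \<mu>" using x_pos mu by simp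
  show b: "x * \<mu> \<le> x" using mult_left_mono[of \<mu> 1 x] x_pos mu by simp
  show c: "x \<le> x * l" using mult_left_mono[of 1 l x] x_pos l_ge by simp
  show "x * \<mu> \<le> 1" using b c p_le by linarith
qed

text \<open>Up to a multiple of x \<rho>, \<open>h1\<close> is (1 - x \<mu>) h0, and the increment
  begins with x G h0; their product is the gain x \<gamma>^2. Everything paired with \<rho> carries
  a further factor x.\<close>

lemma H_bound:
  "h1 \<bullet> (hp - h1) \<ge>
     (1 - x * \<mu>) * (x * (\<gamma>\<^sup>2 - (1/2) * L * \<gamma> * R0 - x * l * L * \<gamma> * n
        - x * ((3/8) * l\<^sup>2 * \<beta>\<^sup>2 + \<beta> * (2 * d * \<beta> + e1))))
     - x\<^sup>2 * \<rho>n * (L * \<gamma> + (1/2) * l * R0 + x * l\<^sup>2 * n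
        + x * l * ((3/2) * (1 + l) * \<beta> + 2 * d * \<beta> + e1))"
proof -
  define \<Delta> where "\<Delta> = x *\<^sub>R G (h0 + sh \<mu> qq) + sh \<mu> (u ff)"
  have hpd: "hp - h1 = \<Delta>" by (simp add: hp_eq \<Delta>_def)
  have i1: "h0 \<bullet> \<Delta> = x * \<gamma>\<^sup>2 + x * ((1/2) * (us (G (sh \<mu> h0)) \<bullet> us r0) - Ys (G (sh \<mu> h0)) \<bullet> \<eta>)
      + us (sh \<mu> h0) \<bullet> ff"
  proof -
    have "h0 \<bullet> G (sh \<mu> qq) = G (sh \<mu> h0) \<bullet> qq" by (metis G_sym sh_sym sh_G)
    also have "\<dots> = (1/2) * (us (G (sh \<mu> h0)) \<bullet> us r0) - Ys (G (sh \<mu> h0)) \<bullet> \<eta>"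
      by (simp add: qq_def inner_diff_right inner_commute[of "G (sh \<mu> h0)"] u_adj Y_adj inner_commute[of "us r0"]
          inner_commute[of \<eta>])
    finally have q: "h0 \<bullet> G (sh \<mu> qq) = (1/2) * (us (G (sh \<mu> h0)) \<bullet> us r0) - Ys (G (sh \<mu> h0)) \<bullet> \<eta>" .
    have f: "h0 \<bullet> sh \<mu> (u ff) = us (sh \<mu> h0) \<bullet> ff"
      by (metis sh_sym u_adj inner_commute)
    show ?thesis by (simp add: \<Delta>_def lin inner_add_right q f \<gamma>_def gam_sq algebra_simps)
  qed
  have a: "- (L * \<gamma> * R0) \<le> us (G (sh \<mu> h0)) \<bullet> us r0"
    using order_trans[OF Cauchy_Schwarz_ineq2 mult_right_mono[OF us_G_mu], of "us r0"] by (simp add: R0_def)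
  have b': "Ys (G (sh \<mu> h0)) \<bullet> \<eta> \<le> x * l * L * \<gamma> * n"
    using order_trans[OF Cauchy_Schwarz_ineq2 mult_right_mono[OF Ys_G_mu], of "\<eta>"] by (simp add: n_def)
  have H1: "x * (\<gamma>\<^sup>2 - (1/2) * L * \<gamma> * R0 - x * l * L * \<gamma> * n
        - x * ((3/8) * l\<^sup>2 * \<beta>\<^sup>2 + \<beta> * (2 * d * \<beta> + e1))) \<le> h0 \<bullet> \<Delta>"
  proof -
    have "x * ((1/2) * (us (G (sh \<mu> h0)) \<bullet> us r0) - Ys (G (sh \<mu> h0)) \<bullet> \<eta>)
        \<ge> x * (- (1/2) * L * \<gamma> * R0 - x * l * L * \<gamma> * n)"
      using a b' x_pos by (intro mult_left_mono) auto
    with ff_main show ?thesis unfolding i1 by (simp add: algebra_simps)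
  qed
  have nq: "norm qq \<le> (1/2) * (L * R0) + x * l * L * n"
    using norm_triangle_ineq4[of "(1/2) *\<^sub>R u (us r0)" "Y \<eta>"] norm_u[of "us r0"] norm_Y[of \<eta>]
    by (simp add: qq_def R0_def n_def)
  have "\<bar>sh \<mu> (u \<rho>) \<bullet> \<Delta>\<bar> \<le> \<rho>n * (x * (L * \<gamma>) + x * (l * ((1/2) * R0 + x * l * n)) + l * norm ff)"
  proof -
    have s1: "sh \<mu> (u \<rho>) \<bullet> G h0 = \<rho> \<bullet> us (G (sh \<mu> h0))" by (metis sh_sym u_adj sh_G)
    have e1': "\<bar>\<rho> \<bullet> us (G (sh \<mu> h0))\<bar> \<le> \<rho>n * (L * \<gamma>)"
      using order_trans[OF Cauchy_Schwarz_ineq2 mult_left_mono[OF us_G_mu], of \<rho>] by (simp add: \<rho>n_def)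
    have nr: "norm (sh \<mu> (u \<rho>)) \<le> L * \<rho>n"
      using norm_mu[of "u \<rho>"] norm_u[of \<rho>] by (simp add: \<rho>n_def)
    have "norm (G (sh \<mu> qq)) \<le> (1/2) * (L * R0) + x * l * L * n"
      using norm_G_le[of "sh \<mu> qq"] norm_mu[of qq] nq by linarith
    then have "\<bar>sh \<mu> (u \<rho>) \<bullet> G (sh \<mu> qq)\<bar> \<le> (L * \<rho>n) * ((1/2) * (L * R0) + x * l * L * n)"
      using nr L_nonneg by (intro order_trans[OF Cauchy_Schwarz_ineq2 mult_mono]) (auto simp: \<rho>n_def)
    also have "\<dots> = \<rho>n * ((L * L) * ((1/2) * R0 + x * l * n))" by (simp add: algebra_simps)
    finally have e2: "\<bar>sh \<mu> (u \<rho>) \<bullet> G (sh \<mu> qq)\<bar> \<le> \<rho>n * (l * ((1/2) * R0 + x * l * n))" by (simp only: L_sq)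
    have "norm (sh \<mu> (u ff)) \<le> L * norm ff" using norm_mu[of "u ff"] norm_u[of ff] by linarith
    then have "\<bar>sh \<mu> (u \<rho>) \<bullet> sh \<mu> (u ff)\<bar> \<le> (L * \<rho>n) * (L * norm ff)"
      using nr L_nonneg by (intro order_trans[OF Cauchy_Schwarz_ineq2 mult_mono]) (auto simp: \<rho>n_def)
    also have "\<dots> = \<rho>n * ((L * L) * norm ff)" by (simp add: algebra_simps)
    finally have e3: "\<bar>sh \<mu> (u \<rho>) \<bullet> sh \<mu> (u ff)\<bar> \<le> \<rho>n * (l * norm ff)" by (simp only: L_sq)
    have "sh \<mu> (u \<rho>) \<bullet> \<Delta> = x * (\<rho> \<bullet> us (G (sh \<mu> h0))) + x * (sh \<mu> (u \<rho>) \<bullet> G (sh \<mu> qq)) + sh \<mu> (u \<rho>) \<bullet> sh \<mu> (u ff)"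
      by (simp add: \<Delta>_def lin inner_add_right s1 algebra_simps)
    then have "\<bar>sh \<mu> (u \<rho>) \<bullet> \<Delta>\<bar> \<le> x * \<bar>\<rho> \<bullet> us (G (sh \<mu> h0))\<bar> + x * \<bar>sh \<mu> (u \<rho>) \<bullet> G (sh \<mu> qq)\<bar> + \<bar>sh \<mu> (u \<rho>) \<bullet> sh \<mu> (u ff)\<bar>"
      using x_pos abs_triangle_ineq[of "x * (\<rho> \<bullet> us (G (sh \<mu> h0))) + x * (sh \<mu> (u \<rho>) \<bullet> G (sh \<mu> qq))" "sh \<mu> (u \<rho>) \<bullet> sh \<mu> (u ff)"]
        abs_triangle_ineq[of "x * (\<rho> \<bullet> us (G (sh \<mu> h0)))" "x * (sh \<mu> (u \<rho>) \<bullet> G (sh \<mu> qq))"] by (simp add: abs_mult)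
    also have "\<dots> \<le> x * (\<rho>n * (L * \<gamma>)) + x * (\<rho>n * (l * ((1/2) * R0 + x * l * n))) + \<rho>n * (l * norm ff)"
      using e1' e2 e3 x_pos by (intro add_mono mult_left_mono) auto
    finally show ?thesis by (simp add: algebra_simps)
  qed
  also have "\<dots> \<le> \<rho>n * (x * (L * \<gamma>) + x * (l * ((1/2) * R0 + x * l * n)) + l * ((x * x) * ((3/2) * (1 + l) * \<beta> + 2 * d * \<beta> + e1)))"
    using ff_norm l_ge by (intro mult_left_mono add_left_mono) (auto simp: \<rho>n_def)
  finally have "sh \<mu> (u \<rho>) \<bullet> \<Delta> \<le> \<rho>n * (x * (L * \<gamma>) + x * (l * ((1/2) * R0 + x * l * n)) + l * ((x * x) * ((3/2) * (1 + l) * \<beta> + 2 * d * \<beta> + e1)))"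
    by linarith
  from mult_left_mono[OF this, of x] x_pos
  have H2: "x * (sh \<mu> (u \<rho>) \<bullet> \<Delta>) \<le> x\<^sup>2 * \<rho>n * (L * \<gamma> + (1/2) * l * R0 + x * l\<^sup>2 * n
        + x * l * ((3/2) * (1 + l) * \<beta> + 2 * d * \<beta> + e1))"
    by (simp add: algebra_simps power2_eq_square)
  have "h1 \<bullet> \<Delta> = (1 - x * \<mu>) * (h0 \<bullet> \<Delta>) - x * (sh \<mu> (u \<rho>) \<bullet> \<Delta>)"
    by (simp add: h1_eq inner_diff_left)
  moreover have "(1 - x * \<mu>) * (x * (\<gamma>\<^sup>2 - (1/2) * L * \<gamma> * R0 - x * l * L * \<gamma> * n
        - x * ((3/8) * l\<^sup>2 * \<beta>\<^sup>2 + \<beta> * (2 * d * \<beta> + e1)))) \<le> (1 - x * \<mu>) * (h0 \<bullet> \<Delta>)"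
    using H1 xmu by (intro mult_left_mono) auto
  ultimately show ?thesis unfolding hpd using H2 by linarith
qed

end

section \<open>Change of the defect form over one step\<close>

context test_vector
begin

definition "\<kappa> = gam (uh \<eta>)"
definition "ch = D \<psi>"
definition "chn = norm ch"
text \<open>Chosen so that \<open>\<theta> * (1 - x * \<mu>)^2\<close> is 1 - 2 x \<mu>: then
  \<theta> times the form at \<psi> cancels (\<phi>, D \<phi>) exactly and the term in (\<rho>,
  \<eta>) up to order x^2, while 1 - \<theta> is itself of order x^2.\<close>

definition "\<theta> = (1 - 2 * (x * \<mu>)) / (1 - x * \<mu>)\<^sup>2"

lemma K_phi: "K \<phi> = \<mu> *\<^sub>R \<phi> + \<rho>" by (simp add: \<rho>_def)

lemma Dp_eq: "Dp \<xi> = D \<xi> - x *\<^sub>R K (D \<xi>) - x *\<^sub>R D (K \<xi>) + (x * x) *\<^sub>R D (uhs (G (G (uh (D \<xi>)))))"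
  by (simp add: Dp_def ups_def up_def lin K_def gram_eq SD scaleR_diff_right)

lemma Dp_inner: "\<phi> \<bullet> Dp \<phi> = \<phi> \<bullet> \<eta> - 2 * x * (K \<phi> \<bullet> \<eta>) + x\<^sup>2 * (norm (G (uh \<eta>)))\<^sup>2"
proof -
  have 1: "\<phi> \<bullet> K \<eta> = K \<phi> \<bullet> \<eta>" by (simp add: K_sym)
  have 2: "\<phi> \<bullet> D (K \<phi>) = K \<phi> \<bullet> \<eta>" by (simp add: D_sym[symmetric] \<eta>_def inner_commute)
  have 3: "\<phi> \<bullet> D (uhs (G (G (uh \<eta>)))) = (norm (G (uh \<eta>)))\<^sup>2"
    by (simp add: D_sym[symmetric] \<eta>_def[symmetric] uh_adj[symmetric] power2_norm_eq_inner)
      (simp add: G_sym)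
  show ?thesis by (simp add: Dp_eq \<eta>_def[symmetric] inner_add_right inner_diff_right 1 2 3 power2_eq_square)
qed

lemma chi_eq: "ch = (1 - x * \<mu>) *\<^sub>R \<eta> - x *\<^sub>R D \<rho>"
  by (simp add: ch_def psi_eq lin \<eta>_def)

lemma Dp_chi: "Dp \<phi> = ch - (x *\<^sub>R K \<eta> - (x * x) *\<^sub>R D (uhs (G (G (uh \<eta>)))))"
  by (simp add: Dp_eq ch_def \<psi>_def lin \<eta>_def)

context
  assumes x_half: "2 * x \<le> 1"
begin

lemma om: "0 < 1 - x * \<mu>" "0 \<le> 1 - 2 * (x * \<mu>)"
  using xmu x_half x_pos by linarith+

lemma theta: "0 \<le> \<theta>" "\<theta> \<le> 1" "1 - \<theta> = (x * \<mu> / (1 - x * \<mu>))\<^sup>2"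
proof -
  show "0 \<le> \<theta>" using om by (simp add: \<theta>_def)
  have "(1 - x * \<mu>)\<^sup>2 = 1 - 2 * (x * \<mu>) + (x * \<mu>)\<^sup>2" by (simp add: power2_eq_square algebra_simps)
  then have *: "\<theta> = ((1 - x * \<mu>)\<^sup>2 - (x * \<mu>)\<^sup>2) / (1 - x * \<mu>)\<^sup>2" by (simp add: \<theta>_def)
  then have "\<theta> = 1 - (x * \<mu>)\<^sup>2 / (1 - x * \<mu>)\<^sup>2" using om by (simp add: diff_divide_distrib)
  then show e: "1 - \<theta> = (x * \<mu> / (1 - x * \<mu>))\<^sup>2" by (simp add: power_divide)
  have "0 \<le> (x * \<mu> / (1 - x * \<mu>))\<^sup>2" by simp
  with e show "\<theta> \<le> 1" by linarith
qed

lemma delta_part: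
  "\<phi> \<bullet> Dp \<phi> - \<theta> * (\<psi> \<bullet> D \<psi>) \<ge> - x\<^sup>2 * (2 / (1 - x * \<mu>) * n * \<rho>n + d * \<rho>n\<^sup>2)"
proof -
  let ?a = "1 - x * \<mu>"
  have e1: "\<psi> \<bullet> D \<psi> = ?a\<^sup>2 * (\<phi> \<bullet> \<eta>) - 2 * ?a * x * (\<rho> \<bullet> \<eta>) + x\<^sup>2 * (\<rho> \<bullet> D \<rho>)"
  proof -
    have "\<phi> \<bullet> D \<rho> = \<rho> \<bullet> \<eta>" by (simp add: D_sym[symmetric] \<eta>_def inner_commute)
    then show ?thesis
      by (simp add: psi_eq lin inner_diff_left inner_diff_right \<eta>_def power2_eq_square algebra_simps)
  qed
  have t1: "\<theta> * ?a\<^sup>2 = 1 - 2 * (x * \<mu>)" using om by (simp add: \<theta>_def)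
  have t2: "\<theta> * ?a = 1 - x * \<mu> / ?a"
  proof -
    have "\<theta> * ?a = (1 - 2 * (x * \<mu>)) / ?a" using om by (simp add: \<theta>_def power2_eq_square)
    then show ?thesis using om(1) by (simp add: field_simps)
  qed
  have "\<theta> * (\<psi> \<bullet> D \<psi>) = (\<theta> * ?a\<^sup>2) * (\<phi> \<bullet> \<eta>) - 2 * (\<theta> * ?a) * x * (\<rho> \<bullet> \<eta>) + x\<^sup>2 * (\<theta> * (\<rho> \<bullet> D \<rho>))"
    unfolding e1 by (simp add: algebra_simps)
  then have e2: "\<phi> \<bullet> Dp \<phi> - \<theta> * (\<psi> \<bullet> D \<psi>)
      = x\<^sup>2 * (norm (G (uh \<eta>)))\<^sup>2 - 2 * x * (x * \<mu> / ?a) * (\<rho> \<bullet> \<eta>) - x\<^sup>2 * (\<theta> * (\<rho> \<bullet> D \<rho>))"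
    unfolding t1 t2 by (simp add: Dp_inner K_phi inner_add_left algebra_simps)
  have "\<theta> * (\<rho> \<bullet> D \<rho>) \<le> \<theta> * (d * \<rho>n\<^sup>2)"
    using theta D_upper[of \<rho>] by (intro mult_left_mono) (auto simp: \<rho>n_def power2_norm_eq_inner)
  also have "\<dots> \<le> d * \<rho>n\<^sup>2" using theta d_nonneg mult_right_mono[of \<theta> 1 "d * \<rho>n\<^sup>2"] by simp
  finally have 1: "x\<^sup>2 * (\<theta> * (\<rho> \<bullet> D \<rho>)) \<le> x\<^sup>2 * (d * \<rho>n\<^sup>2)" by (intro mult_left_mono) auto
  have "\<rho> \<bullet> \<eta> \<le> n * \<rho>n" using norm_cauchy_schwarz[of \<rho> \<eta>] by (simp add: n_def \<rho>n_def mult.commute)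
  then have "(2 * x * (x * \<mu> / ?a)) * (\<rho> \<bullet> \<eta>) \<le> (2 * x * (x * \<mu> / ?a)) * (n * \<rho>n)"
    using om x_pos mu by (intro mult_left_mono) auto
  also have "\<dots> = \<mu> * (x\<^sup>2 * (2 / ?a * n * \<rho>n))" by (simp add: power2_eq_square)
  also have "\<dots> \<le> 1 * (x\<^sup>2 * (2 / ?a * n * \<rho>n))"
    using mu om n_nonneg by (intro mult_right_mono) (auto simp: \<rho>n_def)
  finally have 2: "(2 * x * (x * \<mu> / ?a)) * (\<rho> \<bullet> \<eta>) \<le> x\<^sup>2 * (2 / ?a * n * \<rho>n)" by simp
  have 3: "0 \<le> x\<^sup>2 * (norm (G (uh \<eta>)))\<^sup>2" by simp
  have "- x\<^sup>2 * (2 / ?a * n * \<rho>n + d * \<rho>n\<^sup>2) = - (x\<^sup>2 * (2 / ?a * n * \<rho>n)) - x\<^sup>2 * (d * \<rho>n\<^sup>2)"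
    by (simp add: distrib_left)
  then show ?thesis unfolding e2 using 1 2 3 by linarith
qed

lemma kappa_nonneg: "0 \<le> \<kappa>" by (simp add: \<kappa>_def gam_nonneg)

lemma K_eta: "norm (K \<eta>) \<le> L * \<kappa>" "\<eta> \<bullet> K \<eta> = \<kappa>\<^sup>2"
  "norm (D (uhs (G (G (uh \<eta>))))) \<le> d * (L * \<kappa>)" "norm (uhs (G (G (uh \<eta>)))) \<le> L * \<kappa>"
proof -
  have g: "norm (G (uh \<eta>)) \<le> \<kappa>" unfolding \<kappa>_def by (rule norm_G_le_gam)
  show "norm (K \<eta>) \<le> L * \<kappa>" unfolding K_def
    by (rule order_trans[OF norm_uhs mult_left_mono[OF g L_nonneg]])
  show "\<eta> \<bullet> K \<eta> = \<kappa>\<^sup>2" by (simp add: \<kappa>_def gam_sq K_def uh_adj)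
  show m: "norm (uhs (G (G (uh \<eta>)))) \<le> L * \<kappa>"
    by (rule order_trans[OF norm_uhs mult_left_mono[OF order_trans[OF norm_G_le g] L_nonneg]])
  show "norm (D (uhs (G (G (uh \<eta>))))) \<le> d * (L * \<kappa>)"
    by (rule order_trans[OF norm_D mult_left_mono[OF m d_nonneg]])
qed

lemma chin_le: "chn \<le> n + x * d * \<rho>n"
proof -
  have "chn \<le> (1 - x * \<mu>) * n + x * norm (D \<rho>)"
    unfolding chn_def chi_eq using norm_triangle_ineq4[of "(1 - x * \<mu>) *\<^sub>R \<eta>" "x *\<^sub>R D \<rho>"] om x_pos
    by (simp add: n_def)
  also have "\<dots> \<le> 1 * n + x * (d * \<rho>n)"
    using xmu n_nonneg x_pos norm_D[of \<rho>] by (intro add_mono mult_right_mono mult_left_mono) (auto simp: \<rho>n_def)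
  finally show ?thesis by (simp add: mult.assoc)
qed

text \<open>The new defect at \<phi> is D \<psi> minus x z, with z equal to K \<eta> up to order x.
  The cross term contributes 2 x (1 - x \<mu>) \<kappa>^2; all the rest has the factor x^2.\<close>

lemma eta_part:
  "\<theta> * (norm (D \<psi>))\<^sup>2 - (norm (Dp \<phi>))\<^sup>2 \<ge>
    x\<^sup>2 * (2 / x * (1 - x * \<mu>) * \<kappa>\<^sup>2 - 2 * L * d * \<kappa> * (\<rho>n + chn) - l * (1 + x * d)\<^sup>2 * \<kappa>\<^sup>2
      - (chn / (1 - x * \<mu>))\<^sup>2)"
proof -
  let ?M = "uhs (G (G (uh \<eta>)))" and ?a = "1 - x * \<mu>"
  define z where "z = K \<eta> - x *\<^sub>R D ?M"
  have Dz: "Dp \<phi> = ch - x *\<^sub>R z" by (simp add: Dp_chi z_def algebra_simps)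
  have "(norm (Dp \<phi>))\<^sup>2 = chn\<^sup>2 - 2 * x * (ch \<bullet> z) + x\<^sup>2 * (norm z)\<^sup>2"
    unfolding Dz chn_def power2_norm_eq_inner
    by (simp add: inner_diff_left inner_diff_right inner_commute[of z ch] power2_eq_square algebra_simps)
  then have e: "\<theta> * (norm (D \<psi>))\<^sup>2 - (norm (Dp \<phi>))\<^sup>2
      = 2 * x * (ch \<bullet> z) - x\<^sup>2 * (norm z)\<^sup>2 - (1 - \<theta>) * chn\<^sup>2"
    by (simp add: chn_def[symmetric] ch_def[symmetric] algebra_simps)
  have nz: "norm z \<le> L * \<kappa> * (1 + x * d)"
  proof -
    have "norm z \<le> norm (K \<eta>) + x * norm (D ?M)"
      unfolding z_def using norm_triangle_ineq4[of "K \<eta>" "x *\<^sub>R D ?M"] x_pos by simp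
    also have "\<dots> \<le> L * \<kappa> + x * (d * (L * \<kappa>))"
      using K_eta x_pos by (intro add_mono mult_left_mono) auto
    finally show ?thesis by (simp add: algebra_simps)
  qed
  have "(norm z)\<^sup>2 \<le> (L * \<kappa> * (1 + x * d))\<^sup>2" using nz by (rule power_mono) simp
  also have "\<dots> = (L * L) * (1 + x * d)\<^sup>2 * \<kappa>\<^sup>2" by (simp add: power2_eq_square algebra_simps)
  also have "\<dots> = l * (1 + x * d)\<^sup>2 * \<kappa>\<^sup>2" by (simp only: L_sq)
  finally have 1: "x\<^sup>2 * (norm z)\<^sup>2 \<le> x\<^sup>2 * (l * (1 + x * d)\<^sup>2 * \<kappa>\<^sup>2)" by (intro mult_left_mono) auto
  have 2: "(1 - \<theta>) * chn\<^sup>2 \<le> x\<^sup>2 * (chn / ?a)\<^sup>2"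
  proof -
    have "(1 - \<theta>) * chn\<^sup>2 = \<mu>\<^sup>2 * (x\<^sup>2 * (chn / ?a)\<^sup>2)"
      using theta(3) by (simp add: power_divide power_mult_distrib)
    also have "\<dots> \<le> 1 * (x\<^sup>2 * (chn / ?a)\<^sup>2)"
      using mu by (intro mult_right_mono) (auto simp: power_le_one)
    finally show ?thesis by simp
  qed
  have "ch \<bullet> z = ?a * \<kappa>\<^sup>2 - x * (D \<rho> \<bullet> K \<eta>) - x * (D ch \<bullet> ?M)"
  proof -
    have "ch \<bullet> K \<eta> = ?a * \<kappa>\<^sup>2 - x * (D \<rho> \<bullet> K \<eta>)"
      by (simp add: chi_eq inner_diff_left K_eta(2))
    moreover have "ch \<bullet> D ?M = D ch \<bullet> ?M" by (simp add: D_sym)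
    ultimately show ?thesis by (simp add: z_def inner_diff_right)
  qed
  moreover have "D \<rho> \<bullet> K \<eta> \<le> L * d * \<kappa> * \<rho>n"
  proof -
    have "D \<rho> \<bullet> K \<eta> \<le> norm (D \<rho>) * norm (K \<eta>)" by (rule norm_cauchy_schwarz)
    also have "\<dots> \<le> (d * \<rho>n) * (L * \<kappa>)"
      using norm_D[of \<rho>] K_eta(1) d_nonneg by (intro mult_mono) (auto simp: \<rho>n_def)
    finally show ?thesis by (simp add: algebra_simps)
  qed
  moreover have "D ch \<bullet> ?M \<le> L * d * \<kappa> * chn"
  proof -
    have "D ch \<bullet> ?M \<le> norm (D ch) * norm ?M" by (rule norm_cauchy_schwarz)
    also have "\<dots> \<le> (d * chn) * (L * \<kappa>)"
      using norm_D[of ch] K_eta(4) d_nonneg by (intro mult_mono) (auto simp: chn_def)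
    finally show ?thesis by (simp add: algebra_simps)
  qed
  ultimately have "ch \<bullet> z \<ge> ?a * \<kappa>\<^sup>2 - x * (L * d * \<kappa> * \<rho>n) - x * (L * d * \<kappa> * chn)"
    using x_pos by (smt (verit) mult_left_mono)
  then have "2 * x * (ch \<bullet> z) \<ge> 2 * x * (?a * \<kappa>\<^sup>2 - x * (L * d * \<kappa> * \<rho>n) - x * (L * d * \<kappa> * chn))"
    using x_pos by (intro mult_left_mono) auto
  moreover have "x\<^sup>2 * (2 / x * ?a * \<kappa>\<^sup>2) = 2 * x * (?a * \<kappa>\<^sup>2)" using x_pos by (simp add: power2_eq_square)
  ultimately show ?thesis unfolding e using 1 2 by (simp add: algebra_simps power2_eq_square)
qed

text \<open>The preserved Gram operator I + D is at least 1 - \<epsilon> and factors through the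
  hatted tuple, so |\<eta>| is dominated by \<open>b\<close> times \<kappa>. This makes the decay 2
  x \<kappa>^2 available against errors in n.\<close>

lemma kappa_lower:
  assumes "\<And>v. norm (uhs v) \<le> b * gam v" "\<And>\<xi>. - \<epsilon> * (\<xi> \<bullet> \<xi>) \<le> \<xi> \<bullet> D \<xi>"
  shows "(1 - \<epsilon>) * n \<le> b * \<kappa>"
proof -
  have "(1 - \<epsilon>) * (n * n) \<le> \<eta> \<bullet> (\<eta> + D \<eta>)"
    using assms(2)[of \<eta>] by (simp add: n_def inner_add_right algebra_simps power2_norm_eq_inner flip: power2_eq_square)
  also have "\<dots> \<le> n * norm (\<eta> + D \<eta>)" unfolding n_def by (rule norm_cauchy_schwarz)
  also have "\<eta> + D \<eta> = uhs (uh \<eta>)" by (simp add: gram_eq SD)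
  also have "n * norm (uhs (uh \<eta>)) \<le> n * (b * \<kappa>)"
    using assms(1) n_nonneg by (intro mult_left_mono) (auto simp: \<kappa>_def)
  finally have "n * ((1 - \<epsilon>) * n) \<le> n * (b * \<kappa>)" by (simp add: algebra_simps)
  then show ?thesis using n_nonneg kappa_nonneg b_nonneg
    by (cases "n = 0") (auto simp: mult_le_cancel_left)
qed

text \<open>The hypothesis at \<psi> is multiplied by \<theta>; \<theta> \<le> 1 allows the whole
  gain of the shifted norm to be kept. What remains is x^2 times \<open>excess\<close>.\<close>

lemma step_total:
  assumes c: "0 \<le> c"
    and hyp: "0 \<le> d * (\<psi> \<bullet> D \<psi>) - (norm (D \<psi>))\<^sup>2 + d * c * (norm (sh \<mu> (u \<psi>)))\<^sup>2"
    and tot: "0 \<le> excess x \<mu> l d c L n \<beta> \<gamma> \<kappa> \<rho>n chn R0 e1"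
  shows "0 \<le> d * (\<phi> \<bullet> Dp \<phi>) - (norm (Dp \<phi>))\<^sup>2 + d * c * (norm (sh \<mu> (up \<phi>)))\<^sup>2"
proof -
  let ?H = "(1 - x * \<mu>) / x * (\<gamma>\<^sup>2 - (1/2) * L * \<gamma> * R0 - x * l * L * \<gamma> * n
        - x * ((3/8) * l\<^sup>2 * \<beta>\<^sup>2 + \<beta> * (2 * d * \<beta> + e1)))
     - \<rho>n * (L * \<gamma> + (1/2) * l * R0 + x * l\<^sup>2 * n
        + x * l * ((3/2) * (1 + l) * \<beta> + 2 * d * \<beta> + e1))"
  have "(norm hp)\<^sup>2 = (norm h1)\<^sup>2 + 2 * (h1 \<bullet> (hp - h1)) + (norm (hp - h1))\<^sup>2"
    unfolding power2_norm_eq_inner by (simp add: inner_diff_left inner_diff_right inner_commute[of hp h1])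
  moreover have "x\<^sup>2 * ?H \<le> h1 \<bullet> (hp - h1)"
  proof -
    have eq: "x\<^sup>2 * ?H = (1 - x * \<mu>) * (x * (\<gamma>\<^sup>2 - (1/2) * L * \<gamma> * R0 - x * l * L * \<gamma> * n
        - x * ((3/8) * l\<^sup>2 * \<beta>\<^sup>2 + \<beta> * (2 * d * \<beta> + e1))))
     - x\<^sup>2 * \<rho>n * (L * \<gamma> + (1/2) * l * R0 + x * l\<^sup>2 * n
        + x * l * ((3/2) * (1 + l) * \<beta> + 2 * d * \<beta> + e1))"
      using x_pos by (simp only: right_diff_distrib[of "x\<^sup>2"]) (simp add: power2_eq_square)
    show ?thesis unfolding eq by (rule H_bound)
  qed
  moreover have "\<theta> * (norm h1)\<^sup>2 \<le> (norm h1)\<^sup>2" using theta mult_right_mono[of \<theta> 1 "(norm h1)\<^sup>2"] by simp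
  ultimately have "2 * (x\<^sup>2 * ?H) \<le> (norm hp)\<^sup>2 - \<theta> * (norm h1)\<^sup>2"
    using zero_le_power2[of "norm (hp - h1)"] by linarith
  then have h: "d * c * (2 * (x\<^sup>2 * ?H)) \<le> d * c * ((norm hp)\<^sup>2 - \<theta> * (norm h1)\<^sup>2)"
    using c d_nonneg by (intro mult_left_mono) auto
  have de: "d * (- x\<^sup>2 * (2 / (1 - x * \<mu>) * n * \<rho>n + d * \<rho>n\<^sup>2)) \<le> d * (\<phi> \<bullet> Dp \<phi> - \<theta> * (\<psi> \<bullet> D \<psi>))"
    using delta_part d_nonneg by (intro mult_left_mono) auto
  have "0 \<le> \<theta> * (d * (\<psi> \<bullet> D \<psi>) - (norm (D \<psi>))\<^sup>2 + d * c * (norm h1)\<^sup>2)"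
    using hyp theta by (simp add: h1_def)
  moreover have "0 \<le> x\<^sup>2 * (2 / x * (1 - x * \<mu>) * \<kappa>\<^sup>2 - 2 * L * d * \<kappa> * (\<rho>n + chn) - l * (1 + x * d)\<^sup>2 * \<kappa>\<^sup>2
      - (chn / (1 - x * \<mu>))\<^sup>2 - d * (2 / (1 - x * \<mu>) * n * \<rho>n + d * \<rho>n\<^sup>2) + 2 * d * c * ?H)"
    using tot unfolding excess_def by simp
  ultimately have "0 \<le> d * (\<phi> \<bullet> Dp \<phi>) - (norm (Dp \<phi>))\<^sup>2 + d * c * (norm hp)\<^sup>2"
    using h de eta_part by (simp add: algebra_simps)
  then show ?thesis by (simp add: hp_def)
qed

end

end

section \<open>Numerical verification under the time step restriction\<close>

context test_vector
begin

lemma total_nonneg: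
  fixes N :: real
  assumes uhs_gam: "\<And>v. norm (uhs v) \<le> b * gam v"
    and D_lower: "\<And>\<xi>. - (7/200) * (\<xi> \<bullet> \<xi>) \<le> \<xi> \<bullet> D \<xi>"
    and N: "2 \<le> N" and xN: "x * (2 * sqrt N * (b\<^sup>2 + 19/20 * (N - 1)) * l\<^sup>2 + l) \<le> 1"
    and bl: "l + 1/20 \<le> b\<^sup>2" and xh: "2 * x \<le> 1"
    and c_def: "c = 2 / (5 * sqrt N)"
  shows "0 \<le> excess x \<mu> l d c L n \<beta> \<gamma> \<kappa> \<rho>n chn R0 e1"
proof -
  define r where "r = l / b\<^sup>2"
  \<comment> \<open>The factor is 1 / (1 - 7/200), from \<open>kappa_lower\<close>.\<close>
  define \<nu> where "\<nu> = 200/193 * (b * \<kappa>)"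
  have B0: "0 < b\<^sup>2" using bl l_ge by linarith
  have rB: "r * b\<^sup>2 = l" using B0 by (simp add: r_def)
  have r0: "0 \<le> r" using l_ge by (simp add: r_def)
  have r1: "r \<le> 1" using bl B0 by (simp add: r_def)
  have sN: "707/500 \<le> sqrt N" by (rule real_le_rsqrt) (use N in \<open>simp add: power2_eq_square\<close>)
  have k0: "0 \<le> \<kappa>" by (rule kappa_nonneg[OF xh])
  have c0: "0 \<le> c" using N by (simp add: c_def)
  have c57: "2 * c \<le> 57/100" 
  proof -
    have "2 * c = 4/5 / sqrt N" by (simp add: c_def)
    also have "\<dots> \<le> 57/100" using sN by (subst pos_divide_le_eq) linarith+
    finally show ?thesis .
  qed
  have l1: "1 + d = l" by (simp add: d_def)
  have "193/200 * n \<le> b * \<kappa>" using kappa_lower[OF xh, of "7/200"] uhs_gam D_lower by simp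
  then have n\<nu>: "n \<le> \<nu>" by (simp add: \<nu>_def)
  have bk\<nu>: "b * \<kappa> \<le> \<nu>" using k0 b_nonneg by (simp add: \<nu>_def)
  have nneg: "0 \<le> \<rho>n" "0 \<le> R0" "0 \<le> e1" "0 \<le> chn" by (simp_all add: \<rho>n_def R0_def e1_def chn_def)
  note rn = nneg(1) and R0n = nneg(2) and e1n = nneg(3) and chn0 = nneg(4)
  have xB: "x * (2 * sqrt N * ((b\<^sup>2 + 19/20) * l\<^sup>2) + l) \<le> 1"
  proof -
    have "2 * sqrt N * ((b\<^sup>2 + 19/20) * l\<^sup>2) \<le> 2 * sqrt N * ((b\<^sup>2 + 19/20 * (N - 1)) * l\<^sup>2)"
      using N by (intro mult_left_mono mult_right_mono) auto
    then have "x * (2 * sqrt N * ((b\<^sup>2 + 19/20) * l\<^sup>2) + l) \<le> x * (2 * sqrt N * ((b\<^sup>2 + 19/20 * (N - 1)) * l\<^sup>2) + l)"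
      using x_pos by (intro mult_left_mono) auto
    then show ?thesis using xN by (simp add: mult.assoc)
  qed
  have xl0: "0 < x * l" using x_pos l_ge by simp
  have xs: "x * (2 * sqrt N * ((b\<^sup>2 + 19/20) * l\<^sup>2)) \<le> 1"
    using xB xl0 unfolding distrib_left[of x] by linarith
  have xB': "x * (707/250 * ((b\<^sup>2 + 19/20) * l\<^sup>2) + l) \<le> 1"
  proof -
    have "707/250 * ((b\<^sup>2 + 19/20) * l\<^sup>2) \<le> 2 * sqrt N * ((b\<^sup>2 + 19/20) * l\<^sup>2)"
      using sN B0 by (intro mult_right_mono) auto
    then have "x * (707/250 * ((b\<^sup>2 + 19/20) * l\<^sup>2) + l) \<le> x * (2 * sqrt N * ((b\<^sup>2 + 19/20) * l\<^sup>2) + l)"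
      using x_pos by (intro mult_left_mono) auto
    then show ?thesis using xB by linarith
  qed
  have xs': "x * (707/250 * ((b\<^sup>2 + 19/20) * l\<^sup>2)) \<le> 1"
    using xB' xl0 unfolding distrib_left[of x] by linarith
  \<comment> \<open>Reads off a numerical bound for x l^2: \<iota> is 1 / \<pi>, and 13433/5000 is
    707/250 times 19/20, with 707/250 slightly below 2 sqrt 2.\<close>
  have x_small: "x * l\<^sup>2 \<le> \<pi>"
    if h: "\<iota> * l \<le> 707/250 * (b\<^sup>2 * l) + 13433/5000 * l + 1" and \<pi>: "0 < \<pi>" "\<iota> * \<pi> = 1" for \<pi> \<iota> :: real
  proof -
    have "\<iota> * l * l \<le> (707/250 * (b\<^sup>2 * l) + 13433/5000 * l + 1) * l"
      using l_ge by (intro mult_right_mono[OF h]) auto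
    also have "\<dots> = 707/250 * ((b\<^sup>2 + 19/20) * l\<^sup>2) + l" by algebra
    finally have "x * (\<iota> * l * l) \<le> x * (707/250 * ((b\<^sup>2 + 19/20) * l\<^sup>2) + l)"
      using x_pos by (intro mult_left_mono) auto
    then have "x * (\<iota> * l * l) * \<pi> \<le> 1 * \<pi>" using xB' \<pi> by (intro mult_right_mono) auto
    moreover have "x * (\<iota> * l * l) * \<pi> = (\<iota> * \<pi>) * (x * l\<^sup>2)" by (simp add: power2_eq_square)
    ultimately show ?thesis using \<pi> by simp
  qed
  have Lb: "L \<le> s * b" if s: "0 \<le> s" "r \<le> s\<^sup>2" for s
  proof (rule power2_le_imp_le)
    have "L\<^sup>2 = r * b\<^sup>2" using L_sq rB by (simp add: power2_eq_square)
    also have "\<dots> \<le> s\<^sup>2 * b\<^sup>2" using s by (intro mult_right_mono) auto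
    finally show "L\<^sup>2 \<le> (s * b)\<^sup>2" by (simp add: power_mult_distrib)
  qed (use s b_nonneg in simp)
  have Lgs: "L * \<gamma> \<le> s * \<beta>" if s: "0 \<le> s" "r \<le> s\<^sup>2" for s
    using mult_right_mono[OF Lb[OF s] gamma_nonneg] by (simp add: \<beta>_def \<gamma>_def mult.assoc)
  have Lks: "L * \<kappa> \<le> s * \<nu>" if s: "0 \<le> s" "r \<le> s\<^sup>2" for s
    using mult_right_mono[OF Lb[OF s] k0] mult_left_mono[OF bk\<nu> s(1)] by (simp add: mult.assoc)
  have lkr: "l * \<kappa>\<^sup>2 \<le> r * \<nu>\<^sup>2"
  proof -
    have "l * \<kappa>\<^sup>2 = r * (b * \<kappa>)\<^sup>2" by (simp add: rB[symmetric] power_mult_distrib)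
    also have "\<dots> \<le> r * \<nu>\<^sup>2" using bk\<nu> r0 k0 b_nonneg by (intro mult_left_mono power_mono) auto
    finally show ?thesis .
  qed
  have lB: "(l\<^sup>2 + 19/20 * r * l) * b\<^sup>2 = (b\<^sup>2 + 19/20) * l\<^sup>2"
    using arg_cong[OF rB, of "\<lambda>t. t * l"] by (simp add: power2_eq_square algebra_simps)
  \<comment> \<open>The factor 105000/37249 is 21/8 times (200/193)^2 and lies just below 707/250;
    this fixes the number 21/8. Since r b^2 = l, multiplying by b^2 turns the bracket into (b^2 +
    19/20) l^2, which the time step controls.\<close>
  have gk: "21/8 * (l\<^sup>2 + 19/20 * r * l) * \<nu>\<^sup>2 \<le> \<kappa>\<^sup>2 / x"
  proof -
    have "21/8 * (l\<^sup>2 + 19/20 * r * l) * \<nu>\<^sup>2 = 105000/37249 * (((l\<^sup>2 + 19/20 * r * l) * b\<^sup>2) * \<kappa>\<^sup>2)"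
      by (simp add: \<nu>_def power_mult_distrib power2_eq_square)
    also have "\<dots> \<le> 707/250 * (((l\<^sup>2 + 19/20 * r * l) * b\<^sup>2) * \<kappa>\<^sup>2)"
      using r0 l_ge by (intro mult_right_mono mult_nonneg_nonneg add_nonneg_nonneg) auto
    also have "\<dots> = (707/250 * ((b\<^sup>2 + 19/20) * l\<^sup>2)) * \<kappa>\<^sup>2" unfolding lB by simp
    also have "\<dots> \<le> (1 / x) * \<kappa>\<^sup>2"
    proof (rule mult_right_mono)
      show "707/250 * ((b\<^sup>2 + 19/20) * l\<^sup>2) \<le> 1 / x" using xs' x_pos by (simp add: pos_le_divide_eq mult.commute)
    qed simp
    finally show ?thesis by simp
  qed
  have gg: "4/5 * (l\<^sup>2 + 19/20 * r * l) * \<beta>\<^sup>2 \<le> c * \<gamma>\<^sup>2 / x"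
  proof -
    have sN0: "0 < sqrt N" using N by simp
    have cN: "2 * sqrt N * c = 4/5" using sN0 by (simp add: c_def)
    have "(2 * sqrt N) * (4/5 * ((b\<^sup>2 + 19/20) * l\<^sup>2) * x) = 4/5 * (x * (2 * sqrt N * ((b\<^sup>2 + 19/20) * l\<^sup>2)))" by simp
    also have "\<dots> \<le> 2 * sqrt N * c" unfolding cN using xs by linarith
    finally have "4/5 * ((b\<^sup>2 + 19/20) * l\<^sup>2) * x \<le> c" by (rule mult_left_le_imp_le) (use sN0 in simp)
    then have h: "4/5 * ((b\<^sup>2 + 19/20) * l\<^sup>2) \<le> c / x" using x_pos by (simp add: pos_le_divide_eq)
    have "4/5 * (l\<^sup>2 + 19/20 * r * l) * \<beta>\<^sup>2 = 4/5 * ((l\<^sup>2 + 19/20 * r * l) * b\<^sup>2) * \<gamma>\<^sup>2"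
      by (simp add: \<beta>_def \<gamma>_def power_mult_distrib)
    also have "\<dots> \<le> (c / x) * \<gamma>\<^sup>2" unfolding lB using h by (intro mult_right_mono) auto
    finally show ?thesis by simp
  qed
  have case1: ?thesis if r: "0 \<le> r" "r \<le> 1/2"
  proof -
    \<comment> \<open>A line p r + q dominates sqrt r as soon as 4 p q \<ge> 1; here and in the
      other two ranges this product is just above 1.\<close>
    define s where "s = 63/50 * r + 21/100"
    have sr: "r \<le> s\<^sup>2"
    proof -
      have "0 \<le> (63/50 * r - 1177/6300)\<^sup>2" by simp
      then show ?thesis by (simp add: s_def power2_eq_square field_simps)
    qed
    have s0: "0 \<le> s" using r0 by (simp add: s_def)
    \<comment> \<open>A smaller \<open>r\<close> means a larger b^2 relative to l and hence a
      smaller x l^2; this is why the constant increases from range to range.\<close>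
    have xl: "x * l\<^sup>2 \<le> 11/100"
    proof (rule x_small)
      have "l \<le> 1/2 * b\<^sup>2" using mult_right_mono[OF r(2), of "b\<^sup>2"] rB by simp
      then have "2 * (l * l) \<le> b\<^sup>2 * l" using mult_right_mono[of "2 * l" "b\<^sup>2" l] l_ge by simp
      moreover have "2 * l - 1 \<le> l * l" using zero_le_power2[of "l - 1"] by (simp add: power2_eq_square algebra_simps)
      ultimately have "4 * l - 2 \<le> b\<^sup>2 * l" by linarith
      then show "100/11 * l \<le> 707/250 * (b\<^sup>2 * l) + 13433/5000 * l + 1" using l_ge by linarith
    qed simp_all
    note k = coeff_case1[OF d_nonneg r, folded s_def, unfolded l1]
    show ?thesis
      by (rule total_nonneg_aux[OF l_ge d_def x_pos xl mu beta_nonneg n_nonneg n\<nu> rn R0n e1n chn0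
        kappa_nonneg[OF xh] gamma_nonneg L_nonneg r0 s0 c0 ww_nonneg ww'_nonneg ww_le ww'_le rho_le[folded \<rho>n_def]
        us_r0[folded R0_def] E1_le[folded e1_def] chin_le[OF xh] Lgs[OF s0 sr] Lks[OF s0 sr] lkr gk gg
        _ _ _ _ _ _ _ _ _ c57 _ _ _ _ _ _ _ _ _ _ _ _ k,
        where q = "3/25" and vb = "87/500" and vn = "119/1000"]) simp_all
  qed
  have case2: ?thesis if r: "1/2 \<le> r" "r \<le> 7/10"
  proof -
    define s where "s = 18/25 * r + 7/20"
    have sr: "r \<le> s\<^sup>2"
    proof -
      have "0 \<le> (18/25 * r - 31/90)\<^sup>2" by simp
      then show ?thesis by (simp add: s_def power2_eq_square field_simps)
    qed
    have s0: "0 \<le> s" using r0 by (simp add: s_def)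
    have xl: "x * l\<^sup>2 \<le> 13/100"
    proof (rule x_small)
      have "l \<le> 7/10 * b\<^sup>2" using mult_right_mono[OF r(2), of "b\<^sup>2"] rB by simp
      then have "10/7 * (l * l) \<le> b\<^sup>2 * l" using mult_right_mono[of "10/7 * l" "b\<^sup>2" l] l_ge by simp
      moreover have "2 * l - 1 \<le> l * l" using zero_le_power2[of "l - 1"] by (simp add: power2_eq_square algebra_simps)
      ultimately have "20/7 * l - 10/7 \<le> b\<^sup>2 * l" by linarith
      then show "100/13 * l \<le> 707/250 * (b\<^sup>2 * l) + 13433/5000 * l + 1" using l_ge by linarith
    qed simp_all
    note k = coeff_case2[OF d_nonneg r, folded s_def, unfolded l1]
    show ?thesis
      by (rule total_nonneg_aux[OF l_ge d_def x_pos xl mu beta_nonneg n_nonneg n\<nu> rn R0n e1n chn0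
        kappa_nonneg[OF xh] gamma_nonneg L_nonneg r0 s0 c0 ww_nonneg ww'_nonneg ww_le ww'_le rho_le[folded \<rho>n_def]
        us_r0[folded R0_def] E1_le[folded e1_def] chin_le[OF xh] Lgs[OF s0 sr] Lks[OF s0 sr] lkr gk gg
        _ _ _ _ _ _ _ _ _ c57 _ _ _ _ _ _ _ _ _ _ _ _ k,
        where q = "7/50" and vb = "41/200" and vn = "7/50"]) simp_all
  qed
  have case3: ?thesis if r: "7/10 \<le> r" "r \<le> 1"
  proof -
    define s where "s = 63/100 * r + 2/5"
    have sr: "r \<le> s\<^sup>2"
    proof -
      have "0 \<le> (63/100 * r - 124/315)\<^sup>2" by simp
      then show ?thesis by (simp add: s_def power2_eq_square field_simps)
    qed
    have s0: "0 \<le> s" using r0 by (simp add: s_def)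
    have xl: "x * l\<^sup>2 \<le> 151/1000"
    proof (rule x_small)
      have "(l + 1/20) * l \<le> b\<^sup>2 * l" using bl l_ge by (intro mult_right_mono) auto
      then have "21/20 * l + (l - 1) \<le> b\<^sup>2 * l" using zero_le_power2[of "l - 1"] by (simp add: power2_eq_square algebra_simps)
      then show "1000/151 * l \<le> 707/250 * (b\<^sup>2 * l) + 13433/5000 * l + 1" using l_ge by linarith
    qed simp_all
    note k = coeff_case3[OF d_nonneg r, folded s_def, unfolded l1]
    show ?thesis
      by (rule total_nonneg_aux[OF l_ge d_def x_pos xl mu beta_nonneg n_nonneg n\<nu> rn R0n e1n chn0
        kappa_nonneg[OF xh] gamma_nonneg L_nonneg r0 s0 c0 ww_nonneg ww'_nonneg ww_le ww'_le rho_le[folded \<rho>n_def]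
        us_r0[folded R0_def] E1_le[folded e1_def] chin_le[OF xh] Lgs[OF s0 sr] Lks[OF s0 sr] lkr gk gg
        _ _ _ _ _ _ _ _ _ c57 _ _ _ _ _ _ _ _ _ _ _ _ k,
        where q = "41/250" and vb = "479/2000" and vn = "41/250"]) simp_all
  qed
  show ?thesis
  proof (cases "r \<le> 1/2")
    case True then show ?thesis using case1 r0 by simp
  next
    case False then show ?thesis using case2 case3 r1 by (cases "r \<le> 7/10") auto
  qed
qed

theorem invariant_step:
  fixes N :: real
  assumes "\<And>v. norm (uhs v) \<le> b * gam v" "\<And>\<xi>. - (7/200) * (\<xi> \<bullet> \<xi>) \<le> \<xi> \<bullet> D \<xi>"
    and "2 \<le> N" "x * (2 * sqrt N * (b\<^sup>2 + 19/20 * (N - 1)) * l\<^sup>2 + l) \<le> 1"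
    and "l + 1/20 \<le> b\<^sup>2" "2 * x \<le> 1" "c = 2 / (5 * sqrt N)"
    and "0 \<le> d * (\<psi> \<bullet> D \<psi>) - (norm (D \<psi>))\<^sup>2 + d * c * (norm (sh \<mu> (u \<psi>)))\<^sup>2"
  shows "0 \<le> d * (\<phi> \<bullet> Dp \<phi>) - (norm (Dp \<phi>))\<^sup>2 + d * c * (norm (sh \<mu> (up \<phi>)))\<^sup>2"
proof (rule step_total)
  show "0 \<le> c" using assms(3,7) by simp
qed (use assms total_nonneg[OF assms(1-7)] in simp_all)

end

section \<open>Energy spaces\<close>

text \<open>Cauchy-Schwarz in a form that suits semidefinite forms on a subset: only a nonnegative
  quadratic polynomial is needed, and the leading coefficient may vanish.\<close>

lemma discriminant_le:
  fixes \<alpha> \<beta> \<gamma> :: real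
  assumes "\<And>t. 0 \<le> \<alpha> + 2 * t * \<beta> + t\<^sup>2 * \<gamma>" "0 \<le> \<gamma>"
  shows "\<beta>\<^sup>2 \<le> \<alpha> * \<gamma>"
proof (cases "\<gamma> = 0")
  case True
  have "\<beta> = 0"
  proof (rule ccontr)
    assume "\<beta> \<noteq> 0"
    then have "2 * (- (\<alpha> + 1) / (2 * \<beta>)) * \<beta> = - (\<alpha> + 1)" by simp
    then show False using assms(1)[of "- (\<alpha> + 1) / (2 * \<beta>)"] True by simp
  qed
  then show ?thesis using True by simp
next
  case False
  have "0 \<le> \<alpha> + 2 * (- \<beta> / \<gamma>) * \<beta> + (- \<beta> / \<gamma>)\<^sup>2 * \<gamma>" by (rule assms(1))
  also have "\<dots> = \<alpha> - \<beta>\<^sup>2 / \<gamma>" using False by (simp add: power2_eq_square)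
  finally show ?thesis using False assms(2) by (simp add: pos_divide_le_eq)
qed

lemma mult_self_le_cancel:
  fixes m n :: real
  assumes "n * n \<le> n * m" "0 \<le> n" "0 \<le> m"
  shows "n \<le> m"
proof (cases "n = 0")
  case False
  with assms show ?thesis by (intro mult_left_le_imp_le[of n n m]) auto
qed (use assms in simp)

text \<open>The operator inequality f^2 \<le> m f for 0 \<le> f \<le> m, obtained from
  Cauchy-Schwarz for the semi-inner product (v, f w) applied to v and f v, hence without a spectral
  theorem.\<close>

lemma psd_square_le:
  fixes f :: "'a::real_inner \<Rightarrow> 'a"
  assumes lin: "linear f" and sym: "\<And>v w. f v \<bullet> w = v \<bullet> f w"
    and pos: "\<And>v. 0 \<le> v \<bullet> f v" and le: "\<And>v. v \<bullet> f v \<le> m * (v \<bullet> v)" and m: "0 \<le> m"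
  shows "f v \<bullet> f v \<le> m * (v \<bullet> f v)"
proof -
  let ?c = "v \<bullet> f v"
  have "(f v \<bullet> f v)\<^sup>2 \<le> ?c * (f v \<bullet> f (f v))"
  proof (rule discriminant_le)
    fix t
    have "0 \<le> (v + t *\<^sub>R f v) \<bullet> f (v + t *\<^sub>R f v)" by (rule pos)
    also have "\<dots> = ?c + 2 * t * (f v \<bullet> f v) + t\<^sup>2 * (f v \<bullet> f (f v))"
      by (simp add: linear_add[OF lin] linear_scale[OF lin] inner_add_left inner_add_right sym[of v "f v", symmetric]
          power2_eq_square algebra_simps)
    finally show "0 \<le> ?c + 2 * t * (f v \<bullet> f v) + t\<^sup>2 * (f v \<bullet> f (f v))" .
  qed (rule pos)
  also have "\<dots> \<le> ?c * (m * (f v \<bullet> f v))" by (intro mult_left_mono le pos)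
  finally have 1: "(f v \<bullet> f v) * (f v \<bullet> f v) \<le> (f v \<bullet> f v) * (m * ?c)" by (simp add: power2_eq_square mult_ac)
  show ?thesis by (rule mult_self_le_cancel[OF 1]) (use m pos in simp_all)
qed

lemma sqrt_cauchy:
  fixes \<alpha> \<beta> \<gamma> :: real
  assumes "\<And>t. 0 \<le> \<alpha> + 2 * t * \<beta> + t\<^sup>2 * \<gamma>" "0 \<le> \<gamma>"
  shows "\<beta> \<le> sqrt \<alpha> * sqrt \<gamma>"
proof -
  have "\<bar>\<beta>\<bar> \<le> sqrt (\<alpha> * \<gamma>)" using real_sqrt_le_mono[OF discriminant_le[OF assms]] by simp
  then show ?thesis by (simp add: real_sqrt_mult)
qed

text \<open>The setting after rescaling: \<open>a_ge\<close> is the Rayleigh bound with lambda1 = 1.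
  The axioms are guarded by membership because \<open>a\<close> is meaningful only on
  \<open>H\<close>.\<close>

locale energy_space = contraction_op G
  for G :: "'v::real_inner \<Rightarrow> 'v" +
  fixes H :: "'v set" and a :: "'v \<Rightarrow> 'v \<Rightarrow> real"
  assumes H_sub: "subspace H"
    and a_sym: "v \<in> H \<Longrightarrow> w \<in> H \<Longrightarrow> a v w = a w v"
    and a_add: "v \<in> H \<Longrightarrow> w \<in> H \<Longrightarrow> z \<in> H \<Longrightarrow> a (v + w) z = a v z + a w z"
    and a_scale: "v \<in> H \<Longrightarrow> z \<in> H \<Longrightarrow> a (c *\<^sub>R v) z = c * a v z"
    and a_ge: "v \<in> H \<Longrightarrow> v \<bullet> v \<le> a v v"
    and G_in: "G v \<in> H"
    and a_G: "w \<in> H \<Longrightarrow> a (G v) w = v \<bullet> w"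
begin

lemma H_closed: "v \<in> H \<Longrightarrow> w \<in> H \<Longrightarrow> v + w \<in> H" "v \<in> H \<Longrightarrow> w \<in> H \<Longrightarrow> v - w \<in> H"
  "v \<in> H \<Longrightarrow> c *\<^sub>R v \<in> H" "0 \<in> H"
  using H_sub by (auto simp: subspace_add subspace_diff subspace_scale subspace_0)

lemma H_sum: "(\<And>i. i \<in> I \<Longrightarrow> f i \<in> H) \<Longrightarrow> sum f I \<in> H"
  using H_sub by (simp add: subspace_sum)

lemma a_add2: "v \<in> H \<Longrightarrow> w \<in> H \<Longrightarrow> z \<in> H \<Longrightarrow> a z (v + w) = a z v + a z w"
  by (metis H_closed(1) a_add a_sym)

lemma a_scale2: "v \<in> H \<Longrightarrow> z \<in> H \<Longrightarrow> a z (c *\<^sub>R v) = c * a z v"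
  by (metis H_closed(3) a_scale a_sym)

lemma a_diff: "v \<in> H \<Longrightarrow> w \<in> H \<Longrightarrow> z \<in> H \<Longrightarrow> a (v - w) z = a v z - a w z"
  using a_add[of v "(-1) *\<^sub>R w" z] a_scale[of w z "-1"] H_closed(3)[of w "-1"] by simp

lemma a_diff2: "v \<in> H \<Longrightarrow> w \<in> H \<Longrightarrow> z \<in> H \<Longrightarrow> a z (v - w) = a z v - a z w"
  by (metis H_closed(2) a_diff a_sym)

lemmas a_lin = a_add a_add2 a_diff a_diff2 a_scale a_scale2

lemma a_0: "v \<in> H \<Longrightarrow> a 0 v = 0" "v \<in> H \<Longrightarrow> a v 0 = 0"
  using a_scale[of v v 0] a_scale2[of v v 0] by auto

lemma a_sum: "(\<And>i. i \<in> I \<Longrightarrow> f i \<in> H) \<Longrightarrow> v \<in> H \<Longrightarrow> a (sum f I) v = (\<Sum>i\<in>I. a (f i) v)"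
  by (induction I rule: infinite_finite_induct) (auto simp: a_0 a_add H_sum)

lemma a_sum2: "(\<And>i. i \<in> I \<Longrightarrow> f i \<in> H) \<Longrightarrow> v \<in> H \<Longrightarrow> a v (sum f I) = (\<Sum>i\<in>I. a v (f i))"
  by (induction I rule: infinite_finite_induct) (auto simp: a_0 a_add2 H_sum)

lemma a_G2: "w \<in> H \<Longrightarrow> a w (G v) = v \<bullet> w"
  by (simp add: a_sym[of w] G_in a_G)

lemma a_pos: "v \<in> H \<Longrightarrow> 0 \<le> a v v"
  using a_ge[of v] inner_ge_zero[of v] by linarith

definition na :: "'v \<Rightarrow> real" where "na v = sqrt (a v v)"

lemma na_nonneg: "v \<in> H \<Longrightarrow> 0 \<le> na v" by (simp add: na_def a_pos)
lemma na_sq: "v \<in> H \<Longrightarrow> (na v)\<^sup>2 = a v v" "v \<in> H \<Longrightarrow> na v * na v = a v v" by (simp_all add: na_def a_pos)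
lemma norm_le_na: "v \<in> H \<Longrightarrow> norm v \<le> na v"
  unfolding na_def norm_eq_sqrt_inner by (intro real_sqrt_le_mono a_ge)

lemma a_cauchy: assumes "v \<in> H" "w \<in> H" shows "a v w \<le> na v * na w"
  unfolding na_def
proof (rule sqrt_cauchy)
  fix t
  have "0 \<le> a (v + t *\<^sub>R w) (v + t *\<^sub>R w)" using assms by (intro a_pos) (simp add: H_closed)
  also have "\<dots> = a v v + 2 * t * a v w + t\<^sup>2 * a w w"
    using assms by (simp add: a_lin H_closed a_sym[of w v] power2_eq_square algebra_simps)
  finally show "0 \<le> a v v + 2 * t * a v w + t\<^sup>2 * a w w" .
qed (use assms a_pos in simp)

lemma na_triangle: assumes "v \<in> H" "w \<in> H" shows "na (v + w) \<le> na v + na w"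
proof (rule power2_le_imp_le)
  have "(na (v + w))\<^sup>2 = a v v + 2 * a v w + a w w"
    using assms by (simp add: na_sq a_lin H_closed a_sym[of w v])
  also have "\<dots> \<le> a v v + 2 * (na v * na w) + a w w" using a_cauchy[OF assms] by simp
  also have "\<dots> = (na v + na w)\<^sup>2" using assms by (simp add: na_sq[symmetric] power2_eq_square algebra_simps)
  finally show "(na (v + w))\<^sup>2 \<le> (na v + na w)\<^sup>2" .
qed (use assms na_nonneg in simp)

lemma na_scale: "v \<in> H \<Longrightarrow> na (c *\<^sub>R v) = \<bar>c\<bar> * na v"
  by (simp add: na_def a_lin H_closed real_sqrt_mult flip: power2_eq_square)
     (simp add: real_sqrt_mult power2_eq_square flip: mult.assoc)

lemma na_diff: assumes "v \<in> H" "w \<in> H" shows "na (v - w) \<le> na v + na w"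
  using na_triangle[of v "(-1) *\<^sub>R w"] na_scale[of w "-1"] H_closed(3)[of w "-1"] assms by simp

lemma a_cauchy_neg: assumes "v \<in> H" "w \<in> H" shows "- a v w \<le> na v * na w"
  using a_cauchy[of "(-1) *\<^sub>R v" w] a_scale[of v w "-1"] na_scale[of v "-1"] H_closed(3)[of v "-1"] assms by simp

lemma na_G: "na (G v) = gam v"
  by (simp add: na_def gam_def a_G G_in)

end

text \<open>Contribution of a pair of eigenvalues to the skew estimate. Neither bracket has a sign
  of its own; the symmetrised sum is 2 (m - k)^2 (s - k)(s - m) / (k m s).\<close>

lemma pair_bound:
  fixes k m s \<sigma> :: real
  assumes "0 < k" "0 < m" "k \<le> s" "m \<le> s"
  shows "0 \<le> (2 * s * (m / k - 1) - 2 * (k - 2 * m + m\<^sup>2 / k) + (m - k)\<^sup>2 / s)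
    + (2 * s * (k / m - 1) - 2 * (m - 2 * k + k\<^sup>2 / m) + (k - m)\<^sup>2 / s)" (is "0 \<le> ?L")
proof -
  have s: "0 < s" using assms by linarith
  have "?L * (k * m * s) = 2 * (m - k)\<^sup>2 * ((s - k) * (s - m))"
    using assms s by (simp add: field_simps power2_eq_square)
  also have "0 \<le> \<dots>" using assms by simp
  finally have "0 \<le> ?L * (k * m * s)" .
  moreover have "0 < k * m * s" using assms s by simp
  ultimately show ?thesis by (metis zero_le_mult_iff linorder_not_less)
qed

context energy_space
begin

text \<open>The vectors \<open>p (S b) - q (P b)\<close> are the images of \<open>p b\<close> under the \<open>a\<close>-skew operator B = p q* - q p*, whose squared
  Hilbert-Schmidt norm is twice the first sum on the right. In an eigenbasis of \<open>P\<close> the difference of the two sides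
  becomes a sum of nonnegative terms.\<close>

lemma skew_bound:
  fixes p q :: "'e::euclidean_space \<Rightarrow> 'v" and P Q S :: "'e \<Rightarrow> 'e"
  assumes lin: "linear p" "linear q" "linear P" "linear Q" "linear S"
    and inH: "\<And>\<xi>. p \<xi> \<in> H" "\<And>\<xi>. q \<xi> \<in> H"
    and P: "\<And>\<xi> \<zeta>. a (p \<xi>) (p \<zeta>) = \<xi> \<bullet> P \<zeta>" and Q: "\<And>\<xi> \<zeta>. a (q \<xi>) (q \<zeta>) = \<xi> \<bullet> Q \<zeta>"
    and S: "\<And>\<xi> \<zeta>. a (p \<xi>) (q \<zeta>) = \<xi> \<bullet> S \<zeta>" and S_sym: "\<And>\<xi> \<zeta>. S \<xi> \<bullet> \<zeta> = \<xi> \<bullet> S \<zeta>"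
    and Ps: "\<And>\<xi>. \<xi> \<bullet> P \<xi> \<le> s * (\<xi> \<bullet> \<xi>)"
  shows "2 * (\<Sum>b\<in>Basis. a (p (S b) - q (P b)) (p (S b) - q (P b)))
      \<le> 2 * s * (\<Sum>b\<in>Basis. P b \<bullet> Q b - S b \<bullet> S b)
        + (\<Sum>b\<in>Basis. (norm (P (S b) - S (P b)))\<^sup>2) / s"
proof -
  have P_sym: "P \<xi> \<bullet> \<zeta> = \<xi> \<bullet> P \<zeta>" for \<xi> \<zeta>
    by (metis P a_sym inH(1) inner_commute)
  obtain B k where B: "orthonormal B" "span B = UNIV" "\<And>b. b \<in> B \<Longrightarrow> P b = k b *\<^sub>R b"
    using spectral_theorem[OF lin(3) P_sym] by metis
  have fin: "finite B" using B(1) by (simp add: orthonormal_def)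
  have bb: "b \<bullet> b = 1" if "b \<in> B" for b using that B(1) by (simp add: orthonormal_def norm_eq_1)
  have bo: "b \<bullet> c = 0" if "b \<in> B" "c \<in> B" "b \<noteq> c" for b c
    using that B(1) by (auto simp: orthonormal_def pairwise_def orthogonal_def)
  have k0: "0 \<le> k b" if "b \<in> B" for b
    using a_pos[OF inH(1), of b] P[of b b] B(3)[OF that] bb[OF that] by simp
  have ks: "k b \<le> s" if "b \<in> B" for b using Ps[of b] B(3)[OF that] bb[OF that] by simp
  define \<sigma> where "\<sigma> b c = b \<bullet> S c" for b c
  define t where "t c = c \<bullet> Q c" for c
  \<comment> \<open>Squared energy distance of \<open>q c\<close> from the range of
    \<open>p\<close>. For \<open>k b = 0\<close> the quotient is 0 by convention, which is correct
    since \<open>\<sigma> b c\<close> vanishes there.\<close>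
  define R where "R c = t c - (\<Sum>b\<in>B. (\<sigma> b c)\<^sup>2 / k b)" for c
  have sig_sym: "\<sigma> b c = \<sigma> c b" for b c by (metis \<sigma>_def S_sym inner_commute)
  have sig0: "\<sigma> b c = 0" if "b \<in> B" "k b = 0" for b c
  proof -
    have "a (p b) (p b) = 0" using P[of b b] B(3)[OF that(1)] that(2) by simp
    then have "p b \<bullet> p b \<le> 0" using a_ge[OF inH(1), of b] by simp
    then have "p b = 0" by (metis antisym inner_eq_zero_iff inner_ge_zero)
    then show ?thesis using S[of b c] a_0(1)[OF inH(2)] by (simp add: \<sigma>_def)
  qed
  have R0: "0 \<le> R c" for c
  proof -
    let ?z = "\<Sum>b\<in>B. (\<sigma> b c / k b) *\<^sub>R p b"
    have zH: "?z \<in> H" by (intro H_sum H_closed inH)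
    have zq: "a ?z (q c) = (\<Sum>b\<in>B. (\<sigma> b c)\<^sup>2 / k b)"
      by (simp add: a_sum a_lin H_closed inH S \<sigma>_def power2_eq_square)
    have zp: "a ?z (p b) = \<sigma> b c" if b: "b \<in> B" for b
    proof -
      have "a ?z (p b) = (\<Sum>b'\<in>B. (\<sigma> b' c / k b') * (k b * (b' \<bullet> b)))"
        using B(3)[OF b] by (simp add: a_sum a_lin H_closed inH P)
      also have "\<dots> = (\<Sum>b'\<in>B. if b' = b then \<sigma> b c / k b * k b else 0)"
        using bb[OF b] bo[OF _ b] by (intro sum.cong) auto
      also have "\<dots> = \<sigma> b c / k b * k b" using fin b by simp
      also have "\<dots> = \<sigma> b c" using sig0[OF b] by (cases "k b = 0") auto
      finally show ?thesis .
    qed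
    have zz: "a ?z ?z = (\<Sum>b\<in>B. (\<sigma> b c)\<^sup>2 / k b)"
    proof -
      have "a ?z ?z = (\<Sum>b\<in>B. (\<sigma> b c / k b) * a ?z (p b))"
        using zH by (subst a_sum2) (simp_all add: a_lin H_closed inH)
      also have "\<dots> = (\<Sum>b\<in>B. (\<sigma> b c)\<^sup>2 / k b)" using zp by (intro sum.cong) (auto simp: power2_eq_square)
      finally show ?thesis .
    qed
    have "0 \<le> a (q c - ?z) (q c - ?z)" by (intro a_pos H_closed inH zH)
    also have "\<dots> = a (q c) (q c) - a (q c) ?z - (a ?z (q c) - a ?z ?z)"
      using zH inH by (simp add: a_diff a_diff2 H_closed(2))
    also have "\<dots> = R c" using a_sym[OF inH(2) zH, of c] by (simp add: zq zz R_def t_def Q)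
    finally show ?thesis .
  qed
  have Sn: "v \<bullet> v = (\<Sum>b\<in>B. (b \<bullet> v)\<^sup>2)" for v :: 'e
    using orthonormal_parseval[OF B(1,2), of v v] by (simp add: power2_eq_square inner_commute)
  let ?h = "\<lambda>b c. 2 * s * (k c / k b - 1) - 2 * (k b - 2 * k c + (k c)\<^sup>2 / k b) + (k c - k b)\<^sup>2 / s"
  have main: "0 \<le> (\<Sum>c\<in>B. \<Sum>b\<in>B. ?h b c * (\<sigma> b c)\<^sup>2)"
  proof -
    have sw: "(\<Sum>c\<in>B. \<Sum>b\<in>B. ?h b c * (\<sigma> b c)\<^sup>2) = (\<Sum>c\<in>B. \<Sum>b\<in>B. ?h c b * (\<sigma> b c)\<^sup>2)"
      by (subst sum.swap) (simp add: sig_sym)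
    have "0 \<le> (\<Sum>c\<in>B. \<Sum>b\<in>B. (?h b c + ?h c b) * (\<sigma> b c)\<^sup>2)"
    proof (intro sum_nonneg)
      fix c b assume cb: "c \<in> B" "b \<in> B"
      show "0 \<le> (?h b c + ?h c b) * (\<sigma> b c)\<^sup>2"
      proof (cases "k b = 0 \<or> k c = 0")
        case True
        then have "\<sigma> b c = 0" using sig0[OF cb(1)] sig0[OF cb(2)] sig_sym by metis
        then show ?thesis by simp
      next
        case False
        then have "0 \<le> ?h b c + ?h c b" using k0 ks cb by (intro pair_bound) (auto simp: less_le)
        then show ?thesis by simp
      qed
    qed
    also have "\<dots> = (\<Sum>c\<in>B. \<Sum>b\<in>B. ?h b c * (\<sigma> b c)\<^sup>2) + (\<Sum>c\<in>B. \<Sum>b\<in>B. ?h c b * (\<sigma> b c)\<^sup>2)"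
      by (simp only: distrib_right sum.distrib)
    finally show ?thesis using sw by linarith
  qed
  have tc: "t c = R c + (\<Sum>b\<in>B. (\<sigma> b c)\<^sup>2 / k b)" for c by (simp add: R_def)
  have e1: "a (p (S c) - q (P c)) (p (S c) - q (P c))
      = (\<Sum>b\<in>B. (k b - 2 * k c + (k c)\<^sup>2 / k b) * (\<sigma> b c)\<^sup>2) + (k c)\<^sup>2 * R c" if c: "c \<in> B" for c
  proof -
    have "a (p (S c) - q (P c)) (p (S c) - q (P c))
        = S c \<bullet> P (S c) - 2 * (k c * (S c \<bullet> S c)) + (k c)\<^sup>2 * t c"
      using B(3)[OF c] by (simp add: a_lin H_closed inH linear_scale[OF lin(2)] P Q S t_def
          a_sym[OF inH(2,1)] power2_eq_square algebra_simps)
    also have "S c \<bullet> P (S c) = (\<Sum>b\<in>B. k b * (\<sigma> b c)\<^sup>2)"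
    proof -
      have "S c \<bullet> P (S c) = (\<Sum>b\<in>B. (S c \<bullet> b) * (b \<bullet> P (S c)))" by (rule orthonormal_parseval[OF B(1,2)])
      also have "\<dots> = (\<Sum>b\<in>B. k b * (\<sigma> b c)\<^sup>2)"
        using B(3) by (intro sum.cong) (auto simp: P_sym[symmetric] \<sigma>_def power2_eq_square inner_commute[of "S c"])
      finally show ?thesis .
    qed
    also have "S c \<bullet> S c = (\<Sum>b\<in>B. (\<sigma> b c)\<^sup>2)" by (simp add: Sn[of "S c"] \<sigma>_def)
    finally show ?thesis
      by (simp add: tc sum_distrib_left sum.distrib sum_subtractf algebra_simps)
  qed
  have e2: "P c \<bullet> Q c - S c \<bullet> S c = (\<Sum>b\<in>B. (k c / k b - 1) * (\<sigma> b c)\<^sup>2) + k c * R c" if c: "c \<in> B" for c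
  proof -
    have "P c \<bullet> Q c = k c * t c" using B(3)[OF c] by (simp add: t_def)
    moreover have "S c \<bullet> S c = (\<Sum>b\<in>B. (\<sigma> b c)\<^sup>2)" by (simp add: Sn[of "S c"] \<sigma>_def)
    ultimately show ?thesis
      by (simp add: tc sum_distrib_left sum_subtractf algebra_simps)
  qed
  have e3: "(norm (P (S c) - S (P c)))\<^sup>2 = (\<Sum>b\<in>B. (k c - k b)\<^sup>2 * (\<sigma> b c)\<^sup>2)" if c: "c \<in> B" for c
  proof -
    have "b \<bullet> (P (S c) - S (P c)) = (k b - k c) * \<sigma> b c" if b: "b \<in> B" for b
      using B(3)[OF b] B(3)[OF c]
      by (simp add: inner_diff_right P_sym[symmetric] linear_scale[OF lin(5)] \<sigma>_def algebra_simps)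
    then show ?thesis unfolding power2_norm_eq_inner Sn[of "P (S c) - S (P c)"]
      by (intro sum.cong) (auto simp: power_mult_distrib power2_commute)
  qed
  have bil: "linear (\<lambda>w. a (f v) (f w))" "linear (\<lambda>w. a (f w) (f v))"
    if "linear f" "\<And>\<xi>. f \<xi> \<in> H" for f :: "'e \<Rightarrow> 'v" and v
    using that by (auto intro!: linearI simp: linear_add linear_scale a_lin)
  have lW: "linear (\<lambda>\<xi>. p (S \<xi>) - q (P \<xi>))"
    by (rule linearI) (simp_all add: linear_add[OF lin(1)] linear_add[OF lin(2)] linear_add[OF lin(3)] linear_add[OF lin(5)]
        linear_scale[OF lin(1)] linear_scale[OF lin(2)] linear_scale[OF lin(3)] linear_scale[OF lin(5)] algebra_simps)
  have s1: "(\<Sum>b\<in>Basis. a (p (S b) - q (P b)) (p (S b) - q (P b))) = (\<Sum>b\<in>B. a (p (S b) - q (P b)) (p (S b) - q (P b)))"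
    by (rule orthonormal_sum_bilinear[OF orthonormal_Basis B(1,2)])
      (rule bil[OF lW], simp add: H_closed inH)+
  have s2: "(\<Sum>b\<in>Basis. P b \<bullet> Q b - S b \<bullet> S b) = (\<Sum>b\<in>B. P b \<bullet> Q b - S b \<bullet> S b)"
    by (rule orthonormal_sum_bilinear[OF orthonormal_Basis B(1,2), of "\<lambda>v w. P v \<bullet> Q w - S v \<bullet> S w"])
      (auto intro!: linearI simp: linear_add[OF lin(3)] linear_add[OF lin(4)] linear_add[OF lin(5)]
        linear_scale[OF lin(3)] linear_scale[OF lin(4)] linear_scale[OF lin(5)] inner_add_left inner_add_right algebra_simps)
  have s3: "(\<Sum>b\<in>Basis. (norm (P (S b) - S (P b)))\<^sup>2) = (\<Sum>b\<in>B. (norm (P (S b) - S (P b)))\<^sup>2)"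
    unfolding power2_norm_eq_inner
    by (rule orthonormal_sum_bilinear[OF orthonormal_Basis B(1,2), of "\<lambda>v w. (P (S v) - S (P v)) \<bullet> (P (S w) - S (P w))"])
      (auto intro!: linearI simp: linear_add[OF lin(3)] linear_add[OF lin(5)]
        linear_scale[OF lin(3)] linear_scale[OF lin(5)] inner_add_left inner_add_right inner_diff_left inner_diff_right algebra_simps)
  have "0 \<le> (\<Sum>c\<in>B. (2 * s * k c - 2 * (k c)\<^sup>2) * R c) + (\<Sum>c\<in>B. \<Sum>b\<in>B. ?h b c * (\<sigma> b c)\<^sup>2)"
  proof (intro add_nonneg_nonneg main sum_nonneg mult_nonneg_nonneg R0)
    fix c assume c: "c \<in> B"
    show "0 \<le> 2 * s * k c - 2 * (k c)\<^sup>2"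
      using mult_right_mono[OF ks[OF c] k0[OF c]] by (simp add: power2_eq_square)
  qed
  also have "\<dots> = (\<Sum>c\<in>B. 2 * s * (P c \<bullet> Q c - S c \<bullet> S c) - 2 * a (p (S c) - q (P c)) (p (S c) - q (P c))
      + (norm (P (S c) - S (P c)))\<^sup>2 / s)"
    unfolding sum.distrib[symmetric]
  proof (intro sum.cong refl)
    fix c assume c: "c \<in> B"
    show "(2 * s * k c - 2 * (k c)\<^sup>2) * R c + (\<Sum>b\<in>B. ?h b c * (\<sigma> b c)\<^sup>2)
      = 2 * s * (P c \<bullet> Q c - S c \<bullet> S c) - 2 * a (p (S c) - q (P c)) (p (S c) - q (P c))
      + (norm (P (S c) - S (P c)))\<^sup>2 / s"
      unfolding e1[OF c] e2[OF c] e3[OF c] distrib_left sum_distrib_left sum_divide_distrib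
      by (simp add: sum.distrib sum_subtractf algebra_simps sum_distrib_left)
  qed
  also have "\<dots> = 2 * s * (\<Sum>b\<in>Basis. P b \<bullet> Q b - S b \<bullet> S b)
      - 2 * (\<Sum>b\<in>Basis. a (p (S b) - q (P b)) (p (S b) - q (P b)))
      + (\<Sum>b\<in>Basis. (norm (P (S b) - S (P b)))\<^sup>2) / s"
    unfolding s1 s2 s3
    by (simp only: sum.distrib sum_subtractf sum_distrib_left[symmetric] sum_divide_distrib[symmetric])
  finally show ?thesis by linarith
qed

end

section \<open>Energy dissipation of the midpoint stage\<close>

locale energy_step = midpoint_stage G u uh us uhs x l + energy_space G H a
  for G :: "'v::real_inner \<Rightarrow> 'v" and u uh :: "'e::euclidean_space \<Rightarrow> 'v" and us uhs x l H a +
  assumes u_in: "u \<xi> \<in> H"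
begin

definition Sg :: "'e \<Rightarrow> 'e" where "Sg \<xi> = us (u \<xi>)"
definition T :: "'e \<Rightarrow> 'e" where "T \<xi> = (\<Sum>b\<in>Basis. a (u b) (u \<xi>) *\<^sub>R b)"
definition W :: "'e \<Rightarrow> 'v" where "W \<xi> = A (u \<xi>)"
text \<open>Counterpart of \<open>W\<close> with the roles of u and G u exchanged in the skew
  operator; it appears when a (A v) (u \<xi>) is written as an inner product with v.\<close>

definition W' :: "'e \<Rightarrow> 'v" where "W' \<xi> = u (Sg \<xi>) - G (u (T \<xi>))"
definition ea :: "('e \<Rightarrow> 'v) \<Rightarrow> real" where "ea f = (\<Sum>b\<in>Basis. a (f b) (f b))"
text \<open>Half the squared Hilbert-Schmidt norm of the skew operator, and half the first-order
  rate at which the first stage lowers twice the energy.\<close>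

definition D0 :: real where "D0 = (\<Sum>b\<in>Basis. Ko b \<bullet> T b - Sg b \<bullet> Sg b)"

lemma A_in: "A v \<in> H" by (simp add: A_def H_closed G_in u_in)
lemma Y_in: "Y \<xi> \<in> H" by (simp add: Y_eq H_closed A_in)
lemma uh_in: "uh \<xi> \<in> H" by (simp add: uh_eq H_closed u_in Y_in)
lemma w_in: "w \<xi> \<in> H" by (simp add: w_def H_closed u_in uh_in)
lemma W_in: "W \<xi> \<in> H" "W' \<xi> \<in> H" by (simp_all add: W_def W'_def A_in H_closed u_in G_in)
lemmas in_H = A_in Y_in uh_in w_in W_in u_in G_in

lemma Sg_linear: "linear Sg"
  by (rule linearI) (simp_all add: Sg_def lin)

lemma T_linear: "linear T"
  by (rule linearI)
    (simp_all add: T_def lin a_lin u_in H_closed scaleR_add_left sum.distrib scaleR_right.sum)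

lemma T_form: "a (u \<xi>) (u \<zeta>) = \<xi> \<bullet> T \<zeta>"
proof -
  have "a (u \<xi>) (u \<zeta>) = a (u (\<Sum>b\<in>Basis. (\<xi> \<bullet> b) *\<^sub>R b)) (u \<zeta>)" by (simp add: euclidean_representation)
  also have "\<dots> = (\<Sum>b\<in>Basis. (\<xi> \<bullet> b) * a (u b) (u \<zeta>))"
    by (simp add: linear_sum[OF u_linear] lin a_sum a_lin H_closed u_in)
  also have "\<dots> = \<xi> \<bullet> T \<zeta>" by (simp add: T_def inner_sum_right mult.commute)
  finally show ?thesis .
qed

lemma T_sym: "T \<xi> \<bullet> \<zeta> = \<xi> \<bullet> T \<zeta>"
  by (metis T_form a_sym u_in inner_commute)

lemma Sg_sym: "Sg \<xi> \<bullet> \<zeta> = \<xi> \<bullet> Sg \<zeta>"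
  by (simp add: Sg_def inner_commute[of "us _" \<zeta>] u_adj[symmetric]) (rule inner_commute)

lemma Ko_form: "a (G (u \<xi>)) (G (u \<zeta>)) = \<xi> \<bullet> Ko \<zeta>"
  by (simp add: a_G G_in u_adj Ko_def)

lemma S_form: "a (G (u \<xi>)) (u \<zeta>) = \<xi> \<bullet> Sg \<zeta>" "a (u \<xi>) (G (u \<zeta>)) = \<xi> \<bullet> Sg \<zeta>"
  by (simp_all add: a_G a_G2 u_in u_adj Sg_def) (metis inner_commute u_adj)

lemma W_eq: "W \<xi> = G (u (Sg \<xi>)) - u (Ko \<xi>)"
  by (simp add: W_def A_def Sg_def Ko_def)

lemma us_W: "us (W \<xi>) = Ko (Sg \<xi>) - Sg (Ko \<xi>)"
  by (simp add: W_eq lin Ko_def Sg_def)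

lemma Gu_linear: "linear (\<lambda>\<xi>. G (u \<xi>))"
  by (rule linearI) (simp_all add: lin)

lemma D0_bound:
  assumes "\<And>\<xi>. u \<xi> \<bullet> u \<xi> \<le> s * (\<xi> \<bullet> \<xi>)"
  shows "2 * ea W \<le> 2 * s * D0 + (\<Sum>b\<in>Basis. (norm (us (W b)))\<^sup>2) / s"
  unfolding ea_def D0_def us_W
  unfolding W_eq
proof (rule skew_bound[OF Gu_linear u_linear linears(8) T_linear Sg_linear])
  show "\<xi> \<bullet> Ko \<xi> \<le> s * (\<xi> \<bullet> \<xi>)" for \<xi>
    using assms[of \<xi>] G_le[of "u \<xi>"] by (simp add: Ko_def u_adj[symmetric])
qed (simp_all add: in_H Ko_form T_form S_form Sg_sym)

text \<open>An operator and its adjoint have the same norm, here in the form: Gram operator at most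
  s implies |us v|^2 \<le> s |v|^2.\<close>

lemma us_le:
  assumes "\<And>\<xi>. u \<xi> \<bullet> u \<xi> \<le> s * (\<xi> \<bullet> \<xi>)" "0 \<le> s"
  shows "(norm (us v))\<^sup>2 \<le> s * (v \<bullet> v)"
proof -
  define n where "n = norm (us v)"
  have "n\<^sup>2 = u (us v) \<bullet> v" unfolding n_def power2_norm_eq_inner by (simp add: u_adj)
  also have "\<dots> \<le> norm (u (us v)) * norm v" by (rule norm_cauchy_schwarz)
  finally have "(n\<^sup>2)\<^sup>2 \<le> (norm (u (us v)) * norm v)\<^sup>2" by (intro power_mono) auto
  also have "\<dots> = (u (us v) \<bullet> u (us v)) * (v \<bullet> v)" by (simp add: power_mult_distrib power2_norm_eq_inner)
  also have "\<dots> \<le> (s * n\<^sup>2) * (v \<bullet> v)"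
    using assms(1)[of "us v"] by (intro mult_right_mono) (auto simp: n_def power2_norm_eq_inner)
  finally have "n\<^sup>2 * n\<^sup>2 \<le> n\<^sup>2 * (s * (v \<bullet> v))" by (simp add: power2_eq_square algebra_simps)
  then have "n\<^sup>2 \<le> s * (v \<bullet> v)" by (rule mult_self_le_cancel) (use assms(2) in simp_all)
  then show ?thesis by (simp add: n_def)
qed

lemma ea_pos: "(\<And>\<xi>. f \<xi> \<in> H) \<Longrightarrow> 0 \<le> ea f"
  by (simp add: ea_def sum_nonneg a_pos)

lemma usW_le:
  assumes "\<And>\<xi>. u \<xi> \<bullet> u \<xi> \<le> s * (\<xi> \<bullet> \<xi>)" "0 \<le> s"
  shows "(\<Sum>b\<in>Basis. (norm (us (W b)))\<^sup>2) \<le> s * (\<Sum>b\<in>Basis. W b \<bullet> W b)"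
    "s * (\<Sum>b\<in>Basis. W b \<bullet> W b) \<le> s * ea W"
proof -
  show "(\<Sum>b\<in>Basis. (norm (us (W b)))\<^sup>2) \<le> s * (\<Sum>b\<in>Basis. W b \<bullet> W b)"
    unfolding sum_distrib_left by (intro sum_mono us_le assms)
  show "s * (\<Sum>b\<in>Basis. W b \<bullet> W b) \<le> s * ea W"
    unfolding ea_def by (intro mult_left_mono sum_mono a_ge in_H assms)
qed

text \<open>Bounding |us W|^2 by l times the energy of W uses up one of the two copies on the left
  of \<open>D0_bound\<close>. The quantity given away here is the slack exploited in
  \<open>decay_strong\<close>.\<close>

lemma D0_weak: "ea W \<le> 2 * l * D0"
proof -
  have "(\<Sum>b\<in>Basis. (norm (us (W b)))\<^sup>2) \<le> l * ea W"
    using usW_le[OF u_le] l_ge by linarith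
  then have "(\<Sum>b\<in>Basis. (norm (us (W b)))\<^sup>2) / l \<le> ea W" using l_ge by (simp add: pos_divide_le_eq mult.commute)
  then show ?thesis using D0_bound[OF u_le] by linarith
qed

lemma D0_nonneg: "0 \<le> D0"
proof -
  have "0 \<le> (2 * l) * D0" using D0_weak ea_pos[of W] in_H by force
  then show ?thesis using l_ge by (simp add: zero_le_mult_iff)
qed

lemma T_le_trace: "\<xi> \<bullet> T \<xi> \<le> ea u * (\<xi> \<bullet> \<xi>)"
proof -
  have "\<xi> \<bullet> T \<xi> \<le> (\<Sum>b\<in>Basis. b \<bullet> T b) * (\<xi> \<bullet> \<xi>)"
    by (rule psd_le_trace[OF T_linear T_sym]) (simp add: T_form[symmetric] a_pos u_in)
  then show ?thesis by (simp add: ea_def T_form)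
qed

context
  fixes e2 k0 :: real
  assumes e2: "ea u \<le> e2" "0 < e2" and k0: "k0 = sqrt (l * e2)"
begin

lemma k0_pos: "0 < k0" using k0 e2 l_ge by simp

lemma T_le: "\<xi> \<bullet> T \<xi> \<le> e2 * (\<xi> \<bullet> \<xi>)"
  by (rule order_trans[OF T_le_trace mult_right_mono[OF e2(1)]]) simp

text \<open>Second use of \<open>skew_bound\<close>, with p = u and P = T, so that e2 takes the
  place of s. The commutator of T and the Gram operator represents a (u \<xi>) (W' b) and is
  therefore bounded by the energy of W'.\<close>

lemma W'_le: "(\<Sum>b\<in>Basis. W' b \<bullet> W' b) \<le> 2 * e2 * D0"
proof -
  have W': "W' \<xi> = u (Sg \<xi>) - G (u (T \<xi>))" for \<xi> by (simp add: W'_def)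
  let ?c = "\<lambda>b. T (Sg b) - Sg (T b)"
  have "2 * ea W' \<le> 2 * e2 * (\<Sum>b\<in>Basis. T b \<bullet> Ko b - Sg b \<bullet> Sg b) + (\<Sum>b\<in>Basis. (norm (?c b))\<^sup>2) / e2"
    unfolding ea_def W'
    by (rule skew_bound[OF u_linear Gu_linear T_linear linears(8) Sg_linear])
      (simp_all add: in_H Ko_form T_form S_form Sg_sym T_le[unfolded T_form])
  moreover have "(\<Sum>b\<in>Basis. T b \<bullet> Ko b - Sg b \<bullet> Sg b) = D0" by (simp add: D0_def inner_commute)
  moreover have pw: "(norm (?c b))\<^sup>2 \<le> e2 * a (W' b) (W' b)" for b
  proof -
    have 1: "\<xi> \<bullet> ?c b = a (u \<xi>) (W' b)" for \<xi>
      by (simp add: W' a_diff2 in_H T_form S_form inner_diff_right)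
    have "(norm (?c b))\<^sup>2 = a (u (?c b)) (W' b)" by (simp add: 1[symmetric] power2_norm_eq_inner)
    also have "\<dots> \<le> na (u (?c b)) * na (W' b)" by (intro a_cauchy in_H)
    finally have "((norm (?c b))\<^sup>2)\<^sup>2 \<le> (na (u (?c b)) * na (W' b))\<^sup>2" by (intro power_mono) auto
    also have "\<dots> = a (u (?c b)) (u (?c b)) * a (W' b) (W' b)" by (simp add: power_mult_distrib na_sq in_H)
    also have "\<dots> \<le> (e2 * (norm (?c b))\<^sup>2) * a (W' b) (W' b)"
      using T_le[of "?c b"] by (intro mult_right_mono) (simp_all add: T_form power2_norm_eq_inner a_pos in_H)
    finally have f1: "(norm (?c b))\<^sup>2 * (norm (?c b))\<^sup>2 \<le> (norm (?c b))\<^sup>2 * (e2 * a (W' b) (W' b))"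
      by (simp only: power2_eq_square[of "(norm (?c b))\<^sup>2"] mult_ac)
    have f2: "0 \<le> e2 * a (W' b) (W' b)" using e2(2) a_pos[OF in_H(6)] by simp
    show ?thesis by (rule mult_self_le_cancel[OF f1 _ f2]) simp
  qed
  have "(\<Sum>b\<in>Basis. (norm (?c b))\<^sup>2) \<le> e2 * ea W'"
    unfolding ea_def sum_distrib_left by (intro sum_mono pw)
  then have "(\<Sum>b\<in>Basis. (norm (?c b))\<^sup>2) / e2 \<le> ea W'" using e2(2) by (simp add: pos_divide_le_eq mult.commute)
  moreover have "(\<Sum>b\<in>Basis. W' b \<bullet> W' b) \<le> ea W'" unfolding ea_def by (intro sum_mono a_ge in_H)
  ultimately show ?thesis by (simp add: mult.assoc)
qed

lemma na_u: "na (u \<xi>) \<le> sqrt e2 * norm \<xi>"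
proof -
  have "a (u \<xi>) (u \<xi>) \<le> e2 * (norm \<xi>)\<^sup>2" using T_le[of \<xi>] by (simp add: T_form power2_norm_eq_inner)
  then have "sqrt (a (u \<xi>) (u \<xi>)) \<le> sqrt (e2 * (norm \<xi>)\<^sup>2)" by (rule real_sqrt_le_mono)
  then show ?thesis by (simp add: na_def real_sqrt_mult)
qed

lemma na_uusG: "na (u (us (G v))) \<le> k0 * norm v"
proof -
  have "norm (us (G v)) \<le> sqrt l * norm v"
    using norm_us[of "G v"] mult_left_mono[OF norm_G_le[of v] L_nonneg] by (simp add: L_def)
  then have "sqrt e2 * norm (us (G v)) \<le> sqrt e2 * (sqrt l * norm v)" using e2 by (intro mult_left_mono) auto
  then show ?thesis using na_u[of "us (G v)"] by (simp add: k0 real_sqrt_mult mult_ac)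
qed

lemma na_A: "na (A v) \<le> (l + k0) * norm v"
proof -
  have "na (A v) \<le> na (G (u (us v))) + na (u (us (G v)))" unfolding A_def by (intro na_diff in_H)
  moreover have "na (G (u (us v))) \<le> l * norm v"
  proof -
    have "na (G (u (us v))) \<le> norm (u (us v))" unfolding na_G by (rule gam_le_norm)
    also have "\<dots> \<le> L * norm (us v)" by (rule norm_u)
    also have "\<dots> \<le> L * (L * norm v)" by (intro mult_left_mono norm_us L_nonneg)
    finally show ?thesis by (simp add: L3)
  qed
  ultimately show ?thesis using na_uusG[of v] by (simp add: distrib_right)
qed

lemma Y_alt: "Y \<xi> = x *\<^sub>R (W \<xi> + (1/2) *\<^sub>R A (Y \<xi>))"
proof -
  have "w \<xi> = u \<xi> + (1/2) *\<^sub>R Y \<xi>" by (simp add: w_def Y_def algebra_simps flip: scaleR_add_left)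
  then have "A (w \<xi>) = W \<xi> + (1/2) *\<^sub>R A (Y \<xi>)" by (simp add: lin W_def)
  then show ?thesis using Y_eq[of \<xi>] by simp
qed

text \<open>Testing the implicit equation with Y itself removes the term in A Y by antisymmetry, so
  no smallness of x enters.\<close>

lemma norm_Y_le: "norm (Y \<xi>) \<le> x * norm (W \<xi>)"
proof -
  have AY: "A (Y \<xi>) \<bullet> Y \<xi> = 0" using A_antisym[of "Y \<xi>" "Y \<xi>"] by (simp add: inner_commute)
  have "norm (Y \<xi>) * norm (Y \<xi>) = Y \<xi> \<bullet> Y \<xi>" by (simp add: power2_norm_eq_inner flip: power2_eq_square)
  also have "\<dots> = x * (W \<xi> \<bullet> Y \<xi>)" by (subst Y_alt) (simp add: inner_add_left AY)
  also have "\<dots> \<le> x * (norm (W \<xi>) * norm (Y \<xi>))" using x_pos by (intro mult_left_mono norm_cauchy_schwarz) auto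
  finally have "norm (Y \<xi>) * norm (Y \<xi>) \<le> (x * norm (W \<xi>)) * norm (Y \<xi>)" by (simp add: mult.assoc)
  then show ?thesis using x_pos by (cases "norm (Y \<xi>) = 0") (auto simp: mult_le_cancel_right)
qed

lemma norm_Y_na: "norm (Y \<xi>) \<le> x * na (W \<xi>)"
  by (rule order_trans[OF norm_Y_le mult_left_mono[OF norm_le_na[OF W_in(1)]]]) (use x_pos in simp)

text \<open>The midpoint rule makes the energy change exactly 2 x times the form a (A w) w;
  inserting w = u + Y/2 separates the leading rate from three terms containing Y.\<close>

lemma energy_expand: "ea u - ea uh = 2 * x * (D0 - (1/2) * (\<Sum>b\<in>Basis. a (W b) (Y b))
    - (1/2) * (\<Sum>b\<in>Basis. Y b \<bullet> W' b) - (1/4) * (\<Sum>b\<in>Basis. a (A (Y b)) (Y b)))"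
proof -
  have wb: "w b = u b + (1/2) *\<^sub>R Y b" for b by (simp add: w_def Y_def algebra_simps flip: scaleR_add_left)
  have 1: "a (u b) (u b) - a (uh b) (uh b) = - 2 * x * a (A (w b)) (w b)" for b
  proof -
    have "a (uh b) (uh b) - a (u b) (u b) = 2 * a (Y b) (w b)"
      by (simp add: uh_eq wb a_lin in_H H_closed a_sym[of "Y b" "u b"])
    then show ?thesis by (simp add: Y_eq a_lin in_H H_closed)
  qed
  have 2: "a (A (w b)) (w b) = a (W b) (u b) + (1/2) * a (W b) (Y b) + (1/2) * a (A (Y b)) (u b) + (1/4) * a (A (Y b)) (Y b)" for b
    by (simp add: wb lin W_def a_lin in_H H_closed)
  have 3: "a (W b) (u b) = - (Ko b \<bullet> T b - Sg b \<bullet> Sg b)" for b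
    by (simp add: W_eq a_diff in_H S_form T_form)
  have 4: "a (A (Y b)) (u b) = Y b \<bullet> W' b" for b
  proof -
    have "a (A (Y b)) (u b) = u (us (Y b)) \<bullet> u b - a (u (us (G (Y b)))) (u b)"
      by (simp add: A_def a_diff in_H a_G)
    also have "u (us (Y b)) \<bullet> u b = Y b \<bullet> u (Sg b)"
      by (simp add: u_adj Sg_def) (metis inner_commute u_adj)
    also have "a (u (us (G (Y b)))) (u b) = Y b \<bullet> G (u (T b))"
      by (simp add: T_form) (metis G_sym inner_commute u_adj)
    finally show ?thesis by (simp add: W'_def inner_diff_right)
  qed
  have "ea u - ea uh = (\<Sum>b\<in>Basis. - 2 * x * a (A (w b)) (w b))"
    unfolding ea_def sum_subtractf[symmetric] 1 ..
  also have "\<dots> = - 2 * x * (\<Sum>b\<in>Basis. - (Ko b \<bullet> T b - Sg b \<bullet> Sg b) + (1/2) * a (W b) (Y b)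
      + (1/2) * (Y b \<bullet> W' b) + (1/4) * a (A (Y b)) (Y b))"
    unfolding 2 3 4 sum_distrib_left ..
  also have "\<dots> = - 2 * x * (- D0 + (1/2) * (\<Sum>b\<in>Basis. a (W b) (Y b))
      + (1/2) * (\<Sum>b\<in>Basis. Y b \<bullet> W' b) + (1/4) * (\<Sum>b\<in>Basis. a (A (Y b)) (Y b)))"
    unfolding D0_def sum.distrib sum_negf sum_distrib_left ..
  finally show ?thesis by (simp add: algebra_simps)
qed

context
  assumes xk0: "2 * x * k0 \<le> 1" and xl3: "3 * x * l \<le> 1"
begin

lemma na_Y: "na (Y \<xi>) \<le> 17/12 * (x * na (W \<xi>))"
proof -
  have "na (Y \<xi>) \<le> x * (na (W \<xi>) + (1/2) * na (A (Y \<xi>)))"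
  proof -
    have "na (Y \<xi>) = x * na (W \<xi> + (1/2) *\<^sub>R A (Y \<xi>))"
      using x_pos by (subst Y_alt) (simp add: na_scale in_H H_closed)
    also have "\<dots> \<le> x * (na (W \<xi>) + na ((1/2) *\<^sub>R A (Y \<xi>)))"
      using x_pos by (intro mult_left_mono na_triangle) (auto simp: in_H H_closed)
    finally show ?thesis by (simp add: na_scale in_H)
  qed
  also have "\<dots> \<le> x * (na (W \<xi>) + (1/2) * ((l + k0) * (x * na (W \<xi>))))"
  proof -
    have "na (A (Y \<xi>)) \<le> (l + k0) * norm (Y \<xi>)" by (rule na_A)
    also have "\<dots> \<le> (l + k0) * (x * na (W \<xi>))"
      using k0_pos l_ge by (intro mult_left_mono norm_Y_na) auto
    finally show ?thesis using x_pos by (intro mult_left_mono add_left_mono) auto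
  qed
  also have "\<dots> = (1 + (1/2) * (x * l + x * k0)) * (x * na (W \<xi>))" by (simp add: algebra_simps add_divide_distrib)
  also have "\<dots> \<le> 17/12 * (x * na (W \<xi>))"
  proof (rule mult_right_mono)
    \<comment> \<open>1 + (1/2)(1/3 + 1/2) = 17/12.\<close>
    have "3 * (x * l) \<le> 1" "2 * (x * k0) \<le> 1" using xl3 xk0 by (simp_all add: mult.assoc)
    then show "1 + (1/2) * (x * l + x * k0) \<le> 17/12" by simp
  qed (use x_pos na_nonneg[OF W_in(1)] in simp)
  finally show ?thesis .
qed

lemma stage1_drop: "ea u - ea uh \<ge> 2 * x * ((1 - x * k0) * D0 - 31/32 * x * ea W)"
proof -
  have i1: "(\<Sum>b\<in>Basis. a (W b) (Y b)) \<le> 17/12 * x * ea W"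
  proof -
    have pw: "a (W b) (Y b) \<le> 17/12 * x * a (W b) (W b)" for b
    proof -
      have "a (W b) (Y b) \<le> na (W b) * na (Y b)" by (intro a_cauchy in_H)
      also have "\<dots> \<le> na (W b) * (17/12 * (x * na (W b)))" by (intro mult_left_mono na_Y na_nonneg in_H)
      also have "\<dots> = 17/12 * x * (na (W b) * na (W b))" by simp
      finally show ?thesis by (simp only: na_sq(2)[OF W_in(1)])
    qed
    show ?thesis unfolding ea_def sum_distrib_left by (intro sum_mono pw)
  qed
  have i2: "(\<Sum>b\<in>Basis. Y b \<bullet> W' b) \<le> 2 * x * k0 * D0"
  proof -
    have yy: "(\<Sum>b\<in>Basis. Y b \<bullet> Y b) \<le> x\<^sup>2 * (2 * l * D0)"
    proof -
      have pw: "Y b \<bullet> Y b \<le> x\<^sup>2 * a (W b) (W b)" for b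
      proof -
        have "(norm (Y b))\<^sup>2 \<le> (x * na (W b))\<^sup>2" by (intro power_mono norm_Y_na) auto
        then show ?thesis by (simp add: power2_norm_eq_inner power_mult_distrib na_sq in_H)
      qed
      have "(\<Sum>b\<in>Basis. Y b \<bullet> Y b) \<le> x\<^sup>2 * ea W" unfolding ea_def sum_distrib_left by (intro sum_mono pw)
      also have "\<dots> \<le> x\<^sup>2 * (2 * l * D0)" by (intro mult_left_mono D0_weak) simp
      finally show ?thesis .
    qed
    have "(\<Sum>b\<in>Basis. Y b \<bullet> W' b) \<le> sqrt (\<Sum>b\<in>Basis. Y b \<bullet> Y b) * sqrt (\<Sum>b\<in>Basis. W' b \<bullet> W' b)"
    proof (rule sqrt_cauchy)
      fix t
      have "0 \<le> (\<Sum>b\<in>Basis. (Y b + t *\<^sub>R W' b) \<bullet> (Y b + t *\<^sub>R W' b))" by (intro sum_nonneg) simp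
      also have "\<dots> = (\<Sum>b\<in>Basis. Y b \<bullet> Y b + 2 * t * (Y b \<bullet> W' b) + t\<^sup>2 * (W' b \<bullet> W' b))"
        by (intro sum.cong refl) (simp add: inner_add_left inner_add_right inner_commute[of "W' _" "Y _"] power2_eq_square algebra_simps)
      finally show "0 \<le> (\<Sum>b\<in>Basis. Y b \<bullet> Y b) + 2 * t * (\<Sum>b\<in>Basis. Y b \<bullet> W' b) + t\<^sup>2 * (\<Sum>b\<in>Basis. W' b \<bullet> W' b)"
        by (simp only: sum.distrib sum_distrib_left)
    qed (simp add: sum_nonneg)
    also have "\<dots> \<le> sqrt (x\<^sup>2 * (2 * l * D0)) * sqrt (2 * e2 * D0)"
      using yy W'_le by (intro mult_mono real_sqrt_le_mono) (auto simp: sum_nonneg D0_nonneg l_ge intro!: mult_nonneg_nonneg order_trans[OF zero_le_one l_ge])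
    also have "\<dots> = sqrt ((2 * x * D0)\<^sup>2 * (l * e2))"
      unfolding real_sqrt_mult[symmetric] by (simp add: power2_eq_square mult_ac)
    also have "\<dots> = 2 * x * D0 * k0" using x_pos D0_nonneg by (simp add: real_sqrt_mult k0)
    finally show ?thesis by (simp add: mult_ac)
  qed
  have i3: "(\<Sum>b\<in>Basis. a (A (Y b)) (Y b)) \<le> 25/24 * x * ea W"
  proof -
    have pw: "a (A (Y b)) (Y b) \<le> 25/24 * x * a (W b) (W b)" for b
    proof -
      let ?n = "na (W b)"
      have n0: "0 \<le> ?n" by (intro na_nonneg in_H)
      have ny: "norm (Y b) \<le> x * ?n" by (rule norm_Y_na)
      have y0: "0 \<le> na (Y b)" by (intro na_nonneg in_H)
      have "a (A (Y b)) (Y b) = us (Y b) \<bullet> us (Y b) - a (u (us (G (Y b)))) (Y b)"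
        by (simp add: A_def a_diff in_H a_G u_adj)
      also have "\<dots> \<le> (norm (us (Y b)))\<^sup>2 + na (u (us (G (Y b)))) * na (Y b)"
      proof -
        have "- a (u (us (G (Y b)))) (Y b) \<le> na (u (us (G (Y b)))) * na (Y b)" by (intro a_cauchy_neg in_H)
        then show ?thesis by (simp add: power2_norm_eq_inner)
      qed
      also have "\<dots> \<le> l * (x * ?n)\<^sup>2 + (k0 * (x * ?n)) * (17/12 * (x * ?n))"
      proof (rule add_mono)
        have "(norm (us (Y b)))\<^sup>2 \<le> l * (norm (Y b))\<^sup>2" using us_le[OF u_le, of "Y b"] l_ge by (simp add: power2_norm_eq_inner)
        also have "\<dots> \<le> l * (x * ?n)\<^sup>2" using ny l_ge by (intro mult_left_mono power_mono) auto
        finally show "(norm (us (Y b)))\<^sup>2 \<le> l * (x * ?n)\<^sup>2" .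
        have "na (u (us (G (Y b)))) \<le> k0 * (x * ?n)"
          using na_uusG[of "Y b"] mult_left_mono[OF ny, of k0] k0_pos by linarith
        then show "na (u (us (G (Y b)))) * na (Y b) \<le> (k0 * (x * ?n)) * (17/12 * (x * ?n))"
          by (rule mult_mono[OF _ na_Y]) (use k0_pos x_pos n0 y0 in simp_all)
      qed
      also have "\<dots> = (x * l + 17/12 * (x * k0)) * (x * (?n * ?n))" by (simp add: power2_eq_square algebra_simps)
      also have "\<dots> \<le> 25/24 * (x * (?n * ?n))"
      proof (rule mult_right_mono)
        have "3 * (x * l) \<le> 1" "2 * (x * k0) \<le> 1" using xl3 xk0 by (simp_all add: mult.assoc)
        then show "x * l + 17/12 * (x * k0) \<le> 25/24" by linarith
      qed (use x_pos n0 in simp)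
      also have "\<dots> = 25/24 * x * a (W b) (W b)" by (simp only: na_sq(2)[OF W_in(1)] mult.assoc)
      finally show ?thesis .
    qed
    show ?thesis unfolding ea_def sum_distrib_left by (intro sum_mono pw)
  qed
  \<comment> \<open>The coefficient 31/32 is (1/2)(17/12) + (1/4)(25/24).\<close>
  have "(1 - x * k0) * D0 - 31/32 * x * ea W \<le> D0 - (1/2) * (\<Sum>b\<in>Basis. a (W b) (Y b))
    - (1/2) * (\<Sum>b\<in>Basis. Y b \<bullet> W' b) - (1/4) * (\<Sum>b\<in>Basis. a (A (Y b)) (Y b))"
    using i1 i2 i3 by (simp add: left_diff_distrib)
  then show ?thesis unfolding energy_expand using x_pos by (intro mult_left_mono) auto
qed

end

end

end

section \<open>One step of the scheme\<close>

text \<open>Here \<open>l\<close> and \<open>e2\<close> will be the initial lambda_max and twice the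
  rescaled initial energy, not current values, so that one set of constants serves all steps. The
  tolerance \<epsilon> vanishes together with \<open>d\<close>.\<close>

locale scheme_step = energy_step G u uh us uhs x l H a
  for G :: "'v::real_inner \<Rightarrow> 'v" and u uh :: "'e::euclidean_space \<Rightarrow> 'v" and us uhs x l H a +
  fixes d \<epsilon> e2 :: real
  assumes d_eq: "d = l - 1" and eps: "\<epsilon> = min d (7/200)"
    and D_ge: "- \<epsilon> * (\<xi> \<bullet> \<xi>) \<le> \<xi> \<bullet> D \<xi>"
    and e2: "ea u \<le> e2" and e2_ge: "l + real DIM('e) - 1 \<le> e2"
    and x_le: "x * (2 * sqrt (real DIM('e)) * e2 * l\<^sup>2 + l) \<le> 1"
    and xk0: "2 * x * sqrt (l * e2) \<le> 1"
begin

definition k0 :: real where "k0 = sqrt (l * e2)"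
definition un :: "'e \<Rightarrow> 'v" where "un \<xi> = uh \<xi> - x *\<^sub>R G (uh (D \<xi>))"
definition Dn :: "'e \<Rightarrow> 'e" where
  "Dn \<xi> = D \<xi> - x *\<^sub>R K (D \<xi>) - x *\<^sub>R D (K \<xi>) + (x * x) *\<^sub>R D (uhs (G (G (uh (D \<xi>)))))"
definition trD :: real where "trD = (\<Sum>b\<in>Basis. b \<bullet> D b)"
definition trDD :: real where "trDD = (\<Sum>b\<in>Basis. D b \<bullet> D b)"

lemma dim_ge: "1 \<le> real DIM('e)" "1 \<le> sqrt (real DIM('e))"
  using DIM_positive[where 'a='e] by auto

lemma d0: "0 \<le> d" using d_eq l_ge by simp

lemma eps_le: "0 \<le> \<epsilon>" "\<epsilon> \<le> d" "\<epsilon> \<le> 7/200" using d0 eps by auto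

lemma e2_l: "l \<le> e2" "0 < e2" using e2_ge dim_ge l_ge by linarith+

lemma xl2: "3 * (x * l\<^sup>2) \<le> 1"
proof -
  have "3 * l\<^sup>2 \<le> 2 * l * l\<^sup>2 + l"
  proof -
    have "0 \<le> l * ((2 * l - 1) * (l - 1))" using l_ge by simp
    also have "\<dots> = 2 * l * l\<^sup>2 + l - 3 * l\<^sup>2" by (simp add: power2_eq_square algebra_simps)
    finally show ?thesis by simp
  qed
  also have "\<dots> \<le> 2 * sqrt (real DIM('e)) * e2 * l\<^sup>2 + l"
  proof -
    have "1 * l \<le> sqrt (real DIM('e)) * e2" using dim_ge e2_l l_ge by (intro mult_mono) auto
    then have "(1 * l) * (2 * l\<^sup>2) \<le> (sqrt (real DIM('e)) * e2) * (2 * l\<^sup>2)" by (intro mult_right_mono) auto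
    then show ?thesis by (simp add: mult_ac)
  qed
  finally have "x * (3 * l\<^sup>2) \<le> x * (2 * sqrt (real DIM('e)) * e2 * l\<^sup>2 + l)" using x_pos by (intro mult_left_mono) auto
  then show ?thesis using x_le by linarith
qed

lemma xl: "3 * (x * l) \<le> 1" "12 * (x * d) \<le> 1" "2 * x \<le> 1" "x * l \<le> 1" "0 \<le> x * l" "0 \<le> x * d"
proof -
  have "x * l \<le> x * l\<^sup>2" using x_pos l_ge by (intro mult_left_mono) (auto simp: power2_eq_square)
  then show a: "3 * (x * l) \<le> 1" using xl2 by linarith
  have "x * (4 * d) \<le> x * l\<^sup>2"
    using x_pos zero_le_power2[of "l - 2"] by (intro mult_left_mono) (auto simp: d_eq power2_eq_square algebra_simps)
  then show "12 * (x * d) \<le> 1" using xl2 by linarith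
  show b: "0 \<le> x * l" "0 \<le> x * d" using x_pos l_ge d0 by auto
  show "x * l \<le> 1" using a b by linarith
  have "x * 1 \<le> x * l" using x_pos l_ge by (intro mult_left_mono) auto
  then show "2 * x \<le> 1" using a x_pos by linarith
qed

section \<open>Operator bounds for the tuple and for the next defect\<close>

lemma D_le: "\<xi> \<bullet> D \<xi> \<le> d * (\<xi> \<bullet> \<xi>)"
  using u_le[of \<xi>] by (simp add: D_def inner_diff_right u_adj d_eq left_diff_distrib)

lemma norm_D: "norm (D \<xi>) \<le> d * norm \<xi>"
proof (rule sym_norm_le[OF linears(6) D_sym D_le])
  show "- d * (v \<bullet> v) \<le> v \<bullet> D v" for v
    using D_ge[of v] mult_right_mono[OF eps_le(2) inner_ge_zero[of v]] by simp
qed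

lemma Sg_D: "Sg \<xi> = \<xi> + D \<xi>" by (simp add: Sg_def D_def)

text \<open>Trace bound for the form minus m: the other N - 1 eigenvalues are at least m, so the
  largest is at most the trace minus m (N - 1).\<close>

lemma form_le_trace:
  fixes f :: "'e \<Rightarrow> 'v"
  assumes lf: "linear f" and fH: "\<And>\<xi>. f \<xi> \<in> H" and m: "\<And>\<xi>. m * (\<xi> \<bullet> \<xi>) \<le> f \<xi> \<bullet> f \<xi>"
  shows "a (f \<xi>) (f \<xi>) \<le> (ea f - m * (real DIM('e) - 1)) * (\<xi> \<bullet> \<xi>)"
proof -
  define g where "g \<zeta> = (\<Sum>b\<in>Basis. a (f b) (f \<zeta>) *\<^sub>R b) - m *\<^sub>R \<zeta>" for \<zeta>
  have lg: "linear g"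
    by (rule linearI) (simp_all add: g_def linear_add[OF lf] linear_scale[OF lf] a_lin fH H_closed
        scaleR_add_left scaleR_add_right sum.distrib scaleR_right.sum scaleR_right_diff_distrib)
  have gf: "\<xi> \<bullet> g \<zeta> = a (f \<xi>) (f \<zeta>) - m * (\<xi> \<bullet> \<zeta>)" for \<xi> \<zeta>
  proof -
    have "a (f \<xi>) (f \<zeta>) = a (f (\<Sum>b\<in>Basis. (\<xi> \<bullet> b) *\<^sub>R b)) (f \<zeta>)" by (simp add: euclidean_representation)
    also have "\<dots> = (\<Sum>b\<in>Basis. (\<xi> \<bullet> b) * a (f b) (f \<zeta>))"
      by (simp add: linear_sum[OF lf] linear_scale[OF lf] a_sum a_lin H_closed fH)
    finally show ?thesis by (simp add: g_def inner_diff_right inner_sum_right mult.commute)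
  qed
  have "\<xi> \<bullet> g \<xi> \<le> (\<Sum>b\<in>Basis. b \<bullet> g b) * (\<xi> \<bullet> \<xi>)"
  proof (rule psd_le_trace[OF lg])
    show "g v \<bullet> w = v \<bullet> g w" for v w
      by (subst inner_commute) (simp add: gf a_sym[OF fH fH] inner_commute)
    show "0 \<le> v \<bullet> g v" for v using m[of v] a_ge[OF fH, of v] by (simp add: gf)
  qed
  also have "(\<Sum>b\<in>Basis. b \<bullet> g b) = ea f - m * real DIM('e)"
    by (simp add: gf ea_def sum_subtractf inner_same_Basis)
  finally show ?thesis by (simp add: gf algebra_simps)
qed

text \<open>Duality: (f \<xi>, v) is a (f \<xi>) (G v), and the energy norm of G v is
  \<open>gam v\<close>. Cauchy-Schwarz for \<open>a\<close> thus gives \<open>gam\<close> where the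
  inner product would give only the norm.\<close>

lemma adj_gam:
  fixes f :: "'e \<Rightarrow> 'v" and fs :: "'v \<Rightarrow> 'e"
  assumes fH: "\<And>\<xi>. f \<xi> \<in> H" and adj: "\<And>\<xi> v. f \<xi> \<bullet> v = \<xi> \<bullet> fs v"
    and le: "\<And>\<xi>. a (f \<xi>) (f \<xi>) \<le> \<beta> * (\<xi> \<bullet> \<xi>)"
  shows "norm (fs v) \<le> sqrt \<beta> * gam v"
proof -
  have "norm (fs v) * norm (fs v) = f (fs v) \<bullet> v"
    by (simp add: adj power2_norm_eq_inner flip: power2_eq_square)
  also have "\<dots> = a (f (fs v)) (G v)" by (simp add: a_G2 fH inner_commute)
  also have "\<dots> \<le> na (f (fs v)) * gam v" unfolding na_G[symmetric] by (intro a_cauchy fH G_in)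
  also have "\<dots> \<le> (sqrt \<beta> * norm (fs v)) * gam v"
  proof (rule mult_right_mono)
    have "sqrt (a (f (fs v)) (f (fs v))) \<le> sqrt (\<beta> * (norm (fs v))\<^sup>2)"
      using le[of "fs v"] by (intro real_sqrt_le_mono) (simp add: power2_norm_eq_inner)
    then show "na (f (fs v)) \<le> sqrt \<beta> * norm (fs v)" by (simp add: na_def real_sqrt_mult)
  qed (rule gam_nonneg)
  finally have 1: "norm (fs v) * norm (fs v) \<le> norm (fs v) * (sqrt \<beta> * gam v)" by (simp add: mult_ac)
  show ?thesis
  proof (cases "fs v = 0")
    case False
    then show ?thesis using 1 by simp
  next
    case True
    have "0 \<le> \<beta>"
    proof -
      obtain b :: 'e where b: "b \<in> Basis" using nonempty_Basis by blast
      show ?thesis using le[of b] a_pos[OF fH, of b] b by (simp add: inner_same_Basis)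
    qed
    then show ?thesis using True by (simp add: gam_nonneg)
  qed
qed

lemma us_gam0: "norm (us v) \<le> sqrt e2 * gam v"
  by (rule adj_gam[OF u_in u_adj]) (use T_le[OF e2 e2_l(2) refl] in \<open>simp add: T_form\<close>)

lemma Dn_inner: "\<xi> \<bullet> Dn \<xi> = \<xi> \<bullet> D \<xi> - 2 * x * (K \<xi> \<bullet> D \<xi>) + x\<^sup>2 * (norm (G (uh (D \<xi>))))\<^sup>2"
proof -
  \<comment> \<open>The shift 0 and the constant \<open>sqrt e2\<close> are arbitrary admissible
    values; only the identities for the new defect are taken from this instance.\<close>
  interpret tv: test_vector G u uh us uhs x l "sqrt e2" d 0 \<xi>
    by unfold_locales (use d_eq D_le norm_D us_gam0 e2_l xl in auto)
  show ?thesis using tv.Dp_inner by (simp add: tv.Dp_eq Dn_def tv.\<eta>_def)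
qed

lemma K_pos: "0 \<le> \<xi> \<bullet> K \<xi>" "\<xi> \<bullet> K \<xi> = (gam (uh \<xi>))\<^sup>2"
  by (simp_all add: K_def uh_adj[symmetric] gam_sq G_pos)

lemma K_le: "\<xi> \<bullet> K \<xi> \<le> l * (\<xi> \<bullet> \<xi>)"
  using G_le[of "uh \<xi>"] u_le[of \<xi>] by (simp add: K_pos gam_sq gram_inner)

lemma norm_K: "(norm (K \<xi>))\<^sup>2 \<le> l * (\<xi> \<bullet> K \<xi>)"
proof -
  have "norm (K \<xi>) \<le> L * gam (uh \<xi>)" unfolding K_def
    by (rule order_trans[OF norm_uhs mult_left_mono[OF norm_G_le_gam L_nonneg]])
  then have "(norm (K \<xi>))\<^sup>2 \<le> (L * gam (uh \<xi>))\<^sup>2" by (intro power_mono) auto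
  also have "\<dots> = l * (gam (uh \<xi>))\<^sup>2" using L_sq by (simp add: power_mult_distrib) (simp add: power2_eq_square)
  finally show ?thesis by (simp add: K_pos)
qed

lemma K_amgm: "2 * (K \<xi> \<bullet> \<zeta>) \<le> t * (\<xi> \<bullet> K \<xi>) + (\<zeta> \<bullet> K \<zeta>) / t" if t: "0 < t"
proof -
  have "0 \<le> (t *\<^sub>R \<xi> - \<zeta>) \<bullet> K (t *\<^sub>R \<xi> - \<zeta>)" by (rule K_pos)
  also have "\<dots> = t\<^sup>2 * (\<xi> \<bullet> K \<xi>) - 2 * t * (K \<xi> \<bullet> \<zeta>) + \<zeta> \<bullet> K \<zeta>"
  proof -
    have "\<xi> \<bullet> K \<zeta> = K \<xi> \<bullet> \<zeta>" by (simp only: K_sym)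
    moreover have "\<zeta> \<bullet> K \<xi> = K \<xi> \<bullet> \<zeta>" by (rule inner_commute)
    ultimately show ?thesis by (simp add: lin inner_diff_left inner_diff_right power2_eq_square algebra_simps)
  qed
  finally have "2 * t * (K \<xi> \<bullet> \<zeta>) \<le> t * (t * (\<xi> \<bullet> K \<xi>) + (\<zeta> \<bullet> K \<zeta>) / t)" using t by (simp add: power2_eq_square distrib_left)
  then have "t * (2 * (K \<xi> \<bullet> \<zeta>)) \<le> t * (t * (\<xi> \<bullet> K \<xi>) + (\<zeta> \<bullet> K \<zeta>) / t)" by (simp add: mult_ac)
  then show ?thesis using t by (rule mult_left_le_imp_le)
qed

lemma norm_GuhD: "(norm (G (uh \<xi>)))\<^sup>2 \<le> \<xi> \<bullet> K \<xi>"
  using norm_G_le_gam[of "uh \<xi>"] by (simp add: K_pos power_mono)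

text \<open>With C = d - D \<ge> 0, the cross term supplies 2 x d (\<xi>, K \<xi>). Half of it pays
  for the mixed term in K and C, by \<open>K_amgm\<close> with weight d and C^2 \<le> 2 d C; what is
  left covers the quadratic term.\<close>

lemma upper_next: "\<xi> \<bullet> Dn \<xi> \<le> d * (\<xi> \<bullet> \<xi>)"
proof (cases "d = 0")
  case True
  then have "D \<xi> = 0" "D (K \<xi>) = 0" using norm_D by force+
  then have "Dn \<xi> = 0" by (simp add: Dn_def lin)
  then show ?thesis using True by simp
next
  case False
  then have dp: "0 < d" using d0 by simp
  define C where "C \<zeta> = d *\<^sub>R \<zeta> - D \<zeta>" for \<zeta>
  have Dx: "D \<xi> = d *\<^sub>R \<xi> - C \<xi>" by (simp add: C_def)
  let ?k = "\<xi> \<bullet> K \<xi>" and ?c = "\<xi> \<bullet> C \<xi>"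
  have lC: "linear C" unfolding C_def by (rule linearI) (simp_all add: lin algebra_simps)
  have C_sym: "C v \<bullet> w = v \<bullet> C w" for v w by (simp add: C_def inner_diff_left inner_diff_right D_sym)
  have C0: "0 \<le> v \<bullet> C v" for v using D_le[of v] by (simp add: C_def inner_diff_right)
  have C2: "v \<bullet> C v \<le> 2 * d * (v \<bullet> v)" for v
    using D_ge[of v] mult_right_mono[OF eps_le(2) inner_ge_zero[of v]] by (simp add: C_def inner_diff_right)
  have CC: "C \<xi> \<bullet> C \<xi> \<le> 2 * d * ?c"
    by (rule psd_square_le[OF lC C_sym C0 C2]) (use d0 in simp)
  have CK: "C \<xi> \<bullet> K (C \<xi>) \<le> 2 * (l * (d * ?c))"
  proof -
    have "l * (C \<xi> \<bullet> C \<xi>) \<le> l * (2 * d * ?c)" using CC l_ge by (intro mult_left_mono) auto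
    moreover have "l * (2 * d * ?c) = 2 * (l * (d * ?c))" by simp
    ultimately show ?thesis using K_le[of "C \<xi>"] by linarith
  qed
  have i1: "2 * (K \<xi> \<bullet> C \<xi>) \<le> d * ?k + 2 * (l * ?c)"
  proof -
    have "(C \<xi> \<bullet> K (C \<xi>)) / d \<le> 2 * (l * ?c)" using CK dp by (simp add: pos_divide_le_eq mult_ac)
    then show ?thesis using K_amgm[OF dp, of \<xi> "C \<xi>"] by linarith
  qed
  have i2: "D \<xi> \<bullet> K (D \<xi>) \<le> 2 * (d\<^sup>2 * ?k) + 4 * (l * (d * ?c))"
  proof -
    have "(v - w) \<bullet> K (v - w) \<le> 2 * (v \<bullet> K v) + 2 * (w \<bullet> K w)" for v w
      using K_pos(1)[of "v + w"] by (simp add: linear_add[OF linears(7)] linear_diff[OF linears(7)]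
          inner_diff_left inner_diff_right inner_add_left inner_add_right)
    from this[of "d *\<^sub>R \<xi>" "C \<xi>"] show ?thesis using CK by (simp add: Dx lin power2_eq_square mult_ac)
  qed
  have "d * (\<xi> \<bullet> \<xi>) - \<xi> \<bullet> Dn \<xi> = ?c + 2 * x * (K \<xi> \<bullet> D \<xi>) - x\<^sup>2 * (norm (G (uh (D \<xi>))))\<^sup>2"
    by (simp add: Dn_inner C_def inner_diff_right)
  moreover have "K \<xi> \<bullet> D \<xi> = d * ?k - K \<xi> \<bullet> C \<xi>" by (simp add: Dx inner_diff_right inner_commute)
  moreover have "x\<^sup>2 * (norm (G (uh (D \<xi>))))\<^sup>2 \<le> x\<^sup>2 * (2 * (d\<^sup>2 * ?k) + 4 * (l * (d * ?c)))"
    using norm_GuhD[of "D \<xi>"] i2 by (intro mult_left_mono) auto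
  moreover have "x * (2 * (K \<xi> \<bullet> C \<xi>)) \<le> x * (d * ?k + 2 * (l * ?c))" using i1 x_pos by (intro mult_left_mono) auto
  ultimately have "d * (\<xi> \<bullet> \<xi>) - \<xi> \<bullet> Dn \<xi> \<ge> ?c + x * (d * ?k) - x * (2 * (l * ?c)) - x\<^sup>2 * (2 * (d\<^sup>2 * ?k) + 4 * (l * (d * ?c)))"
    by (simp add: algebra_simps)
  moreover have "?c + x * (d * ?k) - x * (2 * (l * ?c)) - x\<^sup>2 * (2 * (d\<^sup>2 * ?k) + 4 * (l * (d * ?c)))
      = ?c * (1 - 2 * (x * l) - 4 * ((x * l) * (x * d))) + ?k * ((x * d) * (1 - 2 * (x * d)))"
    by (simp add: power2_eq_square algebra_simps)
  moreover have "0 \<le> ?c * (1 - 2 * (x * l) - 4 * ((x * l) * (x * d)))"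
  proof (intro mult_nonneg_nonneg C0)
    have "(x * l) * (12 * (x * d)) \<le> (x * l) * 1" using xl by (intro mult_left_mono) auto
    then have "12 * ((x * l) * (x * d)) \<le> x * l" by simp
    then show "0 \<le> 1 - 2 * (x * l) - 4 * ((x * l) * (x * d))" using xl(1) by linarith
  qed
  moreover have "0 \<le> ?k * ((x * d) * (1 - 2 * (x * d)))" 
    by (rule mult_nonneg_nonneg[OF K_pos(1) mult_nonneg_nonneg[OF xl(6)]]) (use xl in linarith)
  ultimately show ?thesis by linarith
qed

lemma un_linear: "linear un" by (rule linearI) (simp_all add: un_def lin algebra_simps)

lemma un_in: "un \<xi> \<in> H" by (simp add: un_def H_closed in_H)

lemma un_inner: "un \<xi> \<bullet> un \<zeta> = \<xi> \<bullet> \<zeta> + \<xi> \<bullet> Dn \<zeta>"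
proof -
  interpret tv: test_vector G u uh us uhs x l "sqrt e2" d 0 \<xi>
    by unfold_locales (use d_eq D_le norm_D us_gam0 e2_l xl in auto)
  have "un \<xi> \<bullet> v = \<xi> \<bullet> tv.ups v" for v
    by (simp add: un_def tv.ups_def inner_diff_left inner_diff_right uh_adj G_sym D_sym)
  then have "un \<xi> \<bullet> un \<zeta> = \<xi> \<bullet> (tv.Dp \<zeta> + \<zeta>)" by (simp add: tv.Dp_def tv.up_def un_def)
  then show ?thesis by (simp add: tv.Dp_eq Dn_def inner_add_right)
qed

lemma stage2: "ea uh - ea un \<ge> 2 * x * (trD + (1 - x * l / 2) * trDD)"
proof -
  have "a (uh b) (uh b) - a (un b) (un b) \<ge> 2 * x * (b \<bullet> D b + (1 - x * l / 2) * (D b \<bullet> D b))" for b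
  proof -
    have "a (un b) (un b) = a (uh b) (uh b) - 2 * x * (uh (D b) \<bullet> uh b) + x\<^sup>2 * (D b \<bullet> K (D b))"
      by (simp add: un_def a_lin in_H H_closed a_G a_G2 K_def uh_adj[symmetric] power2_eq_square algebra_simps)
    also have "uh (D b) \<bullet> uh b = b \<bullet> D b + D b \<bullet> D b"
    proof -
      have "us (u b) = b + D b" by (simp add: D_def)
      then have "uh (D b) \<bullet> uh b = D b \<bullet> (b + D b)" by (simp only: gram_inner u_adj)
      then show ?thesis by (simp add: inner_add_right inner_commute[of "D b" b])
    qed
    finally have "a (uh b) (uh b) - a (un b) (un b) = 2 * x * (b \<bullet> D b + D b \<bullet> D b) - x\<^sup>2 * (D b \<bullet> K (D b))" by simp
    moreover have "x\<^sup>2 * (D b \<bullet> K (D b)) \<le> x\<^sup>2 * (l * (D b \<bullet> D b))" using K_le by (intro mult_left_mono) auto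
    ultimately show ?thesis by (simp add: power2_eq_square algebra_simps)
  qed
  then have "(\<Sum>b\<in>Basis. 2 * x * (b \<bullet> D b + (1 - x * l / 2) * (D b \<bullet> D b))) \<le> (\<Sum>b\<in>Basis. a (uh b) (uh b) - a (un b) (un b))"
    by (auto intro!: sum_mono)
  moreover have "(\<Sum>b\<in>Basis. 2 * x * (b \<bullet> D b + (1 - x * l / 2) * (D b \<bullet> D b))) = 2 * x * (trD + (1 - x * l / 2) * trDD)"
    unfolding trD_def trDD_def by (simp only: sum_distrib_left[symmetric] sum.distrib)
  ultimately show ?thesis by (simp only: ea_def sum_subtractf)
qed

section \<open>Energy drop of the full step\<close>

lemma total_drop: "ea u - ea un \<ge> 2 * x * ((1 - x * k0) * D0 - 31/32 * x * ea W + (trD + (1 - x * l / 2) * trDD))"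
proof -
  have "ea u - ea uh \<ge> 2 * x * ((1 - x * k0) * D0 - 31/32 * x * ea W)"
    by (rule stage1_drop[OF e2 e2_l(2) k0_def]) (use xk0 xl in \<open>simp_all add: k0_def mult.assoc\<close>)
  with stage2 show ?thesis unfolding distrib_left by linarith
qed

lemma k0_ge: "1 \<le> k0" "k0 * k0 = l * e2" "x * k0 \<le> 1/2"
proof -
  have "1 * 1 \<le> l * e2" using l_ge e2_l by (intro mult_mono) auto
  then show "1 \<le> k0" by (simp add: k0_def)
  show "k0 * k0 = l * e2" using l_ge e2_l by (simp add: k0_def)
  show "x * k0 \<le> 1/2" using xk0 by (simp add: k0_def)
qed

lemma decay_weak:
  assumes pos: "0 \<le> trD + (1 - x * l / 2) * trDD" and ce: "sqrt (real DIM('e)) * e2 * l + 1/2 \<le> ce"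
  shows "ea u - ea un \<ge> 2 * x * ((1 / (2 * l) - ce * x) * ea W)"
proof -
  have W0: "0 \<le> ea W" by (intro ea_pos in_H)
  have "ea W / (2 * l) \<le> D0" using D0_weak l_ge by (simp add: pos_divide_le_eq mult_ac)
  then have "(1 - x * k0) * (ea W / (2 * l)) \<le> (1 - x * k0) * D0" using k0_ge by (intro mult_left_mono) auto
  moreover have "k0 / (2 * l) + 31/32 \<le> ce"
  proof -
    have "k0 / (2 * l) \<le> k0 / 2" using l_ge k0_ge by (intro divide_left_mono) auto
    moreover have "k0 \<le> k0 * k0" using k0_ge mult_left_mono[of 1 k0 k0] by simp
    moreover have "1 * (k0 * k0) \<le> sqrt (real DIM('e)) * (k0 * k0)" using dim_ge k0_ge(1) by (intro mult_right_mono) auto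
    moreover have "sqrt (real DIM('e)) * (k0 * k0) = sqrt (real DIM('e)) * e2 * l" by (simp add: k0_ge(2))
    ultimately show ?thesis using ce k0_ge(1) by linarith
  qed
  then have "(x * (k0 / (2 * l) + 31/32)) * ea W \<le> (x * ce) * ea W"
    using W0 x_pos by (intro mult_right_mono mult_left_mono) auto
  moreover have "(1 - x * k0) * (ea W / (2 * l)) = ea W / (2 * l) - (x * (k0 / (2 * l))) * ea W"
    using l_ge by (simp add: field_simps)
  moreover have "(1 / (2 * l) - ce * x) * ea W = ea W / (2 * l) - (x * ce) * ea W"
    using l_ge by (simp add: field_simps)
  ultimately have "(1 / (2 * l) - ce * x) * ea W \<le> (1 - x * k0) * D0 - 31/32 * x * ea W + (trD + (1 - x * l / 2) * trDD)"
    using pos unfolding distrib_left distrib_right by linarith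
  then have "2 * x * ((1 / (2 * l) - ce * x) * ea W) \<le> 2 * x * ((1 - x * k0) * D0 - 31/32 * x * ea W + (trD + (1 - x * l / 2) * trDD))"
    using x_pos by (intro mult_left_mono) auto
  then show ?thesis using total_drop by linarith
qed

text \<open>Sets the slack of the skew estimate against a negative trace of D. The current bound
  \<open>s\<close> may be smaller than \<open>l\<close>; this matters because the slack has to be
  compared with the invariant, whose constant is small only relative to 1 / s.\<close>

lemma decay_strong:
  assumes s: "1 \<le> s" "s \<le> l" "\<And>\<xi>. u \<xi> \<bullet> u \<xi> \<le> s * (\<xi> \<bullet> \<xi>)" and N: "2 \<le> real DIM('e)"
    and pos: "- ((s * (\<Sum>b\<in>Basis. W b \<bullet> W b) - (\<Sum>b\<in>Basis. (norm (us (W b)))\<^sup>2)) / (2 * s\<^sup>2)) \<le> trD + (1 - x * l / 2) * trDD"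
    and ce: "sqrt (real DIM('e)) * e2 * l + 1/2 \<le> ce"
  shows "ea u - ea un \<ge> 2 * x * ((1 / (2 * l) - ce * x) * ea W)"
proof -
  define NN where "NN = s * (\<Sum>b\<in>Basis. W b \<bullet> W b) - (\<Sum>b\<in>Basis. (norm (us (W b)))\<^sup>2)"
  define C2 where "C2 = (\<Sum>b\<in>Basis. (norm (us (W b)))\<^sup>2)"
  have s0: "0 < s" using s by linarith
  have W0: "0 \<le> ea W" by (intro ea_pos in_H)
  have NN_le: "NN \<le> s * ea W - C2" using usW_le(2)[OF s(3)] s0 by (simp add: NN_def C2_def)
  have C20: "0 \<le> C2" by (simp add: C2_def sum_nonneg)
  have "2 * ea W \<le> 2 * s * D0 + C2 / s" using D0_bound[OF s(3)] by (simp add: C2_def)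
  moreover have "ea W + NN / s \<le> 2 * ea W - C2 / s"
  proof -
    have "(NN + C2) / s \<le> ea W" using NN_le s0 by (simp add: pos_divide_le_eq mult.commute)
    then show ?thesis unfolding add_divide_distrib by linarith
  qed
  ultimately have "ea W + NN / s \<le> 2 * s * D0" by linarith
  then have "(ea W + NN / s) / (2 * s) \<le> D0" using s0 by (simp add: pos_divide_le_eq mult_ac)
  then have D0': "ea W / (2 * s) + NN / (2 * s\<^sup>2) \<le> D0"
    using s0 by (simp add: add_divide_distrib power2_eq_square mult_ac)
  have NNs: "NN / (2 * s\<^sup>2) \<le> ea W / (2 * s)"
    using NN_le C20 s0 by (simp add: field_simps power2_eq_square)
  have "(1 - x * k0) * (ea W / (2 * s) + NN / (2 * s\<^sup>2)) \<le> (1 - x * k0) * D0" using D0' k0_ge by (intro mult_left_mono) auto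
  moreover have "(1 - x * k0) * (ea W / (2 * s) + NN / (2 * s\<^sup>2))
      = ea W / (2 * s) + NN / (2 * s\<^sup>2) - (x * k0) * (ea W / (2 * s) + NN / (2 * s\<^sup>2))" by (simp add: left_diff_distrib)
  moreover have "(x * k0) * (ea W / (2 * s) + NN / (2 * s\<^sup>2)) \<le> (x * k0) * (ea W / s)"
    using NNs k0_ge x_pos by (intro mult_left_mono) auto
  moreover have "ea W / (2 * l) \<le> ea W / (2 * s)" using s s0 W0 by (intro divide_left_mono) auto
  moreover have "(x * k0) * (ea W / s) + 31/32 * x * ea W \<le> (x * ce) * ea W"
  proof -
    have "k0 / s \<le> k0 / 1" using s k0_ge by (intro divide_left_mono) auto
    moreover have "k0 + 31/32 \<le> ce"
    proof -
      have sN: "707/500 \<le> sqrt (real DIM('e))" by (rule real_le_rsqrt) (use N in \<open>simp add: power2_eq_square\<close>)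
      have "1 * 2 \<le> l * e2" using l_ge e2_ge N by (intro mult_mono) auto
      then have kk: "2 \<le> k0 * k0" using k0_ge by simp
      \<comment> \<open>From l \<ge> 1 and e2 \<ge> 2; 7/5 is a rational number below sqrt
        2.\<close>
      have "7/5 \<le> k0"
      proof (rule ccontr)
        assume "\<not> 7/5 \<le> k0"
        then have "k0 * k0 \<le> 7/5 * (7/5)" using k0_ge by (intro mult_mono) auto
        then show False using kk by simp
      qed
      then have "7/5 * k0 \<le> k0 * k0" using k0_ge by (intro mult_right_mono) auto
      moreover have "707/500 * (k0 * k0) \<le> sqrt (real DIM('e)) * (k0 * k0)" using sN k0_ge(1) by (intro mult_right_mono) auto
      moreover have "sqrt (real DIM('e)) * (k0 * k0) = sqrt (real DIM('e)) * e2 * l" by (simp add: k0_ge(2))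
      ultimately show ?thesis using ce k0_ge(1) by linarith
    qed
    ultimately have "k0 / s + 31/32 \<le> ce" by linarith
    then have "(x * (k0 / s + 31/32)) * ea W \<le> (x * ce) * ea W"
      using W0 x_pos by (intro mult_right_mono mult_left_mono) auto
    then show ?thesis by (simp add: algebra_simps)
  qed
  moreover have "(1 / (2 * l) - ce * x) * ea W = ea W / (2 * l) - (x * ce) * ea W"
    using l_ge by (simp add: field_simps)
  moreover have "- (NN / (2 * s\<^sup>2)) \<le> trD + (1 - x * l / 2) * trDD" using pos by (simp only: NN_def)
  ultimately have "(1 / (2 * l) - ce * x) * ea W \<le> (1 - x * k0) * D0 - 31/32 * x * ea W + (trD + (1 - x * l / 2) * trDD)"
    by linarith
  then have "2 * x * ((1 / (2 * l) - ce * x) * ea W) \<le> 2 * x * ((1 - x * k0) * D0 - 31/32 * x * ea W + (trD + (1 - x * l / 2) * trDD))"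
    using x_pos by (intro mult_left_mono) auto
  then show ?thesis using total_drop by linarith
qed

end

section \<open>The invariant after one step and the trace bounds drawn from it\<close>

context scheme_step
begin

definition inv_F :: "real \<Rightarrow> bool" where
  "inv_F c \<longleftrightarrow> (\<forall>\<phi> \<mu>. 0 \<le> \<mu> \<longrightarrow> \<mu> \<le> 1 \<longrightarrow>
    0 \<le> d * (\<phi> \<bullet> D \<phi>) - (norm (D \<phi>))\<^sup>2 + d * c * (norm (sh \<mu> (u \<phi>)))\<^sup>2)"

lemma trDD_nonneg: "0 \<le> trDD" by (simp add: trDD_def sum_nonneg)

lemma decay_dim1:
  assumes pos: "\<And>\<xi>. 0 \<le> \<xi> \<bullet> D \<xi>" and ce: "sqrt (real DIM('e)) * e2 * l + 1/2 \<le> ce"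
  shows "ea u - ea un \<ge> 2 * x * ((1 / (2 * l) - ce * x) * ea W)"
proof (rule decay_weak[OF _ ce])
  have "0 \<le> trD" using pos by (simp add: trD_def sum_nonneg)
  moreover have "0 \<le> (1 - x * l / 2) * trDD" using trDD_nonneg xl by (intro mult_nonneg_nonneg) auto
  ultimately show "0 \<le> trD + (1 - x * l / 2) * trDD" by linarith
qed

text \<open>In dimension one K is a scalar and commutes with D, so the sign of the defect survives
  and no substitute for it is required.\<close>

lemma nonneg_next_dim1:
  assumes dim: "DIM('e) = 1" and pos: "\<And>\<xi>. 0 \<le> \<xi> \<bullet> D \<xi>"
  shows "0 \<le> \<xi> \<bullet> Dn \<xi>"
proof -
  obtain b :: 'e where b: "Basis = {b}" using dim by (metis card_1_singletonE)
  have "(v \<bullet> b) *\<^sub>R b = v" for v using euclidean_representation[of v] by (simp add: b)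
  note rep = this[symmetric]
  define \<kappa> where "\<kappa> = b \<bullet> K b"
  have Kb: "K b = \<kappa> *\<^sub>R b" using rep[of "K b"] by (simp add: \<kappa>_def inner_commute)
  have "K \<xi> = (\<xi> \<bullet> b) *\<^sub>R K b" by (subst rep[of \<xi>]) (simp only: lin)
  also have "\<dots> = \<kappa> *\<^sub>R \<xi>" by (simp add: Kb) (metis rep scaleR_scaleR mult.commute)
  finally have K\<xi>: "K \<xi> = \<kappa> *\<^sub>R \<xi>" .
  have "b \<in> Basis" by (simp add: b)
  then have bb: "b \<bullet> b = 1" by (rule inner_same_Basis)
  have "x * \<kappa> \<le> x * l" using K_le[of b] bb x_pos by (intro mult_left_mono) (auto simp: \<kappa>_def)
  then have "0 \<le> 1 - 2 * (x * \<kappa>)" using xl by linarith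
  then have "0 \<le> (1 - 2 * (x * \<kappa>)) * (\<xi> \<bullet> D \<xi>)" using pos by simp
  moreover have "\<xi> \<bullet> Dn \<xi> = (1 - 2 * (x * \<kappa>)) * (\<xi> \<bullet> D \<xi>) + x\<^sup>2 * (norm (G (uh (D \<xi>))))\<^sup>2"
    by (simp add: Dn_inner K\<xi> algebra_simps)
  ultimately show ?thesis by simp
qed

context
  assumes N2: "2 \<le> real DIM('e)"
begin

lemma sN: "707/500 \<le> sqrt (real DIM('e))"
  by (rule real_le_rsqrt) (use N2 in \<open>simp add: power2_eq_square\<close>)

lemma xl_sharp: "(x * l) * (707/250 * (l * l) + 707/250 * l + 1) \<le> 1"
proof -
  have "707/500 * (l + 1) \<le> sqrt (real DIM('e)) * e2" using sN e2_ge N2 l_ge by (intro mult_mono) auto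
  then have "707/500 * (l + 1) * (2 * l\<^sup>2) \<le> sqrt (real DIM('e)) * e2 * (2 * l\<^sup>2)" by (intro mult_right_mono) auto
  then have "x * (707/500 * (l + 1) * (2 * l\<^sup>2) + l) \<le> x * (sqrt (real DIM('e)) * e2 * (2 * l\<^sup>2) + l)"
    using x_pos by (intro mult_left_mono) auto
  also have "\<dots> \<le> 1" using x_le by (simp add: mult_ac)
  finally have 1: "x * (707/500 * (l + 1) * (2 * l\<^sup>2) + l) \<le> 1" .
  have 2: "x * (707/500 * (l + 1) * (2 * l\<^sup>2) + l) = (x * l) * (707/250 * (l * l) + 707/250 * l + 1)" by algebra
  show ?thesis unfolding 2[symmetric] by (rule 1)
qed

lemma xl6: "6 * (x * l) \<le> 1"
proof -
  have "1 * 1 \<le> l * l" using l_ge by (intro mult_mono) auto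
  then have "(x * l) * 6 \<le> (x * l) * (707/250 * (l * l) + 707/250 * l + 1)"
    using xl l_ge by (intro mult_left_mono) auto
  then show ?thesis using xl_sharp by linarith
qed

text \<open>The condition under which \<open>lower_next\<close> reproduces its own bound. For small
  d both tolerances coincide; otherwise the sharp bound on x l, which decays like l^(-3) times l up
  to constants, beats the linear growth of d.\<close>

lemma eps_step: "(x * l) * (\<epsilon> + d) \<le> 2 * \<epsilon>"
proof (cases "d \<le> 7/200")
  case True
  then have "\<epsilon> = d" using eps by simp
  moreover have "(x * l) * (2 * d) \<le> 1 * (2 * d)" using xl d0 by (intro mult_right_mono) auto
  ultimately show ?thesis by simp
next
  case False
  then have e: "\<epsilon> = 7/200" using eps by simp
  \<comment> \<open>The centre 203/100 is close to the minimiser of the difference of the two sides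
    below.\<close>
  have "0 \<le> (l - 203/100)\<^sup>2" by simp
  then have "\<epsilon> + d \<le> 7/100 * (707/250 * (l * l) + 707/250 * l + 1)"
    using l_ge by (simp add: e d_eq power2_eq_square field_simps)
  then have "(x * l) * (\<epsilon> + d) \<le> (x * l) * (7/100 * (707/250 * (l * l) + 707/250 * l + 1))"
    using xl by (intro mult_left_mono) auto
  also have "\<dots> = 7/100 * ((x * l) * (707/250 * (l * l) + 707/250 * l + 1))" by simp
  also have "\<dots> \<le> 7/100 * 1" by (rule mult_left_mono[OF xl_sharp]) simp
  also have "\<dots> = 2 * \<epsilon>" by (simp add: e)
  finally show ?thesis .
qed

text \<open>With \<psi> = \<xi> - x K \<xi> as test vector, the expected value (\<psi>, D \<psi>)
  differs from the new form only at second order. The bound -\<epsilon> |\<psi>|^2 has shrunk by 2 x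
  \<epsilon> (\<xi>, K \<xi>), which pays for that difference by \<open>eps_step\<close>.\<close>

lemma lower_next: "- \<epsilon> * (\<xi> \<bullet> \<xi>) \<le> \<xi> \<bullet> Dn \<xi>"
proof -
  define \<psi> where "\<psi> = \<xi> - x *\<^sub>R K \<xi>"
  let ?k = "\<xi> \<bullet> K \<xi>" and ?n = "(norm (K \<xi>))\<^sup>2"
  have "\<psi> \<bullet> D \<psi> = \<xi> \<bullet> D \<xi> - 2 * x * (K \<xi> \<bullet> D \<xi>) + x\<^sup>2 * (K \<xi> \<bullet> D (K \<xi>))"
  proof -
    have "\<xi> \<bullet> D (K \<xi>) = K \<xi> \<bullet> D \<xi>" by (metis D_sym inner_commute)
    then show ?thesis
      by (simp add: \<psi>_def linear_diff[OF linears(6)] linear_scale[OF linears(6)] inner_diff_left inner_diff_right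
          power2_eq_square algebra_simps)
  qed
  moreover have "- (\<epsilon> * (\<psi> \<bullet> \<psi>)) \<le> \<psi> \<bullet> D \<psi>" using D_ge[of \<psi>] by simp
  moreover have pp: "\<psi> \<bullet> \<psi> = \<xi> \<bullet> \<xi> - 2 * x * ?k + x\<^sup>2 * ?n"
    unfolding power2_norm_eq_inner
    by (simp add: \<psi>_def inner_diff_left inner_diff_right inner_commute[of "K \<xi>" \<xi>] power2_eq_square algebra_simps)
  moreover have "\<epsilon> * (\<psi> \<bullet> \<psi>) = \<epsilon> * (\<xi> \<bullet> \<xi>) - 2 * (\<epsilon> * (x * ?k)) + x\<^sup>2 * (\<epsilon> * ?n)"
    unfolding pp by (simp add: algebra_simps)
  moreover have "x\<^sup>2 * ((\<epsilon> + d) * ?n) = x\<^sup>2 * (\<epsilon> * ?n) + x\<^sup>2 * (d * ?n)" by (simp add: distrib_left distrib_right)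
  moreover have "x\<^sup>2 * (K \<xi> \<bullet> D (K \<xi>)) \<le> x\<^sup>2 * (d * ?n)"
    using D_le[of "K \<xi>"] by (intro mult_left_mono) (auto simp: power2_norm_eq_inner)
  moreover have "x\<^sup>2 * ((\<epsilon> + d) * ?n) \<le> 2 * (\<epsilon> * (x * ?k))"
  proof -
    have "x\<^sup>2 * ((\<epsilon> + d) * ?n) \<le> x\<^sup>2 * ((\<epsilon> + d) * (l * ?k))"
      using norm_K[of \<xi>] eps_le d0 by (intro mult_left_mono) auto
    also have "\<dots> = ((x * l) * (\<epsilon> + d)) * (x * ?k)" by (simp add: power2_eq_square)
    also have "\<dots> \<le> (2 * \<epsilon>) * (x * ?k)" using eps_step x_pos K_pos(1)[of \<xi>] by (intro mult_right_mono) auto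
    finally show ?thesis by simp
  qed
  moreover have "0 \<le> x\<^sup>2 * (norm (G (uh (D \<xi>))))\<^sup>2" by simp
  ultimately show ?thesis unfolding Dn_inner mult_minus_left by linarith
qed

text \<open>Gives the hatted tuple the same energy bound, so that its adjoint satisfies the
  \<open>gam\<close> estimate with the same constant.\<close>

lemma ea_uh: "ea uh \<le> e2"
proof -
  have W0: "0 \<le> ea W" by (intro ea_pos in_H)
  have "ea W / (2 * l) \<le> D0" using D0_weak l_ge by (simp add: pos_divide_le_eq mult_ac)
  then have "1/2 * (ea W / (2 * l)) \<le> (1 - x * k0) * D0"
    using k0_ge D0_nonneg W0 l_ge by (intro mult_mono) auto
  moreover have "31/32 * x * ea W \<le> 1/2 * (ea W / (2 * l))"
  proof -
    have "31/32 * x * (4 * l) \<le> 1" using xl6 xl by (simp add: mult_ac)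
    then have "31/32 * x \<le> 1 / (4 * l)" by (rule pos_le_divide_eq[THEN iffD2, rotated]) (use l_ge in simp)
    then have "31/32 * x * ea W \<le> 1 / (4 * l) * ea W" using W0 by (rule mult_right_mono)
    then show ?thesis by simp
  qed
  ultimately have "0 \<le> 2 * x * ((1 - x * k0) * D0 - 31/32 * x * ea W)" using x_pos by (intro mult_nonneg_nonneg) auto
  also have "\<dots> \<le> ea u - ea uh"
    by (rule stage1_drop[OF e2 e2_l(2) k0_def]) (use xk0 xl in \<open>simp_all add: k0_def mult.assoc\<close>)
  finally show ?thesis using e2 by linarith
qed

lemma inv_F_next:
  assumes F: "inv_F c" and c: "c = 2 / (5 * sqrt (real DIM('e)))" and mu: "0 \<le> \<mu>" "\<mu> \<le> 1"
  shows "0 \<le> d * (\<phi> \<bullet> Dn \<phi>) - (norm (Dn \<phi>))\<^sup>2 + d * c * (norm (sh \<mu> (un \<phi>)))\<^sup>2"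
proof -
  \<comment> \<open>This is b^2. The defect bound -7/200 leaves all Gram eigenvalues above 19/20, so
    \<open>form_le_trace\<close> applies with m = 19/20; the missing twentieth is what yields the
    margin l + 1/20 \<le> B for N \<ge> 2.\<close>
  define B where "B = e2 - 19/20 * (real DIM('e) - 1)"
  have Bl: "l + 1/20 \<le> B" using e2_ge N2 by (simp add: B_def field_simps)
  have B0: "0 \<le> B" using Bl l_ge by linarith
  have low: "19/20 * (\<xi> \<bullet> \<xi>) \<le> u \<xi> \<bullet> u \<xi>" for \<xi>
  proof -
    have "u \<xi> \<bullet> u \<xi> = \<xi> \<bullet> \<xi> + \<xi> \<bullet> D \<xi>" by (simp add: u_adj D_def inner_diff_right)
    moreover have "\<epsilon> * (\<xi> \<bullet> \<xi>) \<le> 7/200 * (\<xi> \<bullet> \<xi>)" using eps_le by (intro mult_right_mono) auto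
    ultimately show ?thesis using D_ge[of \<xi>] inner_ge_zero[of \<xi>] unfolding mult_minus_left by linarith
  qed
  have low': "19/20 * (\<xi> \<bullet> \<xi>) \<le> uh \<xi> \<bullet> uh \<xi>" for \<xi> unfolding gram_inner by (rule low)
  have le: "a (f \<xi>) (f \<xi>) \<le> B * (\<xi> \<bullet> \<xi>)"
    if "linear f" "\<And>\<xi>. f \<xi> \<in> H" "\<And>\<xi>. 19/20 * (\<xi> \<bullet> \<xi>) \<le> f \<xi> \<bullet> f \<xi>" "ea f \<le> e2" for f \<xi>
    by (rule order_trans[OF form_le_trace[OF that(1-3)] mult_right_mono]) (use that(4) in \<open>simp_all add: B_def\<close>)
  have usB: "norm (us v) \<le> sqrt B * gam v" for v
    by (rule adj_gam[OF u_in u_adj le[OF u_linear u_in low e2]])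
  have uhsB: "norm (uhs v) \<le> sqrt B * gam v" for v
    by (rule adj_gam[OF uh_in uh_adj le[OF uh_linear uh_in low' ea_uh]])
  interpret tv: test_vector G u uh us uhs x l "sqrt B" d \<mu> \<phi>
    by unfold_locales (use d_eq D_le norm_D usB B0 xl mu in auto)
  have "0 \<le> d * (\<phi> \<bullet> tv.Dp \<phi>) - (norm (tv.Dp \<phi>))\<^sup>2 + d * c * (norm (sh \<mu> (tv.up \<phi>)))\<^sup>2"
  proof (rule tv.invariant_step[OF uhsB _ N2 _ _ xl(3) c])
    show "- (7/200) * (\<xi> \<bullet> \<xi>) \<le> \<xi> \<bullet> D \<xi>" for \<xi>
      using D_ge[of \<xi>] mult_right_mono[OF eps_le(3) inner_ge_zero[of \<xi>]] by simp
    show "x * (2 * sqrt (real DIM('e)) * ((sqrt B)\<^sup>2 + 19/20 * (real DIM('e) - 1)) * l\<^sup>2 + l) \<le> 1"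
      using x_le B0 by (simp add: B_def)
    show "l + 1/20 \<le> (sqrt B)\<^sup>2" using Bl B0 by simp
    show "0 \<le> d * (tv.\<psi> \<bullet> D tv.\<psi>) - (norm (D tv.\<psi>))\<^sup>2 + d * c * (norm (sh \<mu> (u tv.\<psi>)))\<^sup>2"
      using F mu unfolding inv_F_def by blast
  qed
  then show ?thesis by (simp add: tv.Dp_eq tv.up_def Dn_def un_def)
qed

lemma norm_sh_ge: "1 \<le> \<mu> \<Longrightarrow> norm (sh 1 v) \<le> norm (sh \<mu> v)"
proof -
  assume \<mu>: "1 \<le> \<mu>"
  have "(norm (sh \<mu> v))\<^sup>2 - (norm (sh 1 v))\<^sup>2 = (\<mu> - 1) * ((\<mu> + 1) * (v \<bullet> v) - 2 * (v \<bullet> G v))"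
    unfolding power2_norm_eq_inner by (simp add: sh_def inner_diff_left inner_diff_right inner_commute[of "G v" v] algebra_simps)
  moreover have "2 * (v \<bullet> v) \<le> (\<mu> + 1) * (v \<bullet> v)" using \<mu> by (intro mult_right_mono) auto
  then have "0 \<le> (\<mu> - 1) * ((\<mu> + 1) * (v \<bullet> v) - 2 * (v \<bullet> G v))" using \<mu> G_le[of v] by (intro mult_nonneg_nonneg) auto
  ultimately have "(norm (sh 1 v))\<^sup>2 \<le> (norm (sh \<mu> v))\<^sup>2" by linarith
  then show ?thesis by (rule power2_le_imp_le) simp
qed

text \<open>Eigenvalues of \<open>Ko\<close> can exceed 1, but beyond 1, the top of the interval
  containing the spectrum of G, the norm of (G - \<mu>) v only increases with \<mu>.\<close>

lemma inv_F_all: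
  assumes F: "inv_F c" and c: "0 \<le> c" and mu: "0 \<le> \<mu>"
  shows "0 \<le> d * (\<phi> \<bullet> D \<phi>) - (norm (D \<phi>))\<^sup>2 + d * c * (norm (sh \<mu> (u \<phi>)))\<^sup>2"
proof (cases "\<mu> \<le> 1")
  case True then show ?thesis using F mu unfolding inv_F_def by blast
next
  case False
  have "(norm (sh 1 (u \<phi>)))\<^sup>2 \<le> (norm (sh \<mu> (u \<phi>)))\<^sup>2" using False by (intro power_mono norm_sh_ge) auto
  then have "d * c * (norm (sh 1 (u \<phi>)))\<^sup>2 \<le> d * c * (norm (sh \<mu> (u \<phi>)))\<^sup>2" using c d0 by (intro mult_left_mono) auto
  moreover have "0 \<le> d * (\<phi> \<bullet> D \<phi>) - (norm (D \<phi>))\<^sup>2 + d * c * (norm (sh 1 (u \<phi>)))\<^sup>2"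
    using F unfolding inv_F_def by simp
  ultimately show ?thesis by linarith
qed

lemma sum_basis_inner:
  fixes f g :: "'e \<Rightarrow> 'a::real_inner"
  assumes B: "orthonormal B" "span B = UNIV" and f: "linear f" and g: "linear g"
  shows "(\<Sum>b\<in>Basis. f b \<bullet> g b) = (\<Sum>b\<in>B. f b \<bullet> g b)"
  by (rule orthonormal_sum_bilinear[OF orthonormal_Basis B])
    (auto intro!: linearI simp: linear_add[OF f] linear_add[OF g] linear_scale[OF f] linear_scale[OF g] inner_add_left inner_add_right)

text \<open>On an eigenvector b of \<open>Ko\<close>, with \<mu> its eigenvalue, (G - \<mu>) u b
  equals W b - G u D b. The invariant then bounds tr D by the size of W and D, measured in the
  seminorm \<open>nn\<close> that expresses the slack of the dissipation.\<close>

lemma trace_lower_A: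
  assumes F: "inv_F c" and c: "c = 2 / (5 * sqrt (real DIM('e)))" and dp: "0 < d"
    and s: "1 \<le> s" "s \<le> sqrt (real DIM('e))" "\<And>\<xi>. u \<xi> \<bullet> u \<xi> \<le> s * (\<xi> \<bullet> \<xi>)"
  shows "- ((s * (\<Sum>b\<in>Basis. W b \<bullet> W b) - (\<Sum>b\<in>Basis. (norm (us (W b)))\<^sup>2)) / (2 * s\<^sup>2)) - 9/10 * trDD \<le> trD"
proof -
  obtain B k where B: "orthonormal B" "span B = UNIV" "\<And>b. b \<in> B \<Longrightarrow> Ko b = k b *\<^sub>R b"
    using spectral_theorem[OF linears(8) Ko_sym] by metis
  have bb: "b \<bullet> b = 1" if "b \<in> B" for b using that B(1) by (simp add: orthonormal_def norm_eq_1)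
  have kp: "0 \<le> k b" "k b \<le> s" if "b \<in> B" for b
  proof -
    have e: "k b = u b \<bullet> G (u b)" using B(3)[OF that] bb[OF that] by (simp add: u_adj flip: Ko_def)
    show "0 \<le> k b" unfolding e by (rule G_pos)
    show "k b \<le> s" unfolding e using G_le[of "u b"] s(3)[of b] bb[OF that] by simp
  qed
  have c0: "0 \<le> c" and cs: "c * s \<le> 2/5"
  proof -
    show "0 \<le> c" using dim_ge by (simp add: c)
    have "c * s \<le> c * sqrt (real DIM('e))" using \<open>0 \<le> c\<close> s by (intro mult_left_mono) auto
    also have "\<dots> = 2/5" using dim_ge by (simp add: c)
    finally show "c * s \<le> 2/5" .
  qed
  have s0: "0 < s" using s by linarith
  define nn where "nn v = s * (v \<bullet> v) - (norm (us v))\<^sup>2" for v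
  have nn0: "0 \<le> nn v" for v using us_le[OF s(3), of v] s0 by (simp add: nn_def)
  \<comment> \<open>Young's inequality with weights 1 + 1/4 and 1 + 4. Since c s \<le> 2/5, the
    factor 5/4 becomes the available 1/2, and 5 * (1/4) + 1 = 9/4 becomes 9/10.\<close>
  have nnq: "nn (v - w) \<le> 5/4 * nn v + 5 * nn w" for v w
  proof -
    have "0 \<le> nn ((1/2) *\<^sub>R v + 2 *\<^sub>R w)" by (rule nn0)
    also have "\<dots> = 5/4 * nn v + 5 * nn w - nn (v - w)"
      unfolding nn_def power2_norm_eq_inner
      by (simp add: lin inner_add_left inner_add_right inner_diff_left inner_diff_right inner_commute[of w v]
          inner_commute[of "us w" "us v"] algebra_simps)
    finally show ?thesis by linarith
  qed
  define Z where "Z \<xi> = G (u \<xi>) - u (Ko \<xi>)" for \<xi>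
  have ZW: "Z \<xi> = W \<xi> - G (u (D \<xi>))" for \<xi> by (simp add: Z_def W_eq Sg_D lin)
  have usZ: "us (Z \<xi>) = - D (Ko \<xi>)" for \<xi> by (simp add: Z_def lin D_def Ko_def)
  have nG: "nn (G (u \<eta>)) \<le> s\<^sup>2 / 4 * (\<eta> \<bullet> \<eta>)" for \<eta>
  proof -
    have "G (u \<eta>) \<bullet> G (u \<eta>) \<le> \<eta> \<bullet> Ko \<eta>" using G_contr[of "u \<eta>"] by (simp add: u_adj Ko_def)
    then have "s * (G (u \<eta>) \<bullet> G (u \<eta>)) \<le> s * (\<eta> \<bullet> Ko \<eta>)" using s0 by (intro mult_left_mono) auto
    moreover have "0 \<le> (Ko \<eta> - (s/2) *\<^sub>R \<eta>) \<bullet> (Ko \<eta> - (s/2) *\<^sub>R \<eta>)" by simp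
    moreover have "(Ko \<eta> - (s/2) *\<^sub>R \<eta>) \<bullet> (Ko \<eta> - (s/2) *\<^sub>R \<eta>) = Ko \<eta> \<bullet> Ko \<eta> - s * (\<eta> \<bullet> Ko \<eta>) + s\<^sup>2 / 4 * (\<eta> \<bullet> \<eta>)"
      by (simp add: inner_diff_left inner_diff_right inner_commute[of "Ko \<eta>" \<eta>] power2_eq_square field_simps)
    ultimately show ?thesis by (simp add: nn_def power2_norm_eq_inner flip: Ko_def)
  qed
  have pt: "c * (norm (Z b))\<^sup>2 \<le> nn (W b) / (2 * s\<^sup>2) + 9/10 * (D b \<bullet> D b)" if b: "b \<in> B" for b
  proof -
    have "(norm (us (Z b)))\<^sup>2 = (k b)\<^sup>2 * (D b \<bullet> D b)"
      unfolding usZ B(3)[OF b] by (simp add: lin power_mult_distrib power2_norm_eq_inner)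
    also have "\<dots> \<le> s\<^sup>2 * (D b \<bullet> D b)" using kp[OF b] by (intro mult_right_mono power_mono) auto
    finally have 1: "(norm (us (Z b)))\<^sup>2 \<le> s\<^sup>2 * (D b \<bullet> D b)" .
    have "s * (norm (Z b))\<^sup>2 = nn (Z b) + (norm (us (Z b)))\<^sup>2" by (simp add: nn_def power2_norm_eq_inner)
    also have "\<dots> \<le> 5/4 * nn (W b) + 9/4 * (s\<^sup>2 * (D b \<bullet> D b))"
      using nnq[of "W b" "G (u (D b))"] nG[of "D b"] 1 by (simp add: ZW)
    finally have sZ: "s * (norm (Z b))\<^sup>2 \<le> 5/4 * nn (W b) + 9/4 * (s\<^sup>2 * (D b \<bullet> D b))" .
    have "(c * s) * (s * (norm (Z b))\<^sup>2) \<le> 2/5 * (5/4 * nn (W b) + 9/4 * (s\<^sup>2 * (D b \<bullet> D b)))"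
      using cs sZ c0 s0 by (intro mult_mono) auto
    then have "s\<^sup>2 * (c * (norm (Z b))\<^sup>2) \<le> s\<^sup>2 * (nn (W b) / (2 * s\<^sup>2) + 9/10 * (D b \<bullet> D b))"
      using s0 by (simp add: power2_eq_square distrib_left mult_ac)
    then show ?thesis using s0 by (simp add: mult_le_cancel_left_pos)
  qed
  have "(\<Sum>b\<in>B. (norm (D b))\<^sup>2 - d * (c * (norm (Z b))\<^sup>2)) \<le> (\<Sum>b\<in>B. d * (b \<bullet> D b))"
  proof (rule sum_mono)
    fix b assume b: "b \<in> B"
    have "sh (k b) (u b) = Z b" by (simp add: sh_def Z_def B(3)[OF b] lin)
    then show "(norm (D b))\<^sup>2 - d * (c * (norm (Z b))\<^sup>2) \<le> d * (b \<bullet> D b)"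
      using inv_F_all[OF F c0 kp(1)[OF b], of b] by (simp add: mult.assoc)
  qed
  moreover have "(\<Sum>b\<in>B. - (d * (nn (W b) / (2 * s\<^sup>2) + 9/10 * (D b \<bullet> D b)))) \<le> (\<Sum>b\<in>B. (norm (D b))\<^sup>2 - d * (c * (norm (Z b))\<^sup>2))"
  proof (rule sum_mono)
    fix b assume b: "b \<in> B"
    have "d * (c * (norm (Z b))\<^sup>2) \<le> d * (nn (W b) / (2 * s\<^sup>2) + 9/10 * (D b \<bullet> D b))"
      using pt[OF b] dp by (intro mult_left_mono) auto
    then show "- (d * (nn (W b) / (2 * s\<^sup>2) + 9/10 * (D b \<bullet> D b))) \<le> (norm (D b))\<^sup>2 - d * (c * (norm (Z b))\<^sup>2)"
      using zero_le_power2[of "norm (D b)"] by linarith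
  qed
  ultimately have "(\<Sum>b\<in>B. - (d * (nn (W b) / (2 * s\<^sup>2) + 9/10 * (D b \<bullet> D b)))) \<le> (\<Sum>b\<in>B. d * (b \<bullet> D b))" by linarith
  moreover have "(\<Sum>b\<in>B. - (d * (nn (W b) / (2 * s\<^sup>2) + 9/10 * (D b \<bullet> D b))))
      = d * (- ((\<Sum>b\<in>B. nn (W b)) / (2 * s\<^sup>2)) - 9/10 * (\<Sum>b\<in>B. D b \<bullet> D b))"
    by (simp only: sum_negf sum.distrib sum_divide_distrib[symmetric] sum_distrib_left[symmetric]) (simp add: algebra_simps)
  moreover have "(\<Sum>b\<in>B. d * (b \<bullet> D b)) = d * trD"
    unfolding trD_def sum_basis_inner[OF B(1,2) linear_ident linears(6)] by (simp add: sum_distrib_left)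
  moreover have "(\<Sum>b\<in>B. D b \<bullet> D b) = trDD"
    unfolding trDD_def sum_basis_inner[OF B(1,2) linears(6) linears(6)] ..
  moreover have "(\<Sum>b\<in>B. nn (W b)) = s * (\<Sum>b\<in>Basis. W b \<bullet> W b) - (\<Sum>b\<in>Basis. (norm (us (W b)))\<^sup>2)"
  proof -
    have lW: "linear W" unfolding W_def by (rule linearI) (simp_all add: lin)
    have luW: "linear (\<lambda>b. us (W b))" unfolding W_def by (rule linearI) (simp_all add: lin)
    show ?thesis unfolding power2_norm_eq_inner sum_basis_inner[OF B(1,2) lW lW] sum_basis_inner[OF B(1,2) luW luW]
      by (simp add: nn_def sum_subtractf sum_distrib_left power2_norm_eq_inner)
  qed
  ultimately have "d * (- ((s * (\<Sum>b\<in>Basis. W b \<bullet> W b) - (\<Sum>b\<in>Basis. (norm (us (W b)))\<^sup>2)) / (2 * s\<^sup>2)) - 9/10 * trDD) \<le> d * trD"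
    by simp
  then show ?thesis using dp by (rule mult_left_le_imp_le)
qed

text \<open>A Gram eigenvalue above q = sqrt N forces tr D^2 \<ge> (q - 1)^2. The invariant with
  \<mu> = 1/2, where |G - 1/2| is at most 1/2, bounds tr D below by -q/10, which is smaller in
  size.\<close>

lemma trace_lower_B:
  assumes F: "inv_F c" and c: "c = 2 / (5 * sqrt (real DIM('e)))" and dp: "0 < d"
    and \<xi>: "sqrt (real DIM('e)) * (\<xi> \<bullet> \<xi>) < u \<xi> \<bullet> u \<xi>"
  shows "0 \<le> trD + 9/10 * trDD"
proof -
  define q where "q = sqrt (real DIM('e))"
  have q: "707/500 \<le> q" "q * q = real DIM('e)" using sN by (simp_all add: q_def)
  have q0: "0 < q" using q by linarith
  have cq: "c = 2 / (5 * q)" by (simp add: c q_def)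
  have c0: "0 \<le> c" using q0 by (simp add: cq)
  have cN: "c * real DIM('e) = 2/5 * q" unfolding q(2)[symmetric] cq using q0 by simp
  have "(\<Sum>b\<in>Basis. - (d * (c/4 * (u b \<bullet> u b)))) \<le> (\<Sum>b\<in>Basis. d * (b \<bullet> D b))"
  proof (rule sum_mono)
    fix b :: 'e assume "b \<in> Basis"
    have "norm (sh (1/2) (u b)) \<le> 1/2 * norm (u b)" by (rule norm_sh_le) auto
    then have "(norm (sh (1/2) (u b)))\<^sup>2 \<le> (1/2 * norm (u b))\<^sup>2" by (intro power_mono) auto
    then have "(norm (sh (1/2) (u b)))\<^sup>2 \<le> 1/4 * (u b \<bullet> u b)" by (simp add: power2_norm_eq_inner power_mult_distrib power_divide)
    then have "d * c * (norm (sh (1/2) (u b)))\<^sup>2 \<le> d * c * (1/4 * (u b \<bullet> u b))" using c0 d0 by (intro mult_left_mono) auto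
    moreover have "0 \<le> d * (b \<bullet> D b) - (norm (D b))\<^sup>2 + d * c * (norm (sh (1/2) (u b)))\<^sup>2"
      using F unfolding inv_F_def by simp
    moreover have "d * (c/4 * (u b \<bullet> u b)) = d * c * (1/4 * (u b \<bullet> u b))" by simp
    ultimately show "- (d * (c/4 * (u b \<bullet> u b))) \<le> d * (b \<bullet> D b)" using zero_le_power2[of "norm (D b)"] by linarith
  qed
  moreover have "(\<Sum>b\<in>Basis. d * (b \<bullet> D b)) = d * trD" by (simp add: trD_def sum_distrib_left)
  moreover have "(\<Sum>b\<in>Basis. - (d * (c/4 * (u b \<bullet> u b)))) = d * - (c/4 * (real DIM('e) + trD))"
  proof -
    have "(\<Sum>b\<in>Basis. u b \<bullet> u b) = (\<Sum>b\<in>Basis. 1 + b \<bullet> D b)"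
      by (intro sum.cong refl) (simp add: u_adj D_def inner_diff_right inner_same_Basis)
    also have "\<dots> = real DIM('e) + trD" by (simp add: sum.distrib trD_def)
    finally have S: "(\<Sum>b\<in>Basis. u b \<bullet> u b) = real DIM('e) + trD" .
    show ?thesis by (simp only: sum_negf sum_distrib_left[symmetric] S mult_minus_right)
  qed
  ultimately have "d * - (c/4 * (real DIM('e) + trD)) \<le> d * trD" by simp
  then have 1: "- (c/4 * (real DIM('e) + trD)) \<le> trD" using dp by (rule mult_left_le_imp_le)
  have 2: "- (q / 10) \<le> trD"
  proof (cases "0 \<le> trD")
    case True then show ?thesis using q by linarith
  next
    case False
    then have "c/4 * trD \<le> 0" using c0 by (simp add: mult_nonneg_nonpos)
    moreover have "c/4 * (real DIM('e) + trD) = q / 10 + c/4 * trD" using cN by (simp add: distrib_left)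
    ultimately show ?thesis using 1 by linarith
  qed
  have x0: "0 < \<xi> \<bullet> \<xi>" using \<xi> by (cases "\<xi> = 0") (auto simp: lin)
  have DD: "D \<xi> \<bullet> D \<xi> \<le> trDD * (\<xi> \<bullet> \<xi>)"
  proof -
    have lDD: "linear (\<lambda>v. D (D v))" by (rule linearI) (simp_all add: lin)
    have DDe: "v \<bullet> D (D v) = D v \<bullet> D v" for v by (simp only: D_sym)
    have "\<xi> \<bullet> D (D \<xi>) \<le> (\<Sum>b\<in>Basis. b \<bullet> D (D b)) * (\<xi> \<bullet> \<xi>)"
    proof (rule psd_le_trace[OF lDD])
      show "D (D v) \<bullet> w = v \<bullet> D (D w)" for v w by (simp only: D_sym)
      show "0 \<le> v \<bullet> D (D v)" for v unfolding DDe by simp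
    qed
    then show ?thesis by (simp only: trDD_def DDe)
  qed
  have "(q - 1) * (\<xi> \<bullet> \<xi>) \<le> \<xi> \<bullet> D \<xi>" using \<xi> by (simp add: q_def u_adj D_def inner_diff_right left_diff_distrib)
  moreover have q1: "0 \<le> (q - 1) * (\<xi> \<bullet> \<xi>)" using q by (intro mult_nonneg_nonneg) auto
  ultimately have "((q - 1) * (\<xi> \<bullet> \<xi>))\<^sup>2 \<le> (\<xi> \<bullet> D \<xi>)\<^sup>2" by (intro power_mono)
  also have "\<dots> \<le> (\<xi> \<bullet> \<xi>) * (D \<xi> \<bullet> D \<xi>)" by (rule Cauchy_Schwarz_ineq)
  also have "\<dots> \<le> (\<xi> \<bullet> \<xi>) * (trDD * (\<xi> \<bullet> \<xi>))" using DD by (intro mult_left_mono) auto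
  finally have "(\<xi> \<bullet> \<xi>)\<^sup>2 * (q - 1)\<^sup>2 \<le> (\<xi> \<bullet> \<xi>)\<^sup>2 * trDD" by (simp add: power2_eq_square mult_ac)
  then have 3: "(q - 1)\<^sup>2 \<le> trDD" by (rule mult_left_le_imp_le) (use x0 in simp)
  \<comment> \<open>The larger root of 9 (q - 1)^2 = q is (19 + sqrt 37)/18, about 1.394 and just
    below sqrt 2, so N = 2 is the critical case.\<close>
  have "0 \<le> (q - 707/500) * (q - 707/1000)" using q by (intro mult_nonneg_nonneg) auto
  then have "q / 10 \<le> 9/10 * (q - 1)\<^sup>2" using q(1) by (simp add: power2_eq_square field_simps)
  then show ?thesis using 2 3 by linarith
qed

text \<open>Dichotomy at lambda_max = sqrt N for the current Gram matrix: below it c s \<le> 2/5 and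
  the dissipation slack pays, above it tr D^2 pays. The share 9/10 of tr D^2 is available because x
  l \<le> 1/6.\<close>

theorem decay_N2:
  assumes F: "inv_F c" and c: "c = 2 / (5 * sqrt (real DIM('e)))"
    and ce: "sqrt (real DIM('e)) * e2 * l + 1/2 \<le> ce"
  shows "ea u - ea un \<ge> 2 * x * ((1 / (2 * l) - ce * x) * ea W)"
proof -
  have 9: "9/10 * trDD \<le> (1 - x * l / 2) * trDD" 
  proof (rule mult_right_mono)
    show "9/10 \<le> 1 - x * l / 2" using xl6 xl by linarith
  qed (rule trDD_nonneg)
  show ?thesis
  proof (cases "d = 0")
    case True
    then have D0: "D \<xi> = 0" for \<xi> using norm_D[of \<xi>] by simp
    show ?thesis by (rule decay_dim1[OF _ ce]) (simp add: D0)
  next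
    case False
    then have dp: "0 < d" using d0 by simp
    show ?thesis
    proof (cases "\<exists>\<xi>. sqrt (real DIM('e)) * (\<xi> \<bullet> \<xi>) < u \<xi> \<bullet> u \<xi>")
      case True
      then have "0 \<le> trD + 9/10 * trDD" using trace_lower_B[OF F c dp] by blast
      then show ?thesis using 9 by (intro decay_weak[OF _ ce]) linarith
    next
      case False
      define s where "s = min l (sqrt (real DIM('e)))"
      have s: "1 \<le> s" "s \<le> sqrt (real DIM('e))" "s \<le> l" using l_ge dim_ge by (auto simp: s_def)
      have us: "u \<xi> \<bullet> u \<xi> \<le> s * (\<xi> \<bullet> \<xi>)" for \<xi>
        using False u_le[of \<xi>] by (auto simp: s_def min_def not_less)
      show ?thesis using trace_lower_A[OF F c dp s(1,2) us] 9
        by (intro decay_strong[OF s(1,3) us N2 _ ce]) linarith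
    qed
  qed
qed

end

end

section \<open>Tuples as linear maps\<close>

definition syn :: "('n::finite \<Rightarrow> 'v::real_vector) \<Rightarrow> real^'n \<Rightarrow> 'v" where
  "syn U \<xi> = (\<Sum>i\<in>UNIV. (\<xi> $ i) *\<^sub>R U i)"

definition ana :: "('n::finite \<Rightarrow> 'v::real_inner) \<Rightarrow> 'v \<Rightarrow> real^'n" where
  "ana U v = (\<chi> i. U i \<bullet> v)"

lemma syn_linear: "linear (syn U)"
  by (rule linearI) (simp_all add: syn_def scaleR_add_left sum.distrib scaleR_right.sum)

lemma ana_linear: "linear (ana U)"
  by (rule linearI) (simp_all add: ana_def vec_eq_iff inner_add_right)

lemma syn_adj: "syn U \<xi> \<bullet> v = \<xi> \<bullet> ana U v"
  by (simp add: syn_def ana_def inner_sum_left inner_vec_def)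

lemma syn_axis: "syn U (axis i 1) = U i"
  by (simp add: syn_def axis_def if_distrib[of "\<lambda>c. c *\<^sub>R _"] cong: if_cong)

lemma syn_in: "subspace H \<Longrightarrow> (\<And>i. U i \<in> H) \<Longrightarrow> syn U \<xi> \<in> H"
  by (simp add: syn_def subspace_sum subspace_scale)

lemma syn_map: "linear f \<Longrightarrow> syn (\<lambda>i. f (U i)) \<xi> = f (syn U \<xi>)"
  by (simp add: syn_def linear_sum linear_scale)

lemma tmul_syn: "tmul U M j = syn U (\<chi> i. M $ i $ j)"
  by (simp add: tmul_def syn_def)

lemma tmul_gram: "tmul U (gram V W) j = syn U (ana V (W j))"
  by (simp add: tmul_syn gram_def ana_def)

lemma gram_mult: "gram U U *v \<xi> = ana U (syn U \<xi>)"
  by (simp add: gram_def ana_def syn_def vec_eq_iff matrix_vector_mult_def inner_sum_right mult.commute)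

lemma A_op_syn:
  assumes "linear G"
  shows "A_op G U V j = G (syn U (ana U (V j))) - syn U (ana U (G (V j)))"
  unfolding A_op_def tmul_gram tG_def by (simp add: syn_map[OF assms])

lemma sum_Basis_vec: "(\<Sum>b\<in>Basis. f b) = (\<Sum>i\<in>UNIV. f (axis i 1))" for f :: "real^'n \<Rightarrow> real"
proof -
  have B: "(Basis :: (real^'n) set) = (\<lambda>i. axis i 1) ` UNIV" unfolding Basis_vec_def by auto
  have "inj (\<lambda>i::'n. axis i (1::real))" by (auto simp: inj_def axis_eq_axis)
  then have "sum f Basis = sum (f \<circ> (\<lambda>i. axis i 1)) UNIV" unfolding B by (rule sum.reindex)
  then show ?thesis by (simp add: o_def)
qed

lemma linear_axis_eq:
  fixes f g :: "real^'n \<Rightarrow> 'v::real_vector"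
  assumes "linear f" "linear g" "\<And>i. f (axis i 1) = g (axis i 1)"
  shows "f = g"
proof (rule linear_eq_stdbasis[OF assms(1,2)])
  fix b :: "real^'n" assume "b \<in> Basis"
  then obtain i where "b = axis i 1" unfolding Basis_vec_def by auto
  then show "f b = g b" using assms(3) by simp
qed

text \<open>The maximum in \<open>lambda_max\<close> is meaningful because every eigenvalue already
  occurs in an orthonormal eigenbasis, so there are finitely many; the variational maximiser attains
  it.\<close>

lemma lambda_max_gram:
  fixes U :: "'n::finite \<Rightarrow> 'v::real_inner"
  shows "\<And>\<xi>. syn U \<xi> \<bullet> syn U \<xi> \<le> lambda_max (gram U U) * (\<xi> \<bullet> \<xi>)"
    and "\<exists>e. norm e = 1 \<and> syn U e \<bullet> syn U e = lambda_max (gram U U)"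
proof -
  let ?f = "\<lambda>\<xi>. ana U (syn U \<xi>)"
  have lin: "linear ?f"
    by (rule linearI) (simp_all add: linear_add[OF syn_linear] linear_add[OF ana_linear]
        linear_scale[OF syn_linear] linear_scale[OF ana_linear])
  have sym: "?f v \<bullet> w = v \<bullet> ?f w" for v w
    by (metis inner_commute syn_adj)
  obtain e lam where e: "norm e = 1" "?f e = lam *\<^sub>R e" "\<And>v. v \<bullet> ?f v \<le> lam * (v \<bullet> v)"
    using quadratic_max_eigenvector[OF lin sym subspace_UNIV, of "axis undefined 1"] by (auto simp: axis_eq_0_iff)
  obtain B k where B: "orthonormal B" "span B = UNIV" "\<And>b. b \<in> B \<Longrightarrow> ?f b = k b *\<^sub>R b"
    using spectral_theorem[OF lin sym] by metis
  let ?E = "{l. \<exists>x::real^'n. x \<noteq> 0 \<and> gram U U *v x = l *\<^sub>R x}"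
  have "?E \<subseteq> k ` B"
  proof
    fix l assume "l \<in> ?E"
    then obtain x where x: "x \<noteq> 0" "?f x = l *\<^sub>R x" by (auto simp: gram_mult)
    have "\<exists>b\<in>B. x \<bullet> b \<noteq> 0"
    proof (rule ccontr)
      assume "\<not> ?thesis"
      then have "x \<bullet> x = 0" by (subst orthonormal_parseval[OF B(1,2)]) simp
      then show False using x by simp
    qed
    then obtain b where b: "b \<in> B" "x \<bullet> b \<noteq> 0" by blast
    have "l * (x \<bullet> b) = k b * (x \<bullet> b)" using sym[of x b] x(2) B(3)[OF b(1)] by simp
    then show "l \<in> k ` B" using b by auto
  qed
  then have fin: "finite ?E" using B(1) finite_subset by (fastforce simp: orthonormal_def)
  have max: "lambda_max (gram U U) = lam"
    unfolding lambda_max_def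
  proof (rule Max_eqI[OF fin])
    fix y assume "y \<in> ?E"
    then obtain x where x: "x \<noteq> 0" "?f x = y *\<^sub>R x" by (auto simp: gram_mult)
    have "y * (x \<bullet> x) \<le> lam * (x \<bullet> x)" using e(3)[of x] x(2) by simp
    then show "y \<le> lam" using x(1) by (simp add: mult_le_cancel_right)
  next
    have "e \<noteq> 0" using e(1) by auto
    then show "lam \<in> ?E" using e(2) by (auto simp: gram_mult)
  qed
  show "syn U \<xi> \<bullet> syn U \<xi> \<le> lambda_max (gram U U) * (\<xi> \<bullet> \<xi>)" for \<xi>
    using e(3)[of \<xi>] by (simp add: max syn_adj)
  show "\<exists>e. norm e = 1 \<and> syn U e \<bullet> syn U e = lambda_max (gram U U)"
    using e(1,2) by (intro exI[of _ e]) (simp add: max syn_adj norm_eq_1)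
qed

text \<open>Inserting the eigenvector for \<open>lam1\<close> into the embedding inequality gives
  the second fact and thereby positivity. The Rayleigh bound then makes \<open>a\<close> definite,
  so the equation defining G has unique solutions and G is linear.\<close>

lemma standing_facts:
  assumes st: "standing H a G c\<Omega> lam1"
  shows "0 < lam1" "1 \<le> c\<Omega>\<^sup>2 * lam1"
    and "energy_space (\<lambda>v. lam1 *\<^sub>R G v) H (\<lambda>v w. a v w / lam1)" and "linear G"
proof -
  have sub: "subspace H" and sym: "\<And>u v. u \<in> H \<Longrightarrow> v \<in> H \<Longrightarrow> a u v = a v u"
    and add: "\<And>u v w. u \<in> H \<Longrightarrow> v \<in> H \<Longrightarrow> w \<in> H \<Longrightarrow> a (u + v) w = a u w + a v w"
    and scl: "\<And>u w c. u \<in> H \<Longrightarrow> w \<in> H \<Longrightarrow> a (c *\<^sub>R u) w = c * a u w"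
    and nn: "\<And>u. u \<in> H \<Longrightarrow> 0 \<le> a u u" and cpos: "0 < c\<Omega>"
    and poin: "\<And>u. u \<in> H \<Longrightarrow> norm u \<le> c\<Omega> * sqrt (a u u)"
    and ray: "\<And>u. u \<in> H \<Longrightarrow> lam1 * (u \<bullet> u) \<le> a u u"
    and GH: "\<And>f. G f \<in> H" and aG: "\<And>f v. v \<in> H \<Longrightarrow> a (G f) v = f \<bullet> v"
    using st unfolding standing_def by blast+
  have "\<exists>e\<in>H. e \<noteq> 0 \<and> (\<forall>v\<in>H. a e v = lam1 * (e \<bullet> v))"
    using st by (simp add: standing_def)
  then obtain e where e: "e \<in> H" "e \<noteq> 0" and ev: "\<forall>v\<in>H. a e v = lam1 * (e \<bullet> v)" by blast
  have ee: "0 < e \<bullet> e" using e(2) by simp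
  have "(norm e)\<^sup>2 \<le> (c\<Omega> * sqrt (a e e))\<^sup>2" using poin[OF e(1)] by (intro power_mono) auto
  then have le: "e \<bullet> e \<le> c\<Omega>\<^sup>2 * lam1 * (e \<bullet> e)"
    using nn[OF e(1)] bspec[OF ev e(1)] by (simp add: power2_norm_eq_inner power_mult_distrib)
  then show one: "1 \<le> c\<Omega>\<^sup>2 * lam1" using ee by simp
  show lam: "0 < lam1"
  proof (rule ccontr)
    assume "\<not> 0 < lam1"
    then have "c\<Omega>\<^sup>2 * lam1 \<le> 0" by (simp add: mult_nonneg_nonpos)
    then show False using one by linarith
  qed
  have uniq: "v = 0" if "v \<in> H" "\<And>w. w \<in> H \<Longrightarrow> a v w = 0" for v
  proof -
    have "lam1 * (v \<bullet> v) \<le> 0" using ray[OF that(1)] that(2)[OF that(1)] by simp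
    then show ?thesis using lam by (metis inner_gt_zero_iff linorder_not_less mult_pos_pos)
  qed
  have diff: "a (u - v) w = a u w - a v w" if "u \<in> H" "v \<in> H" "w \<in> H" for u v w
    using add[of u "(-1) *\<^sub>R v" w] scl[of v w "-1"] subspace_scale[OF sub, of v "-1"] that by simp
  show linG: "linear G"
  proof (rule linearI)
    fix v w :: 'a and c :: real
    have "G (v + w) - (G v + G w) = 0"
      by (rule uniq) (simp_all add: subspace_add subspace_diff sub GH diff add aG inner_add_left)
    then show "G (v + w) = G v + G w" by simp
    have "G (c *\<^sub>R v) - c *\<^sub>R G v = 0"
      by (rule uniq) (simp_all add: subspace_scale subspace_diff sub GH diff scl aG)
    then show "G (c *\<^sub>R v) = c *\<^sub>R G v" by simp
  qed
  have Gsym: "G v \<bullet> w = v \<bullet> G w" for v w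
    by (metis GH aG inner_commute sym)
  show "energy_space (\<lambda>v. lam1 *\<^sub>R G v) H (\<lambda>v w. a v w / lam1)"
  proof (intro energy_space.intro contraction_op.intro energy_space_axioms.intro)
    show "linear (\<lambda>v. lam1 *\<^sub>R G v)"
      by (rule linearI) (simp_all add: linear_add[OF linG] linear_scale[OF linG] scaleR_add_right)
    show "lam1 *\<^sub>R G v \<bullet> w = v \<bullet> lam1 *\<^sub>R G w" for v w by (simp add: Gsym)
    show "lam1 *\<^sub>R G v \<bullet> lam1 *\<^sub>R G v \<le> v \<bullet> lam1 *\<^sub>R G v" for v
    proof -
      have "lam1 * (G v \<bullet> G v) \<le> v \<bullet> G v" using ray[OF GH, of v] aG[OF GH, of v v] by simp
      then show ?thesis using lam by simp
    qed
  qed (use sub sym add scl ray GH aG lam in \<open>auto simp: add_divide_distrib pos_le_divide_eq mult.commute subspace_scale\<close>)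
qed

section \<open>Invariants and energy decay\<close>

definition defect :: "('n::finite \<Rightarrow> 'v::real_inner) \<Rightarrow> real^'n \<Rightarrow> real^'n" where
  "defect U \<xi> = ana U (syn U \<xi>) - \<xi>"

text \<open>The scheme does not preserve nonnegativity of the defect when N is at least 2; the last clause replaces it and says that
  a direction in which the defect is negative cannot be close to an eigenvector of \<open>G\<close>.\<close>

definition invariant ::
  "('v::real_inner \<Rightarrow> 'v) \<Rightarrow> 'v set \<Rightarrow> ('v \<Rightarrow> 'v \<Rightarrow> real) \<Rightarrow> real \<Rightarrow> real \<Rightarrow> ('n::finite \<Rightarrow> 'v) \<Rightarrow> bool" where
  "invariant G H a l e2 U \<longleftrightarrow>
    (\<forall>i. U i \<in> H) \<and> (\<Sum>i\<in>UNIV. a (U i) (U i)) \<le> e2 \<and>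
    (\<forall>\<xi>. \<xi> \<bullet> defect U \<xi> \<le> (l - 1) * (\<xi> \<bullet> \<xi>)) \<and>
    (\<forall>\<xi>. - min (l - 1) (7/200) * (\<xi> \<bullet> \<xi>) \<le> \<xi> \<bullet> defect U \<xi>) \<and>
    (CARD('n) = 1 \<longrightarrow> (\<forall>\<xi>. 0 \<le> \<xi> \<bullet> defect U \<xi>)) \<and>
    (2 \<le> CARD('n) \<longrightarrow> (\<forall>\<phi> \<mu>. 0 \<le> \<mu> \<longrightarrow> \<mu> \<le> 1 \<longrightarrow>
      0 \<le> (l - 1) * (\<phi> \<bullet> defect U \<phi>) - (norm (defect U \<phi>))\<^sup>2
        + (l - 1) * (2 / (5 * sqrt (real CARD('n)))) * (norm (G (syn U \<phi>) - \<mu> *\<^sub>R syn U \<phi>))\<^sup>2))"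

lemma invariant_step:
  fixes U Uh U' :: "'n::finite \<Rightarrow> 'v::real_inner"
  assumes es: "energy_space G H a" and l: "1 \<le> l" and x: "0 < x"
    and e2: "l + real CARD('n) - 1 \<le> e2"
    and x_le: "x * (2 * sqrt (real CARD('n)) * e2 * l\<^sup>2 + l) \<le> 1"
    and ce: "sqrt (real CARD('n)) * e2 * l + 1/2 \<le> ce" and xce: "2 * (ce * x * l) \<le> 1"
    and inv: "invariant G H a l e2 U"
    and mid: "\<And>i. Uh i = U i + x *\<^sub>R A_op G U (\<lambda>k. (1/2) *\<^sub>R (Uh k + U k)) i"
    and upd: "\<And>i. U' i = Uh i - x *\<^sub>R tmul (tG G Uh) (gram Uh Uh - mat 1) i"
  shows "invariant G H a l e2 U'"
    and "(\<Sum>i\<in>UNIV. a (U i) (U i)) - (\<Sum>i\<in>UNIV. a (U' i) (U' i))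
      \<ge> 2 * x * ((1 / (2 * l) - ce * x) * (\<Sum>i\<in>UNIV. a (A_op G U U i) (A_op G U U i)))"
proof -
  interpret es: energy_space G H a by (rule es)
  define c where "c = 2 / (5 * sqrt (real CARD('n)))"
  have UH: "U i \<in> H" for i using inv by (simp add: invariant_def)
  have ea: "(\<Sum>i\<in>UNIV. a (U i) (U i)) \<le> e2" using inv by (simp add: invariant_def)
  have def_le: "\<xi> \<bullet> defect U \<xi> \<le> (l - 1) * (\<xi> \<bullet> \<xi>)" for \<xi> using inv by (simp add: invariant_def)
  have def_ge: "- min (l - 1) (7/200) * (\<xi> \<bullet> \<xi>) \<le> \<xi> \<bullet> defect U \<xi>" for \<xi> using inv unfolding invariant_def by blast
  have linG: "linear G" by (rule es.G_linear)
  note lins = linear_add[OF syn_linear] linear_add[OF ana_linear] linear_add[OF linG]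
    linear_scale[OF syn_linear] linear_scale[OF ana_linear] linear_scale[OF linG]
  have mid': "syn Uh \<xi> = syn U \<xi> + x *\<^sub>R (G (syn U (ana U ((1/2) *\<^sub>R (syn Uh \<xi> + syn U \<xi>))))
      - syn U (ana U (G ((1/2) *\<^sub>R (syn Uh \<xi> + syn U \<xi>)))))" for \<xi>
  proof -
    have "syn Uh = (\<lambda>\<xi>. syn U \<xi> + x *\<^sub>R (G (syn U (ana U ((1/2) *\<^sub>R (syn Uh \<xi> + syn U \<xi>))))
      - syn U (ana U (G ((1/2) *\<^sub>R (syn Uh \<xi> + syn U \<xi>))))))"
    proof (rule linear_axis_eq[OF syn_linear])
      show "linear (\<lambda>\<xi>. syn U \<xi> + x *\<^sub>R (G (syn U (ana U ((1/2) *\<^sub>R (syn Uh \<xi> + syn U \<xi>))))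
        - syn U (ana U (G ((1/2) *\<^sub>R (syn Uh \<xi> + syn U \<xi>))))))"
        by (rule linearI) (simp_all add: lins algebra_simps)
      show "syn Uh (axis i 1) = syn U (axis i 1) + x *\<^sub>R (G (syn U (ana U ((1/2) *\<^sub>R (syn Uh (axis i 1) + syn U (axis i 1)))))
        - syn U (ana U (G ((1/2) *\<^sub>R (syn Uh (axis i 1) + syn U (axis i 1))))))" for i
        unfolding syn_axis using mid[of i] by (simp only: A_op_syn[OF linG])
    qed
    then show ?thesis by (rule fun_cong)
  qed
  have syn_le: "syn U \<xi> \<bullet> syn U \<xi> \<le> l * (\<xi> \<bullet> \<xi>)" for \<xi>
    using def_le[of \<xi>] by (simp add: defect_def syn_adj inner_diff_right left_diff_distrib)
  interpret st: energy_step G "syn U" "syn Uh" "ana U" "ana Uh" x l H a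
  proof (intro energy_step.intro midpoint_stage.intro midpoint_stage_axioms.intro energy_step_axioms.intro
      es.contraction_op_axioms es)
    show "linear (syn U)" "linear (syn Uh)" "linear (ana U)" "linear (ana Uh)"
      by (rule syn_linear ana_linear)+
    show "syn U \<xi> \<bullet> v = \<xi> \<bullet> ana U v" "syn Uh \<xi> \<bullet> v = \<xi> \<bullet> ana Uh v" for \<xi> v
      by (rule syn_adj)+
    show "syn Uh \<xi> = syn U \<xi> + x *\<^sub>R (G (syn U (ana U ((1/2) *\<^sub>R (syn Uh \<xi> + syn U \<xi>))))
      - syn U (ana U (G ((1/2) *\<^sub>R (syn Uh \<xi> + syn U \<xi>)))))" for \<xi> by (rule mid')
    show "syn U \<xi> \<bullet> syn U \<xi> \<le> l * (\<xi> \<bullet> \<xi>)" for \<xi> by (rule syn_le)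
    show "syn U \<xi> \<in> H" for \<xi> by (rule syn_in[OF es.H_sub UH])
  qed (rule x l)+
  have stD: "st.D = defect U" by (rule ext) (simp add: st.D_def defect_def)
  have eaU: "st.ea (syn V) = (\<Sum>i\<in>UNIV. a (V i) (V i))" for V by (simp add: st.ea_def sum_Basis_vec syn_axis)
  have dim: "DIM(real^'n) = CARD('n)" by simp
  have xk0: "2 * x * sqrt (l * e2) \<le> 1"
  proof -
    define k where "k = sqrt (l * e2)"
    have N: "1 \<le> sqrt (real CARD('n))" using zero_less_card_finite[where 'a='n] by simp
    have "1 \<le> real CARD('n)" using zero_less_card_finite[where 'a='n] by simp
    then have e2l: "l \<le> e2" using e2 by linarith
    have kk: "k * k = l * e2" using l e2l by (simp add: k_def)
    \<comment> \<open>This is 2 (k - 1/2)^2 \<ge> 0 with room to spare; since k^2 = l e2, the right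
      side is dominated by the bracket in \<open>x_le\<close>.\<close>
    have "2 * k \<le> 2 * (k * k) + 1"
    proof -
      have "0 \<le> 2 * (k - 1/2)\<^sup>2" by simp
      then show ?thesis by (simp add: power2_eq_square algebra_simps)
    qed
    also have "\<dots> \<le> 2 * sqrt (real CARD('n)) * e2 * l\<^sup>2 + l"
    proof -
      have "1 * (l * e2) \<le> (sqrt (real CARD('n)) * l) * (l * e2)"
        using N l e2l mult_mono[of 1 "sqrt (real CARD('n))" 1 l] by (intro mult_right_mono) auto
      then show ?thesis using l by (simp add: kk power2_eq_square mult_ac)
    qed
    finally have "x * (2 * k) \<le> x * (2 * sqrt (real CARD('n)) * e2 * l\<^sup>2 + l)" using x by (intro mult_left_mono) auto
    then show ?thesis using x_le by (simp add: k_def)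
  qed
  interpret ss: scheme_step G "syn U" "syn Uh" "ana U" "ana Uh" x l H a "l - 1" "min (l - 1) (7/200)" e2
  proof unfold_locales
    show "- min (l - 1) (7/200) * (\<xi> \<bullet> \<xi>) \<le> \<xi> \<bullet> st.D \<xi>" for \<xi> unfolding stD by (rule def_ge)
    show "st.ea (syn U) \<le> e2" unfolding eaU by (rule ea)
    show "l + real DIM(real^'n) - 1 \<le> e2" unfolding dim by (rule e2)
    show "x * (2 * sqrt (real DIM(real^'n)) * e2 * l\<^sup>2 + l) \<le> 1" unfolding dim by (rule x_le)
    show "2 * x * sqrt (l * e2) \<le> 1" by (rule xk0)
  qed (rule refl)+
  have un: "syn U' = ss.un"
  proof (rule linear_axis_eq[OF syn_linear ss.un_linear])
    fix i
    have "(\<chi> k. (gram Uh Uh - mat 1) $ k $ i) = ana Uh (Uh i) - axis i 1"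
      by (simp add: vec_eq_iff gram_def ana_def mat_def axis_def)
    also have "\<dots> = st.D (axis i 1)" using st.gram_eq[of "axis i 1"] by (simp add: st.D_def syn_axis)
    finally show "syn U' (axis i 1) = ss.un (axis i 1)"
      unfolding syn_axis upd ss.un_def tmul_syn tG_def by (simp add: syn_map[OF linG])
  qed
  have D': "defect U' \<xi> = ss.Dn \<xi>" for \<xi>
  proof -
    have "\<zeta> \<bullet> defect U' \<xi> = \<zeta> \<bullet> ss.Dn \<xi>" for \<zeta>
      using ss.un_inner[of \<zeta> \<xi>] by (simp add: defect_def inner_diff_right syn_adj[symmetric] un)
    then show ?thesis by (rule vector_eq_ldot[THEN iffD1, rule_format])
  qed
  have W: "st.ea st.W = (\<Sum>i\<in>UNIV. a (A_op G U U i) (A_op G U U i))"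
    by (simp add: st.ea_def sum_Basis_vec st.W_def st.A_def syn_axis A_op_syn[OF linG])
  have W0: "0 \<le> st.ea st.W" by (intro st.ea_pos st.in_H)
  have F: "ss.inv_F c" if "2 \<le> CARD('n)"
    using inv that unfolding ss.inv_F_def invariant_def c_def stD es.sh_def by blast
  have N0: "CARD('n) = 1 \<or> 2 \<le> CARD('n)" using zero_less_card_finite[where 'a='n] by linarith
  have decay: "st.ea (syn U) - st.ea ss.un \<ge> 2 * x * ((1 / (2 * l) - ce * x) * st.ea st.W)"
    using N0
  proof
    assume N1: "CARD('n) = 1"
    show ?thesis
    proof (rule ss.decay_dim1)
      show "0 \<le> \<xi> \<bullet> st.D \<xi>" for \<xi> using inv N1 by (simp add: invariant_def stD)
    qed (use ce in simp)
  next
    assume N2: "2 \<le> CARD('n)"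
    show ?thesis by (rule ss.decay_N2[OF _ F[OF N2]]) (use N2 ce in \<open>simp_all add: c_def\<close>)
  qed
  then show "(\<Sum>i\<in>UNIV. a (U i) (U i)) - (\<Sum>i\<in>UNIV. a (U' i) (U' i))
      \<ge> 2 * x * ((1 / (2 * l) - ce * x) * (\<Sum>i\<in>UNIV. a (A_op G U U i) (A_op G U U i)))"
    by (simp only: eaU W un[symmetric])
  have "0 \<le> 2 * x * ((1 / (2 * l) - ce * x) * st.ea st.W)"
  proof -
    have "ce * x \<le> 1 / (2 * l)" using xce l by (simp add: pos_le_divide_eq mult_ac)
    then show ?thesis using x W0 by (intro mult_nonneg_nonneg) auto
  qed
  then have ea': "(\<Sum>i\<in>UNIV. a (U' i) (U' i)) \<le> e2"
    using decay ea by (simp only: eaU un[symmetric])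
  have U'H: "U' i \<in> H" for i using ss.un_in[of "axis i 1"] by (simp add: un[symmetric] syn_axis)
  have lower: "- min (l - 1) (7/200) * (\<xi> \<bullet> \<xi>) \<le> \<xi> \<bullet> defect U' \<xi>" for \<xi>
    using N0
  proof
    assume N1: "CARD('n) = 1"
    have "0 \<le> \<xi> \<bullet> ss.Dn \<xi>"
      by (rule ss.nonneg_next_dim1) (use inv N1 in \<open>simp_all add: invariant_def stD\<close>)
    moreover have "0 \<le> min (l - 1) (7/200) * (\<xi> \<bullet> \<xi>)" using l by simp
    ultimately show ?thesis unfolding D' mult_minus_left by linarith
  next
    assume N2: "2 \<le> CARD('n)"
    show ?thesis unfolding D' by (rule ss.lower_next) (use N2 in simp)
  qed
  show "invariant G H a l e2 U'"
    unfolding invariant_def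
  proof (intro conjI allI impI U'H ea' lower)
    show "\<xi> \<bullet> defect U' \<xi> \<le> (l - 1) * (\<xi> \<bullet> \<xi>)" for \<xi> unfolding D' by (rule ss.upper_next)
    show "0 \<le> \<xi> \<bullet> defect U' \<xi>" if "CARD('n) = 1" for \<xi>
      unfolding D' by (rule ss.nonneg_next_dim1) (use inv that in \<open>simp_all add: invariant_def stD\<close>)
    show "0 \<le> (l - 1) * (\<phi> \<bullet> defect U' \<phi>) - (norm (defect U' \<phi>))\<^sup>2
        + (l - 1) * (2 / (5 * sqrt (real CARD('n)))) * (norm (G (syn U' \<phi>) - \<mu> *\<^sub>R syn U' \<phi>))\<^sup>2"
      if "2 \<le> CARD('n)" "0 \<le> \<mu>" "\<mu> \<le> 1" for \<phi> \<mu>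
    proof -
      have "2 \<le> real DIM(real^'n)" "c = 2 / (5 * sqrt (real DIM(real^'n)))" using that(1) by (simp_all add: c_def)
      from ss.inv_F_next[OF this(1) F[OF that(1)] this(2) that(2,3), of \<phi>]
      show ?thesis unfolding D' un c_def es.sh_def .
    qed
  qed
qed

theorem theorem4p5:
  fixes H :: "'v::real_inner set" and a :: "'v \<Rightarrow> 'v \<Rightarrow> real" and G :: "'v \<Rightarrow> 'v"
    and c\<Omega> lam1 :: real
    and U Uh :: "nat \<Rightarrow> 'n::finite \<Rightarrow> 'v" and \<tau> :: "nat \<Rightarrow> real"
  assumes st: "standing H a G c\<Omega> lam1"
    and U0H: "\<forall>i. U 0 i \<in> H"
    and U0: "quasi_stiefel (U 0)"
    and tau_pos: "\<forall>n. \<tau> n > 0"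
    and stage1: "\<forall>n. Uh n = (\<lambda>i. U n i + \<tau> n *\<^sub>R A_op G (U n) (\<lambda>k. (1/2) *\<^sub>R (Uh n k + U n k)) i)"
    and stage2: "\<forall>n. U (Suc n) = (\<lambda>i. Uh n i - \<tau> n *\<^sub>R tmul (tG G (Uh n)) (gram (Uh n) (Uh n) - mat 1) i)"
    and tau_small: "\<forall>n. \<tau> n < min
        (lam1 / (2 * (2 * (sqrt 2 * energy a (U 0) / lam1
              + c\<Omega>^2 * sqrt (energy a (U 0) * lambda_max (gram (U 0) (U 0))))
            * sqrt (real CARD('n) * energy a (U 0) * lambda_max (gram (U 0) (U 0))) + 1/2)
          * lambda_max (gram (U 0) (U 0))))
        (lam1 / (2 * sqrt (2 * energy a (U 0) * lambda_max (gram (U 0) (U 0)))))"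
  shows "\<forall>n. energy a (U n) - energy a (U (Suc n)) \<ge>
      (lam1 / (2 * lambda_max (gram (U 0) (U 0)))
        - (2 * (sqrt 2 * energy a (U 0) / lam1
              + c\<Omega>^2 * sqrt (energy a (U 0) * lambda_max (gram (U 0) (U 0))))
            * sqrt (real CARD('n) * energy a (U 0) * lambda_max (gram (U 0) (U 0))) + 1/2) * \<tau> n)
      * \<tau> n * (tnorm_a a (A_op G (U n) (U n)))^2"
proof -
  define l where "l = lambda_max (gram (U 0) (U 0))"
  define E where "E = energy a (U 0)"
  define ce where "ce = 2 * (sqrt 2 * E / lam1 + c\<Omega>^2 * sqrt (E * l)) * sqrt (real CARD('n) * E * l) + 1/2"
  \<comment> \<open>Rescaling to lambda1 = 1. The scheme is linear in G apart from the tuple, so the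
    factor of \<open>G1\<close> is compensated by x = \<tau> / lam1.\<close>
  define G1 where "G1 = (\<lambda>v. lam1 *\<^sub>R G v)"
  define a1 where "a1 = (\<lambda>v w. a v w / lam1)"
  define e2 where "e2 = 2 * E / lam1"
  define x where "x n = \<tau> n / lam1" for n
  note sf = standing_facts[OF st]
  have lam: "0 < lam1" by (rule sf)
  interpret es: energy_space G1 H a1 unfolding G1_def a1_def by (rule sf)
  have N0: "1 \<le> real CARD('n)" using zero_less_card_finite[where 'a='n] by simp
  have tn: "(tnorm_a a V)\<^sup>2 = (\<Sum>i\<in>UNIV. a (V i) (V i))" if "\<And>i. V i \<in> H" for V :: "'n \<Rightarrow> 'v"
  proof -
    have "0 \<le> a v v" if "v \<in> H" for v using st that unfolding standing_def by blast
    then have "0 \<le> (\<Sum>i\<in>UNIV. a (V i) (V i))" using that by (intro sum_nonneg) auto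
    then show ?thesis by (simp add: tnorm_a_def mtrace_def gram_a_def)
  qed
  have en: "energy a V = lam1 / 2 * (\<Sum>i\<in>UNIV. a1 (V i) (V i))" if "\<And>i. V i \<in> H" for V :: "'n \<Rightarrow> 'v"
    using lam by (simp add: energy_def tn[OF that] a1_def sum_divide_distrib[symmetric])
  have def0: "0 \<le> \<xi> \<bullet> defect (U 0) \<xi>" for \<xi>
    using U0 by (simp add: quasi_stiefel_def psd_def matrix_vector_mult_diff_rdistrib gram_mult defect_def)
  have def_le: "\<xi> \<bullet> defect (U 0) \<xi> \<le> (l - 1) * (\<xi> \<bullet> \<xi>)" for \<xi>
    using lambda_max_gram(1)[of "U 0" \<xi>] by (simp add: l_def defect_def syn_adj inner_diff_right left_diff_distrib)
  obtain e where e: "norm e = 1" "syn (U 0) e \<bullet> syn (U 0) e = l" using lambda_max_gram(2)[of "U 0"] by (auto simp: l_def)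
  have ed: "e \<bullet> defect (U 0) e = l - 1" using e by (simp add: defect_def inner_diff_right syn_adj norm_eq_1)
  have l1: "1 \<le> l" using def0[of e] ed by simp
  have dlin: "linear (defect (U 0))"
    unfolding defect_def by (rule linearI) (simp_all add: linear_add[OF syn_linear] linear_add[OF ana_linear]
        linear_scale[OF syn_linear] linear_scale[OF ana_linear] algebra_simps)
  have dsym: "defect (U 0) v \<bullet> w = v \<bullet> defect (U 0) w" for v w
    unfolding defect_def inner_diff_left inner_diff_right by (metis inner_commute syn_adj)
  have e2_eq: "e2 = (\<Sum>i\<in>UNIV. a1 (U 0 i) (U 0 i))"
    using U0H lam by (simp add: e2_def E_def en)
  \<comment> \<open>The initial defect is nonnegative, so its largest eigenvalue l - 1 is at most
    its trace tr S0 - N, and tr S0 is at most e2 by the Rayleigh bound.\<close>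
  have e2_ge: "l + real CARD('n) - 1 \<le> e2"
  proof -
    have "l - 1 \<le> (\<Sum>b\<in>Basis. b \<bullet> defect (U 0) b) * (e \<bullet> e)"
      using psd_le_trace[OF dlin dsym def0, of e] ed by simp
    also have "\<dots> = (\<Sum>i\<in>UNIV. U 0 i \<bullet> U 0 i - 1)"
      using e(1) by (simp add: sum_Basis_vec norm_eq_1 defect_def inner_diff_right syn_adj[symmetric] syn_axis)
    also have "\<dots> = (\<Sum>i\<in>UNIV. U 0 i \<bullet> U 0 i) - real CARD('n)" by (simp add: sum_subtractf)
    also have "\<dots> \<le> e2 - real CARD('n)" unfolding e2_eq using U0H by (intro diff_right_mono sum_mono es.a_ge) auto
    finally show ?thesis by simp
  qed
  have e2l: "0 < e2" "l \<le> e2" using e2_ge N0 l1 by linarith+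
  have Epos: "0 < E" using e2l(1) lam by (simp add: e2_def zero_less_divide_iff)
  \<comment> \<open>The product of the two square roots is sqrt N E l, and 1 / lam1 \<le>
    c\<Omega>^2 converts 2 E / lam1 = e2 into the form in which it occurs in
    \<open>ce\<close>.\<close>
  have ce: "sqrt (real CARD('n)) * e2 * l + 1/2 \<le> ce"
  proof -
    let ?s = "sqrt (real CARD('n) * E * l)"
    have s: "sqrt (E * l) * ?s = sqrt (real CARD('n)) * (E * l)"
    proof -
      have "?s = sqrt (real CARD('n)) * sqrt (E * l)" by (simp only: mult.assoc real_sqrt_mult[of "real CARD('n)" "E * l"])
      moreover have "sqrt (E * l) * sqrt (E * l) = E * l" using Epos l1 by simp
      moreover have "sqrt (E * l) * (sqrt (real CARD('n)) * sqrt (E * l)) = sqrt (real CARD('n)) * (sqrt (E * l) * sqrt (E * l))"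
        by (simp only: mult.left_commute)
      ultimately show ?thesis by (simp only:)
    qed
    have "e2 \<le> 2 * (c\<Omega>\<^sup>2 * E)"
    proof -
      have "1 / lam1 \<le> c\<Omega>\<^sup>2" using sf(2) lam by (simp add: pos_divide_le_eq)
      then have "1 / lam1 * (2 * E) \<le> c\<Omega>\<^sup>2 * (2 * E)" using Epos by (intro mult_right_mono) auto
      then show ?thesis by (simp add: e2_def mult_ac)
    qed
    then have "sqrt (real CARD('n)) * l * e2 \<le> sqrt (real CARD('n)) * l * (2 * (c\<Omega>\<^sup>2 * E))"
      using l1 by (intro mult_left_mono) auto
    also have "\<dots> = 2 * (c\<Omega>^2 * (sqrt (E * l) * ?s))" unfolding s by simp
    also have "\<dots> \<le> 2 * (sqrt 2 * E / lam1 * ?s) + 2 * (c\<Omega>^2 * (sqrt (E * l) * ?s))"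
      using Epos lam l1 by simp
    also have "\<dots> = ce - 1/2" by (simp add: ce_def distrib_left distrib_right mult.assoc)
    finally show ?thesis by (simp add: mult_ac)
  qed
  have cep: "0 < ce"
  proof -
    have "0 \<le> sqrt (real CARD('n)) * e2 * l" using e2l l1 by simp
    then show ?thesis using ce by linarith
  qed
  have xp: "0 < x n" for n using tau_pos lam by (simp add: x_def)
  have xce: "2 * (ce * x n * l) \<le> 1" for n
  proof -
    have "\<tau> n < lam1 / (2 * ce * l)" using tau_small by (simp add: ce_def E_def l_def)
    then have "\<tau> n * (2 * ce * l) < lam1" using cep l1 by (simp add: pos_less_divide_eq)
    then have "\<tau> n * (2 * ce * l) / lam1 < 1" using lam by (simp add: pos_divide_less_eq)
    then show ?thesis by (simp add: x_def mult_ac)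
  qed
  have x_le: "x n * (2 * sqrt (real CARD('n)) * e2 * l\<^sup>2 + l) \<le> 1" for n
  proof -
    have "(sqrt (real CARD('n)) * e2 * l + 1/2) * (2 * (x n * l)) \<le> ce * (2 * (x n * l))"
      using ce xp[of n] l1 by (intro mult_right_mono) auto
    also have "\<dots> \<le> 1" using xce[of n] by (simp add: mult_ac)
    finally show ?thesis by (simp add: power2_eq_square algebra_simps)
  qed
  have AG: "A_op G1 V Z i = lam1 *\<^sub>R A_op G V Z i" for V Z :: "'n \<Rightarrow> 'v" and i
    unfolding A_op_syn[OF es.G_linear] A_op_syn[OF sf(4)]
    by (simp add: G1_def linear_scale[OF syn_linear] linear_scale[OF ana_linear] scaleR_diff_right)
  have tGG: "tmul (tG G1 V) M i = lam1 *\<^sub>R tmul (tG G V) M i" for V :: "'n \<Rightarrow> 'v" and M i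
    by (simp add: tmul_def tG_def G1_def scaleR_right.sum mult.commute)
  have mid: "Uh n i = U n i + x n *\<^sub>R A_op G1 (U n) (\<lambda>k. (1/2) *\<^sub>R (Uh n k + U n k)) i" for n i
    using lam fun_cong[OF stage1[rule_format, of n], of i] by (simp add: AG x_def)
  have upd: "U (Suc n) i = Uh n i - x n *\<^sub>R tmul (tG G1 (Uh n)) (gram (Uh n) (Uh n) - mat 1) i" for n i
    using lam fun_cong[OF stage2[rule_format, of n], of i] by (simp add: tGG x_def)
  have inv: "invariant G1 H a1 l e2 (U n)" for n
  proof (induction n)
    case 0
    show ?case unfolding invariant_def
    proof (intro conjI allI impI def_le def0)
      show "(\<Sum>i\<in>UNIV. a1 (U 0 i) (U 0 i)) \<le> e2" by (simp add: e2_eq)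
      show "- min (l - 1) (7/200) * (\<xi> \<bullet> \<xi>) \<le> \<xi> \<bullet> defect (U 0) \<xi>" for \<xi>
      proof -
        have "0 \<le> min (l - 1) (7/200) * (\<xi> \<bullet> \<xi>)" using l1 by simp
        then show ?thesis using def0[of \<xi>] unfolding mult_minus_left by linarith
      qed
      show "0 \<le> (l - 1) * (\<phi> \<bullet> defect (U 0) \<phi>) - (norm (defect (U 0) \<phi>))\<^sup>2
        + (l - 1) * (2 / (5 * sqrt (real CARD('n)))) * (norm (G1 (syn (U 0) \<phi>) - \<mu> *\<^sub>R syn (U 0) \<phi>))\<^sup>2" for \<phi> \<mu>
      \<comment> \<open>Initially 0 \<le> D \<le> l - 1 gives D^2 \<le> (l - 1) D, so the first two
        terms together are already nonnegative.\<close>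
      proof -
        have "defect (U 0) \<phi> \<bullet> defect (U 0) \<phi> \<le> (l - 1) * (\<phi> \<bullet> defect (U 0) \<phi>)"
          by (rule psd_square_le[OF dlin dsym def0 def_le]) (use l1 in simp)
        moreover have "0 \<le> (l - 1) * (2 / (5 * sqrt (real CARD('n)))) * (norm (G1 (syn (U 0) \<phi>) - \<mu> *\<^sub>R syn (U 0) \<phi>))\<^sup>2"
          using l1 by simp
        ultimately show ?thesis by (simp add: power2_norm_eq_inner)
      qed
    qed (use U0H in simp)
  next
    case (Suc n)
    show ?case
      by (rule invariant_step(1)[OF es.energy_space_axioms l1 xp e2_ge x_le ce xce Suc mid upd])
  qed
  have UH: "U n i \<in> H" for n i using inv[of n] by (simp add: invariant_def)
  have AH: "A_op G (U n) (U n) i \<in> H" for n i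
  proof -
    have GH: "G v \<in> H" for v using st unfolding standing_def by blast
    show ?thesis unfolding A_op_syn[OF sf(4)]
      by (intro subspace_diff[OF es.H_sub] syn_in[OF es.H_sub] UH GH)
  qed
  show ?thesis
  proof
    fix n
    let ?A = "\<Sum>i\<in>UNIV. a (A_op G (U n) (U n) i) (A_op G (U n) (U n) i)"
    have "a1 (A_op G1 (U n) (U n) i) (A_op G1 (U n) (U n) i) = lam1 * a (A_op G (U n) (U n) i) (A_op G (U n) (U n) i)" for i
    proof -
      have "a1 (A_op G1 (U n) (U n) i) (A_op G1 (U n) (U n) i) = lam1 * (lam1 * a1 (A_op G (U n) (U n) i) (A_op G (U n) (U n) i))"
        unfolding AG using AH by (simp add: es.a_lin es.H_closed)
      then show ?thesis using lam by (simp add: a1_def)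
    qed
    then have A1: "(\<Sum>i\<in>UNIV. a1 (A_op G1 (U n) (U n) i) (A_op G1 (U n) (U n) i)) = lam1 * ?A"
      by (simp add: sum_distrib_left)
    have "(\<Sum>i\<in>UNIV. a1 (U n i) (U n i)) - (\<Sum>i\<in>UNIV. a1 (U (Suc n) i) (U (Suc n) i))
        \<ge> 2 * x n * ((1 / (2 * l) - ce * x n) * (lam1 * ?A))"
      using invariant_step(2)[OF es.energy_space_axioms l1 xp[of n] e2_ge x_le[of n] ce xce[of n] inv[of n] mid[of n] upd[of n]]
      unfolding A1 .
    then have "lam1 / 2 * (2 * x n * ((1 / (2 * l) - ce * x n) * (lam1 * ?A)))
        \<le> lam1 / 2 * ((\<Sum>i\<in>UNIV. a1 (U n i) (U n i)) - (\<Sum>i\<in>UNIV. a1 (U (Suc n) i) (U (Suc n) i)))"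
      using lam by (intro mult_left_mono) auto
    also have "\<dots> = energy a (U n) - energy a (U (Suc n))" using UH by (simp add: en right_diff_distrib)
    also have "lam1 / 2 * (2 * x n * ((1 / (2 * l) - ce * x n) * (lam1 * ?A))) = (lam1 / (2 * l) - ce * \<tau> n) * \<tau> n * ?A"
      using lam l1 by (simp add: x_def field_simps)
    also have "?A = (tnorm_a a (A_op G (U n) (U n)))\<^sup>2" using AH by (simp add: tn)
    finally show "energy a (U n) - energy a (U (Suc n)) \<ge>
      (lam1 / (2 * lambda_max (gram (U 0) (U 0)))
        - (2 * (sqrt 2 * energy a (U 0) / lam1
              + c\<Omega>^2 * sqrt (energy a (U 0) * lambda_max (gram (U 0) (U 0))))
            * sqrt (real CARD('n) * energy a (U 0) * lambda_max (gram (U 0) (U 0))) + 1/2) * \<tau> n)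
      * \<tau> n * (tnorm_a a (A_op G (U n) (U n)))^2"
      by (simp only: ce_def E_def l_def)
  qed
qed

end
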